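(* Let $S$ be the Sierpinski gasket in $\mathbb{R}^2$ with boundary vertices $\Gamma=\{a_1,a_2,a_3\}$, let $S^n$ be its $n$-th prefractal network, let $f:S\to\mathbb{R}$ be continuous with $\inf_S f>0$, and let $g:\Gamma\to\mathbb{R}$ satisfy $$g(x)\le \inf\Big\{\int_0^T f(\xi(t))\,dt+g(y)\Big\}\qquad\text{for all }x,y\in\Gamma,$$ where the infimum is over all $T\ge 0$ and all absolutely continuous curves $\xi:[0,T]\to S$ with metric derivative $|\xi'|\le 1$ a.e., $\xi(0)=x$ and $\xi(T)=y$. For each $n$ let $u_n:S^n\to\mathbb{R}$ be the (network) viscosity solution of $|Du|=f$ in $S^n\setminus\Gamma$ with $u_n=g$ on $\Gamma$, and let $u:S\to\mathbb{R}$ be the metric viscosity solution of $|Du|=f$ in $S\setminus \Gamma$ with $u=g$ on $\Gamma$. Then $u_n\to u$ uniformly as $n\to+\infty$, i.e. $$\lim_{n\to\infty}\ \sup_{x\in S^n}|u_n(x)-u(x)|=0 .$$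
   Context: **Gasket and prefractals.** $a_1,a_2,a_3$ are the vertices of an equilateral triangle of side $1$ in $\mathbb{R}^2$, $\Gamma=\{a_1,a_2,a_3\}$, $\psi_i(x)=a_i+\frac12(x-a_i)$. $V^n$ is the union of the images of $\Gamma$ under all $n$-fold compositions $\psi_{i_1}\circ\dots\circ\psi_{i_n}$; $S$ is the closure of $\bigcup_n V^n$ (the unique nonempty compact $K$ with $K=\bigcup_i\psi_i(K)$). $E^n$ is the set of closed segments (edges, each of length $h_n=2^{-n}$) that are images of a side of the initial triangle under some $\psi_{i_1}\circ\dots\circ\psi_{i_n}$; $S^n\subset S$ is the union of the edges in $E^n$; $V^n_0=V^n\setminus\Gamma$. **Distance.** $d(x,y)$ is the geodesic distance on $S$: the infimum of the lengths of paths in $S$ joining $x$ to $y$. **Network viscosity solutions on $S^n$.** Label the edges of $E^n$ as $e_j$ and let $\pi_j:[0,h_n]\to e_j$ be an arc-length parametrization. For $x_i\in V^n$ let $Inc_i=\{j: x_i\in e_j\}$, and $a_{ij}=1$ if $\pi_j(0)=x_i$, $a_{ij}=-1$ if $\pi_j(h_n)=x_i$. For $\phi:S^n\to\mathbb{R}$ put $\phi_j=\phi\circ\pi_j$ and $D_j\phi(x)=\phi_j'(\pi_j^{-1}(x))$ (one-sided at endpoints). For $x$ in the relative interior of $e_j$, a test function at $x$ is a $\phi\in C(S^n)$ with $\phi_j$ differentiable at $\pi_j^{-1}(x)$. For $x=x_i\in V_0^n$ and $j\ne k$ in $Inc_i$, a $(j,k)$-test function at $x$ is a $\phi\in C(S^n)$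 with $\phi_j,\phi_k$ differentiable at $\pi_j^{-1}(x)$, $\pi_k^{-1}(x)$ and $a_{ij}D_j\phi(x)+a_{ik}D_k\phi(x)=0$. An upper semicontinuous $u$ on $S^n$ is a subsolution of $|Du|=f$ if (a) at each $x$ interior to an edge $e_j$, $|D_j\phi(x)|\le f(x)$ for every test function $\phi$ at $x$ such that $u-\phi$ has a local maximum at $x$; (b) at each $x=x_i\in V^n_0$, for all $j\ne k$ in $Inc_i$ and all $(j,k)$-test functions $\phi$ such that $u-\phi$ has a local maximum at $x$ relative to $e_j\cup e_k$, $|D_j\phi(x)|\le f(x)$. A lower semicontinuous $v$ on $S^n$ is a supersolution if (a) at each $x$ interior to an edge $e_j$, $|D_j\phi(x)|\ge f(x)$ for every test function $\phi$ at $x$ such that $v-\phi$ has a local minimum at $x$; (b) at each $x=x_i\in V^n_0$, for every $j\in Inc_i$ there is $k\in Inc_i\setminus\{j\}$ such that for all $(j,k)$-test functions $\phi$ for which $v-\phi$ has a local minimum at $x$ relative to $e_j\cup e_k$, $|D_j\phi(x)|\ge f(x)$. A solution is both. Known fact: under the compatibility condition, the unique solution with $u_n=g$ on $\Gamma$ is $u_n(x)=\inf\{\int_0^T f(\xi(t))dt+g(y)\}$, the infimum over $y\in\Gamma$ and piecewise differentiable paths $\xi:[0,T]\to S^n$ with speed at most $1$, $\xi(0)=x$, $\xi(T)=y$. **Metric viscosity solutions on $S$.** For a curve $\xi:I\to S$ ($I$ an interval) the metric derivative is $|\xi'|(t)=\lim_{s\to t}d(\xi(s),\xi(t))/|s-t|$;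 $\xi$ is absolutely continuous if $|\xi'|(t)$ exists for a.e. $t$, $|\xi'|\in L^1_{loc}(I)$ and $d(\xi(s),\xi(t))\le\int_s^t|\xi'|(r)dr$ for $s\le t$. An admissible curve is an absolutely continuous one with $|\xi'|\le1$ a.e. Let $\Omega=S\setminus\Gamma$ (so $\partial\Omega=\Gamma$). A function is arcwise upper (lower) semicontinuous if its composition with every admissible curve is upper (lower) semicontinuous. $D^{+}w(t)$, $D^-w(t)$ denote the super- and subdifferential of $w$ at $t$ in the usual viscosity sense. An arcwise upper semicontinuous $u$ is a subsolution of $|Du|=f$ in $\Omega$ if for each $x\in\Omega$ and each admissible curve $\xi:I\to\Omega$, $I$ an open interval containing $0$, $\xi(0)=x$, the function $w=u\circ\xi$ satisfies $|p|\le f(x)$ for all $p\in D^+w(0)$. An arcwise lower semicontinuous $v$ is a supersolution if for each $x\in\Omega$ and $\varepsilon>0$ there are an admissible curve $\xi:\mathbb{R}\to S$ with $\xi(0)=x$ and a lower semicontinuous $w:\mathbb{R}\to\mathbb{R}$ such that $T^+=\inf\{t\ge0:\xi(t)\in\partial\Omega\}$ and $T^-=\sup\{t\le0:\xi(t)\in\partial\Omega\}$ are both finite, $w(0)=v(x)$, $w(t)\ge v(\xi(t))-\varepsilon$ for $t\in(T^-,T^+)$, and $|p|\ge f(\xi(t))-\varepsilon$ for all $p\in D^-w(t)$, $t\in(T^-,T^+)$. A solution is both. Known fact: under the compatibility condition, the unique solution with $u=g$ on $\Gamma$ is the continuous function $u(x)=\inf\{\int_0^T f(\xi(t))dt+g(y)\}$,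 the infimum over $y\in\Gamma$ and admissible curves $\xi:[0,T]\to S$ with $\xi(0)=x$, $\xi(T)=y$. *)

theory Defs
  imports "HOL-Analysis.Analysis"
begin

definition unit_equilateral :: "(3 \<Rightarrow> real^2) \<Rightarrow> bool" where
  "unit_equilateral a \<longleftrightarrow> (\<forall>i j. i \<noteq> j \<longrightarrow> dist (a i) (a j) = 1)"

abbreviation bdry :: "(3 \<Rightarrow> real^2) \<Rightarrow> (real^2) set" where
  "bdry a \<equiv> range a"

definition psi :: "(3 \<Rightarrow> real^2) \<Rightarrow> 3 \<Rightarrow> real^2 \<Rightarrow> real^2" where
  "psi a i x = a i + (1/2) *\<^sub>R (x - a i)"

fun psi_word :: "(3 \<Rightarrow> real^2) \<Rightarrow> 3 list \<Rightarrow> real^2 \<Rightarrow> real^2" where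
  "psi_word a [] = id"
| "psi_word a (i # w) = psi a i \<circ> psi_word a w"

definition vertices :: "(3 \<Rightarrow> real^2) \<Rightarrow> nat \<Rightarrow> (real^2) set" where
  "vertices a n = (\<Union>w\<in>{w. length w = n}. psi_word a w ` bdry a)"

definition inner_vertices :: "(3 \<Rightarrow> real^2) \<Rightarrow> nat \<Rightarrow> (real^2) set" where
  "inner_vertices a n = vertices a n - bdry a"

definition gasket :: "(3 \<Rightarrow> real^2) \<Rightarrow> (real^2) set" where
  "gasket a = closure (\<Union>n. vertices a n)"

definition edges :: "(3 \<Rightarrow> real^2) \<Rightarrow> nat \<Rightarrow> (real^2) set set" where
  "edges a n = {psi_word a w ` closed_segment (a i) (a j) | w i j. length w = n \<and> i \<noteq> j}"

definition network :: "(3 \<Rightarrow> real^2) \<Rightarrow> nat \<Rightarrow> (real^2) set" where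
  "network a n = \<Union>(edges a n)"

definition edge_length :: "nat \<Rightarrow> real" where
  "edge_length n = (1/2) ^ n"

definition usc_on :: "'a::topological_space set \<Rightarrow> ('a \<Rightarrow> real) \<Rightarrow> bool" where
  "usc_on A u \<longleftrightarrow> (\<forall>x\<in>A. \<forall>c. u x < c \<longrightarrow> eventually (\<lambda>y. u y < c) (at x within A))"

definition lsc_on :: "'a::topological_space set \<Rightarrow> ('a \<Rightarrow> real) \<Rightarrow> bool" where
  "lsc_on A u \<longleftrightarrow> (\<forall>x\<in>A. \<forall>c. c < u x \<longrightarrow> eventually (\<lambda>y. c < u y) (at x within A))"

definition local_max_on :: "'a::topological_space set \<Rightarrow> ('a \<Rightarrow> real) \<Rightarrow> 'a \<Rightarrow> bool" where
  "local_max_on A w x \<longleftrightarrow> eventually (\<lambda>y. w y \<le> w x) (at x within A)"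

definition local_min_on :: "'a::topological_space set \<Rightarrow> ('a \<Rightarrow> real) \<Rightarrow> 'a \<Rightarrow> bool" where
  "local_min_on A w x \<longleftrightarrow> eventually (\<lambda>y. w x \<le> w y) (at x within A)"

definition superdiff :: "(real \<Rightarrow> real) \<Rightarrow> real \<Rightarrow> real set" where
  "superdiff w t =
     {p. Limsup (at t) (\<lambda>s. ereal ((w s - w t - p * (s - t)) / \<bar>s - t\<bar>)) \<le> 0}"

definition subdiff :: "(real \<Rightarrow> real) \<Rightarrow> real \<Rightarrow> real set" where
  "subdiff w t =
     {p. Liminf (at t) (\<lambda>s. ereal ((w s - w t - p * (s - t)) / \<bar>s - t\<bar>)) \<ge> 0}"

text \<open>The edges serve as their own labels, so \<open>\<pi> e\<close> is the parametrization of the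
  edge \<open>e\<close>. For a segment, an arc-length parametrization is the same as an isometry from
  \<open>[0, h\<^sub>n]\<close> onto it. Edges of different levels have different lengths, so
  the level need not be an argument of \<open>\<pi>\<close>.\<close>

definition arclength_params :: "(3 \<Rightarrow> real^2) \<Rightarrow> ((real^2) set \<Rightarrow> real \<Rightarrow> real^2) \<Rightarrow> bool" where
  "arclength_params a \<pi> \<longleftrightarrow> (\<forall>n. \<forall>e\<in>edges a n.
      \<pi> e ` {0..edge_length n} = e \<and>
      (\<forall>s\<in>{0..edge_length n}. \<forall>t\<in>{0..edge_length n}. dist (\<pi> e s) (\<pi> e t) = \<bar>s - t\<bar>))"

definition incident :: "(3 \<Rightarrow> real^2) \<Rightarrow> nat \<Rightarrow> real^2 \<Rightarrow> (real^2) set set" where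
  "incident a n x = {e \<in> edges a n. x \<in> e}"

text \<open>Junk value \<open>0\<close> when \<open>x\<close> is not an endpoint of \<open>e\<close>.\<close>

definition orient :: "((real^2) set \<Rightarrow> real \<Rightarrow> real^2) \<Rightarrow> nat \<Rightarrow> real^2 \<Rightarrow> (real^2) set \<Rightarrow> real" where
  "orient \<pi> n x e =
     (if \<pi> e 0 = x then 1 else if \<pi> e (edge_length n) = x then -1 else 0)"

definition edge_coord ::
    "((real^2) set \<Rightarrow> real \<Rightarrow> real^2) \<Rightarrow> nat \<Rightarrow> (real^2) set \<Rightarrow> real^2 \<Rightarrow> real" where
  "edge_coord \<pi> n e x = inv_into {0..edge_length n} (\<pi> e) x"

definition edge_differentiable ::
    "((real^2) set \<Rightarrow> real \<Rightarrow> real^2) \<Rightarrow> nat \<Rightarrow> (real^2) set \<Rightarrow> (real^2 \<Rightarrow> real) \<Rightarrow> real^2 \<Rightarrow> bool" where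
  "edge_differentiable \<pi> n e \<phi> x \<longleftrightarrow>
     (\<phi> \<circ> \<pi> e) differentiable (at (edge_coord \<pi> n e x) within {0..edge_length n})"

definition edge_deriv ::
    "((real^2) set \<Rightarrow> real \<Rightarrow> real^2) \<Rightarrow> nat \<Rightarrow> (real^2) set \<Rightarrow> (real^2 \<Rightarrow> real) \<Rightarrow> real^2 \<Rightarrow> real" where
  "edge_deriv \<pi> n e \<phi> x =
     vector_derivative (\<phi> \<circ> \<pi> e) (at (edge_coord \<pi> n e x) within {0..edge_length n})"

definition edge_test ::
    "(3 \<Rightarrow> real^2) \<Rightarrow> ((real^2) set \<Rightarrow> real \<Rightarrow> real^2) \<Rightarrow> nat \<Rightarrow> (real^2) set \<Rightarrow> real^2 \<Rightarrow>
     (real^2 \<Rightarrow> real) \<Rightarrow> bool" where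
  "edge_test a \<pi> n e x \<phi> \<longleftrightarrow>
     continuous_on (network a n) \<phi> \<and> edge_differentiable \<pi> n e \<phi> x"

definition vertex_test ::
    "(3 \<Rightarrow> real^2) \<Rightarrow> ((real^2) set \<Rightarrow> real \<Rightarrow> real^2) \<Rightarrow> nat \<Rightarrow> (real^2) set \<Rightarrow> (real^2) set \<Rightarrow>
     real^2 \<Rightarrow> (real^2 \<Rightarrow> real) \<Rightarrow> bool" where
  "vertex_test a \<pi> n e e' x \<phi> \<longleftrightarrow>
     continuous_on (network a n) \<phi> \<and>
     edge_differentiable \<pi> n e \<phi> x \<and> edge_differentiable \<pi> n e' \<phi> x \<and>
     orient \<pi> n x e * edge_deriv \<pi> n e \<phi> x + orient \<pi> n x e' * edge_deriv \<pi> n e' \<phi> x = 0"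

definition network_subsolution ::
    "(3 \<Rightarrow> real^2) \<Rightarrow> ((real^2) set \<Rightarrow> real \<Rightarrow> real^2) \<Rightarrow> nat \<Rightarrow> (real^2 \<Rightarrow> real) \<Rightarrow>
     (real^2 \<Rightarrow> real) \<Rightarrow> bool" where
  "network_subsolution a \<pi> n f u \<longleftrightarrow>
     usc_on (network a n) u \<and>
     (\<forall>e\<in>edges a n. \<forall>x\<in>rel_interior e. \<forall>\<phi>.
        edge_test a \<pi> n e x \<phi> \<and> local_max_on (network a n) (\<lambda>y. u y - \<phi> y) x \<longrightarrow>
        \<bar>edge_deriv \<pi> n e \<phi> x\<bar> \<le> f x) \<and>
     (\<forall>x\<in>inner_vertices a n. \<forall>e\<in>incident a n x. \<forall>e'\<in>incident a n x - {e}. \<forall>\<phi>.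
        vertex_test a \<pi> n e e' x \<phi> \<and> local_max_on (e \<union> e') (\<lambda>y. u y - \<phi> y) x \<longrightarrow>
        \<bar>edge_deriv \<pi> n e \<phi> x\<bar> \<le> f x)"

definition network_supersolution ::
    "(3 \<Rightarrow> real^2) \<Rightarrow> ((real^2) set \<Rightarrow> real \<Rightarrow> real^2) \<Rightarrow> nat \<Rightarrow> (real^2 \<Rightarrow> real) \<Rightarrow>
     (real^2 \<Rightarrow> real) \<Rightarrow> bool" where
  "network_supersolution a \<pi> n f v \<longleftrightarrow>
     lsc_on (network a n) v \<and>
     (\<forall>e\<in>edges a n. \<forall>x\<in>rel_interior e. \<forall>\<phi>.
        edge_test a \<pi> n e x \<phi> \<and> local_min_on (network a n) (\<lambda>y. v y - \<phi> y) x \<longrightarrow>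
        \<bar>edge_deriv \<pi> n e \<phi> x\<bar> \<ge> f x) \<and>
     (\<forall>x\<in>inner_vertices a n. \<forall>e\<in>incident a n x. \<exists>e'\<in>incident a n x - {e}. \<forall>\<phi>.
        vertex_test a \<pi> n e e' x \<phi> \<and> local_min_on (e \<union> e') (\<lambda>y. v y - \<phi> y) x \<longrightarrow>
        \<bar>edge_deriv \<pi> n e \<phi> x\<bar> \<ge> f x)"

definition network_solution ::
    "(3 \<Rightarrow> real^2) \<Rightarrow> ((real^2) set \<Rightarrow> real \<Rightarrow> real^2) \<Rightarrow> nat \<Rightarrow> (real^2 \<Rightarrow> real) \<Rightarrow>
     (real^2 \<Rightarrow> real) \<Rightarrow> bool" where
  "network_solution a \<pi> n f u \<longleftrightarrow>
     network_subsolution a \<pi> n f u \<and> network_supersolution a \<pi> n f u"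

definition path_len :: "(real \<Rightarrow> real^2) \<Rightarrow> ennreal" where
  "path_len \<gamma> = (SUP ts\<in>{ts. sorted ts \<and> set ts \<subseteq> {0..1}}.
     \<Sum>i<length ts - 1. ennreal (dist (\<gamma> (ts ! i)) (\<gamma> (ts ! Suc i))))"

text \<open>Any two points of the gasket are joined by a path of finite length in it, so
  \<^const>\<open>enn2real\<close> loses nothing there.\<close>

definition geodist :: "(3 \<Rightarrow> real^2) \<Rightarrow> real^2 \<Rightarrow> real^2 \<Rightarrow> real" where
  "geodist a x y = enn2real (INF \<gamma>\<in>{\<gamma>. path \<gamma> \<and> path_image \<gamma> \<subseteq> gasket a \<and>
     pathstart \<gamma> = x \<and> pathfinish \<gamma> = y}. path_len \<gamma>)"

definition has_metric_deriv ::
    "(3 \<Rightarrow> real^2) \<Rightarrow> real set \<Rightarrow> (real \<Rightarrow> real^2) \<Rightarrow> real \<Rightarrow> real \<Rightarrow> bool" where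
  "has_metric_deriv a I \<xi> t m \<longleftrightarrow>
     ((\<lambda>s. geodist a (\<xi> s) (\<xi> t) / \<bar>s - t\<bar>) \<longlongrightarrow> m) (at t within I)"

definition metric_deriv ::
    "(3 \<Rightarrow> real^2) \<Rightarrow> real set \<Rightarrow> (real \<Rightarrow> real^2) \<Rightarrow> real \<Rightarrow> real" where
  "metric_deriv a I \<xi> t = (THE m. has_metric_deriv a I \<xi> t m)"

definition abs_cont_curve :: "(3 \<Rightarrow> real^2) \<Rightarrow> real set \<Rightarrow> (real \<Rightarrow> real^2) \<Rightarrow> bool" where
  "abs_cont_curve a I \<xi> \<longleftrightarrow>
     is_interval I \<and> \<xi> ` I \<subseteq> gasket a \<and>
     (AE t in lebesgue. t \<in> I \<longrightarrow> (\<exists>m. has_metric_deriv a I \<xi> t m)) \<and>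
     (\<forall>s\<in>I. \<forall>t\<in>I. s \<le> t \<longrightarrow>
        set_integrable lebesgue {s..t} (metric_deriv a I \<xi>) \<and>
        geodist a (\<xi> s) (\<xi> t) \<le> (LINT r:{s..t}|lebesgue. metric_deriv a I \<xi> r))"

definition admissible :: "(3 \<Rightarrow> real^2) \<Rightarrow> real set \<Rightarrow> (real \<Rightarrow> real^2) \<Rightarrow> bool" where
  "admissible a I \<xi> \<longleftrightarrow>
     abs_cont_curve a I \<xi> \<and> (AE t in lebesgue. t \<in> I \<longrightarrow> metric_deriv a I \<xi> t \<le> 1)"

definition arcwise_usc :: "(3 \<Rightarrow> real^2) \<Rightarrow> (real^2 \<Rightarrow> real) \<Rightarrow> bool" where
  "arcwise_usc a u \<longleftrightarrow> (\<forall>I \<xi>. admissible a I \<xi> \<longrightarrow> usc_on I (u \<circ> \<xi>))"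

definition arcwise_lsc :: "(3 \<Rightarrow> real^2) \<Rightarrow> (real^2 \<Rightarrow> real) \<Rightarrow> bool" where
  "arcwise_lsc a u \<longleftrightarrow> (\<forall>I \<xi>. admissible a I \<xi> \<longrightarrow> lsc_on I (u \<circ> \<xi>))"

definition metric_subsolution ::
    "(3 \<Rightarrow> real^2) \<Rightarrow> (real^2 \<Rightarrow> real) \<Rightarrow> (real^2 \<Rightarrow> real) \<Rightarrow> bool" where
  "metric_subsolution a f u \<longleftrightarrow>
     arcwise_usc a u \<and>
     (\<forall>x\<in>gasket a - bdry a. \<forall>I \<xi>.
        open I \<and> 0 \<in> I \<and> admissible a I \<xi> \<and> \<xi> ` I \<subseteq> gasket a - bdry a \<and> \<xi> 0 = x \<longrightarrow>
        (\<forall>p\<in>superdiff (u \<circ> \<xi>) 0. \<bar>p\<bar> \<le> f x))"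

definition hit_forward :: "(3 \<Rightarrow> real^2) \<Rightarrow> (real \<Rightarrow> real^2) \<Rightarrow> ereal" where
  "hit_forward a \<xi> = (INF t\<in>{t. 0 \<le> t \<and> \<xi> t \<in> bdry a}. ereal t)"

definition hit_backward :: "(3 \<Rightarrow> real^2) \<Rightarrow> (real \<Rightarrow> real^2) \<Rightarrow> ereal" where
  "hit_backward a \<xi> = (SUP t\<in>{t. t \<le> 0 \<and> \<xi> t \<in> bdry a}. ereal t)"

definition metric_supersolution ::
    "(3 \<Rightarrow> real^2) \<Rightarrow> (real^2 \<Rightarrow> real) \<Rightarrow> (real^2 \<Rightarrow> real) \<Rightarrow> bool" where
  "metric_supersolution a f v \<longleftrightarrow>
     arcwise_lsc a v \<and>
     (\<forall>x\<in>gasket a - bdry a. \<forall>\<epsilon>>0. \<exists>\<xi> w.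
        admissible a UNIV \<xi> \<and> \<xi> 0 = x \<and> lsc_on UNIV w \<and>
        \<bar>hit_forward a \<xi>\<bar> \<noteq> \<infinity> \<and> \<bar>hit_backward a \<xi>\<bar> \<noteq> \<infinity> \<and>
        w 0 = v x \<and>
        (\<forall>t. hit_backward a \<xi> < ereal t \<and> ereal t < hit_forward a \<xi> \<longrightarrow>
           w t \<ge> v (\<xi> t) - \<epsilon> \<and> (\<forall>p\<in>subdiff w t. \<bar>p\<bar> \<ge> f (\<xi> t) - \<epsilon>)))"

definition metric_solution ::
    "(3 \<Rightarrow> real^2) \<Rightarrow> (real^2 \<Rightarrow> real) \<Rightarrow> (real^2 \<Rightarrow> real) \<Rightarrow> bool" where
  "metric_solution a f u \<longleftrightarrow> metric_subsolution a f u \<and> metric_supersolution a f u"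

text \<open>For positive continuous \<open>f\<close> the set is nonempty and bounded below, so the real
  \<^const>\<open>Inf\<close> is the true infimum.\<close>

definition compatible :: "(3 \<Rightarrow> real^2) \<Rightarrow> (real^2 \<Rightarrow> real) \<Rightarrow> (real^2 \<Rightarrow> real) \<Rightarrow> bool" where
  "compatible a f g \<longleftrightarrow> (\<forall>x\<in>bdry a. \<forall>y\<in>bdry a.
     g x \<le> Inf {integral {0..T} (\<lambda>t. f (\<xi> t)) + g y | T \<xi>.
                  0 \<le> T \<and> admissible a {0..T} \<xi> \<and> \<xi> 0 = x \<and> \<xi> T = y})"

end

theory Submission
  imports Defs "HOL-Complex_Analysis.Great_Picard"
begin

text \<open>Both kinds of solution are compared along paths. On an edge the subsolution property says
  that the solution varies by at most the integral of \<open>f\<close>; the supersolution property yields from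
  every point a path to \<open>\<Gamma>\<close> along which the solution decreases by at least the integral of
  \<open>f\<close>. A path in the network is also a path in the gasket, so \<open>U \<le> u\<^sub>n\<close>. Conversely, a
  curve in the gasket passes from one vertex of level \<open>n\<close> to an adjacent one, since cells of level
  \<open>n\<close> meet only in vertices, and needs at least the time \<open>h\<^sub>n\<close> for this. Replacing each
  passage by the edge costs at most the oscillation of \<open>f\<close> at scale \<open>h\<^sub>n\<close> times the
  duration of the curve, which is bounded because \<open>f\<close> is bounded below and \<open>U\<close> above.\<close>

section \<open>Viscosity conditions on an interval\<close>

text \<open>The supersolution definitions give a path through a point in two directions without
  saying which one is optimal. The interval comparison is therefore an alternative between the two
  ends, and the same lemma serves for one edge, for two edges meeting at a vertex and for a
  two-sided curve in the gasket. Costs are kept as differences of antiderivatives of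
  \<open>f\<close> along the path: these can be built into test functions directly, and the mean
  value theorem turns them into a value of \<open>f\<close> times a duration. \<open>U\<close> is
  semicontinuous only along admissible curves, so compactness does not bound it; it is bounded at
  the vertices by following edges of lengths 1/2, 1/4, ... from the boundary, whose total is below
  1. The inequality \<open>U \<le> u\<^sub>n\<close> holds without error because edges are geodesics
  of the gasket. In the converse the slack \<epsilon> of a metric supersolution also enters
  multiplied by the duration, and taking \<epsilon> at most half the minimum of \<open>f\<close>
  lets the duration bound absorb it.\<close>

lemma lsc_attains_inf:
  fixes w :: "'a::topological_space \<Rightarrow> real"
  assumes "compact K" "K \<noteq> {}" and lsc: "lsc_on K w"
  shows "\<exists>x\<in>K. \<forall>y\<in>K. w x \<le> w y"
proof (rule ccontr)
  assume no: "\<not> ?thesis"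
  have "\<exists>T. open T \<and> x \<in> T \<and> (\<forall>y\<in>T \<inter> K. w z < w y)" if "x \<in> K" "w z < w x" for x z
  proof -
    have "eventually (\<lambda>y. w z < w y) (at x within K)"
      using lsc that by (auto simp: lsc_on_def)
    then obtain T where "open T" "x \<in> T" "\<forall>y\<in>T. y \<noteq> x \<longrightarrow> y \<in> K \<longrightarrow> w z < w y"
      unfolding eventually_at_topological by auto
    then show ?thesis using that by (intro exI[of _ T]) auto
  qed
  moreover have "\<forall>x\<in>K. \<exists>z\<in>K. w z < w x"
    using no by (auto simp: not_le)
  ultimately have "\<forall>x\<in>K. \<exists>z T. z \<in> K \<and> open T \<and> x \<in> T \<and> (\<forall>y\<in>T \<inter> K. w z < w y)"
    by meson
  then obtain z T where zT: "\<And>x. x \<in> K \<Longrightarrow> z x \<in> K" "\<And>x. x \<in> K \<Longrightarrow> open (T x)"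
      "\<And>x. x \<in> K \<Longrightarrow> x \<in> T x" "\<And>x y. x \<in> K \<Longrightarrow> y \<in> T x \<inter> K \<Longrightarrow> w (z x) < w y"
    by metis
  obtain D where D: "D \<subseteq> K" "finite D" "K \<subseteq> (\<Union>x\<in>D. T x)"
    using compactE_image[OF assms(1), of K T] zT by (metis UN_iff subsetI)
  have "D \<noteq> {}" using D assms(2) by auto
  \<comment> \<open>The lowest of the finitely many values \<open>w (z x)\<close> is itself
    undercut, since that \<open>z x\<close> lies in one of the covering sets.\<close>
  define m where "m = Min ((\<lambda>x. w (z x)) ` D)"
  have "m \<in> (\<lambda>x. w (z x)) ` D"
    unfolding m_def using D \<open>D \<noteq> {}\<close> by (intro Min_in) auto
  then obtain x where x: "x \<in> D" "m = w (z x)" by auto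
  then obtain x' where x': "x' \<in> D" "z x \<in> T x'"
    using D zT(1) by blast
  then have "w (z x') < m"
    using zT(1)[of x] zT(4)[of x' "z x"] D x by auto
  moreover have "m \<le> w (z x')"
    unfolding m_def using D x' by (intro Min_le) auto
  ultimately show False by simp
qed

lemma continuous_imp_lsc: "continuous_on A u \<Longrightarrow> lsc_on A u"
  by (auto simp: lsc_on_def continuous_on_def intro: order_tendstoD)

lemma lsc_on_subset: "lsc_on A w \<Longrightarrow> B \<subseteq> A \<Longrightarrow> lsc_on B w"
  unfolding lsc_on_def by (meson at_le filter_leD subsetD)

lemma usc_lsc_imp_continuous:
  "usc_on A u \<Longrightarrow> lsc_on A u \<Longrightarrow> continuous_on A u"
  by (auto simp: lsc_on_def usc_on_def continuous_on_def order_tendsto_iff)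

lemma eventually_at_interior_interval:
  fixes t :: real
  assumes "\<alpha> < t" "t < \<beta>" "\<And>s. \<alpha> < s \<Longrightarrow> s < \<beta> \<Longrightarrow> P s"
  shows "eventually P (at t)"
  using assms unfolding eventually_at_topological
  by (intro exI[of _ "{\<alpha><..<\<beta>}"]) auto

text \<open>The smooth cone \<open>sqrt (\<delta>\<^sup>2 + (F - F x0)\<^sup>2) - \<delta>\<close> has slope strictly below \<open>c\<close>, so
  adding it to \<open>w\<close> cannot create an interior minimum; for small \<open>\<delta>\<close> it would do so if the
  conclusion failed.\<close>

lemma superoptimality_interval:
  fixes w F c :: "real \<Rightarrow> real"
  assumes x0: "\<alpha> < x0" "x0 < \<beta>"
    and lsc: "lsc_on {\<alpha>..\<beta>} w"
    and F: "\<And>t. t \<in> {\<alpha>..\<beta>} \<Longrightarrow> (F has_real_derivative c t) (at t within {\<alpha>..\<beta>})"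
    and cpos: "\<And>t. \<alpha> < t \<Longrightarrow> t < \<beta> \<Longrightarrow> 0 < c t"
    and test: "\<And>t \<phi> p. \<alpha> < t \<Longrightarrow> t < \<beta> \<Longrightarrow> continuous_on {\<alpha>..\<beta>} \<phi> \<Longrightarrow>
      (\<phi> has_real_derivative p) (at t) \<Longrightarrow> eventually (\<lambda>s. w t - \<phi> t \<le> w s - \<phi> s) (at t) \<Longrightarrow>
      c t \<le> \<bar>p\<bar>"
  shows "w \<alpha> + \<bar>F x0 - F \<alpha>\<bar> \<le> w x0 \<or> w \<beta> + \<bar>F \<beta> - F x0\<bar> \<le> w x0"
proof (rule ccontr)
  assume "\<not> ?thesis"
  then have lt: "w x0 < w \<alpha> + \<bar>F x0 - F \<alpha>\<bar>" "w x0 < w \<beta> + \<bar>F \<beta> - F x0\<bar>" by auto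
  obtain \<delta> where \<delta>: "\<delta> > 0" "w x0 + \<delta> < w \<alpha> + \<bar>F x0 - F \<alpha>\<bar>" "w x0 + \<delta> < w \<beta> + \<bar>F \<beta> - F x0\<bar>"
    using lt that[of "min (w \<alpha> + \<bar>F x0 - F \<alpha>\<bar> - w x0) (w \<beta> + \<bar>F \<beta> - F x0\<bar> - w x0) / 2"]
    by (auto simp: min_def field_simps split: if_splits)
  define \<psi> where "\<psi> s = sqrt (\<delta>\<^sup>2 + (F s - F x0)\<^sup>2)" for s
  have pos: "\<delta>\<^sup>2 + (F s - F x0)\<^sup>2 > 0" for s
    using \<delta> by (simp add: add_pos_nonneg)
  have contF: "continuous_on {\<alpha>..\<beta>} F"
    by (rule DERIV_continuous_on[OF F])
  have cont: "continuous_on {\<alpha>..\<beta>} \<psi>"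
    unfolding \<psi>_def by (intro continuous_intros contF)
  have "lsc_on {\<alpha>..\<beta>} (\<lambda>s. w s + \<psi> s)"
    unfolding lsc_on_def
  proof (intro ballI allI impI)
    fix x y assume x: "x \<in> {\<alpha>..\<beta>}" and y: "y < w x + \<psi> x"
    define \<epsilon> where "\<epsilon> = (w x + \<psi> x - y) / 2"
    have "\<epsilon> > 0" using y by (simp add: \<epsilon>_def)
    then have "eventually (\<lambda>s. w x - \<epsilon> < w s) (at x within {\<alpha>..\<beta>})"
      using lsc x by (auto simp: lsc_on_def)
    moreover have "eventually (\<lambda>s. \<psi> x - \<epsilon> < \<psi> s) (at x within {\<alpha>..\<beta>})"
      using cont x \<open>\<epsilon> > 0\<close> unfolding continuous_on_def
      by (intro order_tendstoD(1)[where y = "\<psi> x"]) auto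
    ultimately show "eventually (\<lambda>s. y < w s + \<psi> s) (at x within {\<alpha>..\<beta>})"
    proof eventually_elim
      case (elim s)
      have "y = w x + \<psi> x - 2 * \<epsilon>" by (simp add: \<epsilon>_def field_simps)
      then show ?case using elim by linarith
    qed
  qed
  then obtain t where t: "t \<in> {\<alpha>..\<beta>}" and tmin: "\<And>s. s \<in> {\<alpha>..\<beta>} \<Longrightarrow> w t + \<psi> t \<le> w s + \<psi> s"
    using lsc_attains_inf[of "{\<alpha>..\<beta>}" "\<lambda>s. w s + \<psi> s"] x0 by auto
  have \<psi>x0: "\<psi> x0 = \<delta>" using \<delta> by (simp add: \<psi>_def)
  have \<psi>ge: "\<bar>F s - F x0\<bar> \<le> \<psi> s" for s
    unfolding \<psi>_def by (rule real_le_rsqrt) simp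
  \<comment> \<open>At an end \<open>w + \<psi>\<close> is at least
    \<open>w + \<bar>F - F x0\<bar>\<close>, which by the choice of \<delta> exceeds
    \<open>w x0 + \<delta>\<close>, the value at \<open>x0\<close>; so the minimum is
    interior.\<close>
  have "t \<noteq> \<alpha>" "t \<noteq> \<beta>"
    using tmin[of x0] x0 \<psi>x0 \<psi>ge[of \<alpha>] \<psi>ge[of \<beta>] \<delta> by (auto simp: abs_minus_commute)
  then have t': "\<alpha> < t" "t < \<beta>" using t by auto
  have "(F has_real_derivative c t) (at t)"
    using F[OF t] t' by (simp add: at_within_Icc_at)
  then have D: "((\<lambda>s. - \<psi> s) has_real_derivative - ((F t - F x0) * c t / \<psi> t)) (at t)"
    unfolding \<psi>_def using pos[of t]
    by (auto intro!: derivative_eq_intros simp: divide_simps)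
  have "c t \<le> \<bar>- ((F t - F x0) * c t / \<psi> t)\<bar>"
    by (rule test[OF t' _ D])
       (use tmin t' in \<open>auto intro!: continuous_intros cont eventually_at_interior_interval[of \<alpha> t \<beta>]\<close>)
  moreover have "\<bar>F t - F x0\<bar> < \<psi> t"
    unfolding \<psi>_def by (rule real_less_rsqrt) (use \<delta> in auto)
  moreover have "c t > 0" using cpos t' by auto
  ultimately have "c t * \<psi> t \<le> \<bar>F t - F x0\<bar> * c t" "\<bar>F t - F x0\<bar> * c t < \<psi> t * c t"
    by (auto simp: abs_mult abs_div pos_le_divide_eq)
  then show False by (simp add: mult.commute)
qed

text \<open>If the bound failed, \<open>w - F\<close> would still rise from \<open>s\<close> to
  \<open>t\<close> after a small linear term is subtracted. Subtracting also a nondecreasing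
  function that is tiny at some interior point and large at \<open>t\<close> produces an interior
  maximum, where the test function has slope above \<open>c\<close>. Only upper bounds on slopes
  enter, hence the one-sided hypothesis.\<close>

lemma suboptimality_interval_aux:
  fixes w F c :: "real \<Rightarrow> real"
  assumes w: "continuous_on {\<alpha>..\<beta>} w"
    and F: "\<And>t. t \<in> {\<alpha>..\<beta>} \<Longrightarrow> (F has_real_derivative c t) (at t within {\<alpha>..\<beta>})"
    and test: "\<And>t \<phi> p. \<alpha> < t \<Longrightarrow> t < \<beta> \<Longrightarrow> continuous_on {\<alpha>..\<beta>} \<phi> \<Longrightarrow>
      (\<phi> has_real_derivative p) (at t) \<Longrightarrow> eventually (\<lambda>s. w s - \<phi> s \<le> w t - \<phi> t) (at t) \<Longrightarrow>
      p \<le> c t"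
    and st: "\<alpha> \<le> s" "s < t" "t \<le> \<beta>"
  shows "w t - w s \<le> F t - F s"
proof (rule ccontr)
  assume "\<not> ?thesis"
  then have gt: "w t - F t > w s - F s" by simp
  \<comment> \<open>Half the mean excess slope of \<open>w - F\<close>, so that \<open>v\<close>
    keeps half of the rise.\<close>
  define \<kappa> where "\<kappa> = (w t - F t - (w s - F s)) / (2 * (t - s))"
  have \<kappa>: "\<kappa> > 0" using gt st by (simp add: \<kappa>_def)
  define v where "v y = w y - F y - \<kappa> * y" for y
  have "\<kappa> * (t - s) = (w t - F t - (w s - F s)) / 2"
    using st unfolding \<kappa>_def by (simp add: divide_simps)
  then have vlt: "v s < v t" using gt by (simp add: v_def algebra_simps)
  have contF: "continuous_on {\<alpha>..\<beta>} F"
    by (rule DERIV_continuous_on[OF F])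
  have contv: "continuous_on {s..t} v"
    unfolding v_def using st
    by (intro continuous_intros continuous_on_subset[OF w] continuous_on_subset[OF contF]) auto
  obtain y0 where y0: "s < y0" "y0 < t" "v s < v y0"
  proof -
    have "\<exists>y\<ge>s. y \<le> t \<and> v y = (v s + v t) / 2"
      using vlt st contv by (intro IVT') auto
    then obtain y where y: "s \<le> y" "y \<le> t" "v y = (v s + v t) / 2" by auto
    then have "y \<noteq> s" "y \<noteq> t" using vlt by auto
    then show thesis using that[of y] y vlt by auto
  qed
  define A where "A = \<bar>v t - v y0\<bar> + 1"
  have A: "A > 0" "A > v t - v y0" by (auto simp: A_def)
  define r where "r = (y0 - s) / (t - s)"
  have r: "0 < r" "r < 1" using y0 by (auto simp: r_def)
  \<comment> \<open>The power makes \<theta> at \<open>y0\<close> smaller than the gain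
    \<open>v y0 - v s\<close>, which rules out a maximum at \<open>s\<close>, and smaller than 1,
    which with the summand 1 in \<open>A\<close> rules out \<open>t\<close>.\<close>
  obtain N0 where N0: "r ^ N0 < min (v y0 - v s) 1 / A"
    using real_arch_pow_inv[of "min (v y0 - v s) 1 / A" r] y0 A r by auto
  \<comment> \<open>A positive exponent is required for \<theta> to vanish at
    \<open>s\<close>.\<close>
  define N where "N = Suc N0"
  have "r ^ N \<le> r ^ N0" unfolding N_def using r by (simp add: power_decreasing mult_left_le_one_le)
  then have "A * r ^ N \<le> A * r ^ N0" using A by simp
  moreover have "A * r ^ N0 < min (v y0 - v s) 1" using N0 A by (simp add: pos_less_divide_eq mult.commute)
  ultimately have N: "A * r ^ N < v y0 - v s" "A * r ^ N < 1" by linarith+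
  define \<theta> where "\<theta> y = A * ((y - s) / (t - s)) ^ N" for y
  have cont\<theta>: "continuous_on X \<theta>" for X
    unfolding \<theta>_def by (cases "t = s") (auto intro!: continuous_intros)
  obtain x where x: "x \<in> {s..t}" and xmax: "\<And>y. y \<in> {s..t} \<Longrightarrow> v y - \<theta> y \<le> v x - \<theta> x"
  proof -
    have "continuous_on {s..t} (\<lambda>y. v y - \<theta> y)"
      by (intro continuous_intros contv cont\<theta>)
    then show thesis
      using continuous_attains_sup[of "{s..t}" "\<lambda>y. v y - \<theta> y"] st that by auto
  qed
  have "\<theta> s = 0" "\<theta> t = A" "\<theta> y0 = A * r ^ N" using st by (auto simp: \<theta>_def N_def r_def)
  then have "x \<noteq> s" "x \<noteq> t"
    using xmax[of y0] y0 N A abs_ge_self[of "v t - v y0"] unfolding A_def by auto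
  then have x': "s < x" "x < t" using x by auto
  define D where "D = A * ((1 + of_nat N0) * (1 / (t - s) * ((x - s) / (t - s)) ^ N0))"
  have D\<theta>: "(\<theta> has_real_derivative D) (at x)"
    unfolding \<theta>_def D_def N_def
    by (intro DERIV_cmult DERIV_power_Suc DERIV_cdivide) (auto intro!: derivative_eq_intros)
  have D: "D \<ge> 0" unfolding D_def using A x' st by auto
  have "(F has_real_derivative c x) (at x)"
    using F[of x] x' st by (simp add: at_within_Icc_at)
  then have D\<phi>: "((\<lambda>y. F y + \<kappa> * y + \<theta> y) has_real_derivative (c x + \<kappa> + D)) (at x)"
    using D\<theta> by (auto intro!: derivative_eq_intros)
  have "c x + \<kappa> + D \<le> c x"
  proof (rule test[OF _ _ _ D\<phi>])
    show "eventually (\<lambda>y. w y - (F y + \<kappa> * y + \<theta> y) \<le> w x - (F x + \<kappa> * x + \<theta> x)) (at x)"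
      using xmax x' by (intro eventually_at_interior_interval[of s x t]) (auto simp: v_def algebra_simps)
  qed (use x' st in \<open>auto intro!: continuous_intros contF cont\<theta>\<close>)
  then show False using D \<kappa> by simp
qed

lemma suboptimality_interval:
  fixes w F c :: "real \<Rightarrow> real"
  assumes w: "continuous_on {\<alpha>..\<beta>} w"
    and F: "\<And>t. t \<in> {\<alpha>..\<beta>} \<Longrightarrow> (F has_real_derivative c t) (at t within {\<alpha>..\<beta>})"
    and test: "\<And>t \<phi> p. \<alpha> < t \<Longrightarrow> t < \<beta> \<Longrightarrow> continuous_on {\<alpha>..\<beta>} \<phi> \<Longrightarrow>
      (\<phi> has_real_derivative p) (at t) \<Longrightarrow> eventually (\<lambda>s. w s - \<phi> s \<le> w t - \<phi> t) (at t) \<Longrightarrow>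
      \<bar>p\<bar> \<le> c t"
    and st: "s \<in> {\<alpha>..\<beta>}" "t \<in> {\<alpha>..\<beta>}"
  shows "\<bar>w s - w t\<bar> \<le> \<bar>F s - F t\<bar>"
proof -
  have *: "\<bar>w t - w s\<bar> \<le> \<bar>F t - F s\<bar>" if "\<alpha> \<le> s" "s < t" "t \<le> \<beta>" for s t
  proof -
    have up: "w t - w s \<le> F t - F s"
      using that by (intro suboptimality_interval_aux[OF w F]) (use test in force)+
    \<comment> \<open>Reflection turns a decrease of \<open>w\<close> into an increase; the second
      minus sign in \<open>?F\<close> keeps the derivative equal to \<open>c\<close> instead of its
      negative.\<close>
    let ?w = "\<lambda>y. w (- y)" and ?F = "\<lambda>y. - F (- y)" and ?c = "\<lambda>y. c (- y)"
    have "?w (- s) - ?w (- t) \<le> ?F (- s) - ?F (- t)"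
    proof (rule suboptimality_interval_aux[where w = ?w and F = ?F and \<alpha> = "- \<beta>" and \<beta> = "- \<alpha>" and c = ?c])
      show "continuous_on {- \<beta>..- \<alpha>} (\<lambda>y. w (- y))"
        by (rule continuous_on_compose2[OF w]) (auto intro!: continuous_intros)
    next
      fix y assume y: "y \<in> {- \<beta>..- \<alpha>}"
      have im: "uminus ` {- \<beta>..- \<alpha>} = {\<alpha>..\<beta>}" by simp
      have "(F has_real_derivative c (- y)) (at (- y) within uminus ` {- \<beta>..- \<alpha>})"
        using F[of "- y"] y unfolding im by auto
      then have "((\<lambda>y. F (- y)) has_real_derivative (c (- y) * -1)) (at y within {- \<beta>..- \<alpha>})"
        by (rule DERIV_image_chain[unfolded o_def]) (auto intro!: derivative_eq_intros)
      from DERIV_minus[OF this] show "(?F has_real_derivative c (- y)) (at y within {- \<beta>..- \<alpha>})"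
        by simp
    next
      fix y \<phi> p
      assume y: "- \<beta> < y" "y < - \<alpha>" and \<phi>: "continuous_on {- \<beta>..- \<alpha>} \<phi>"
        "(\<phi> has_real_derivative p) (at y)"
        and ev: "eventually (\<lambda>s. w (- s) - \<phi> s \<le> w (- y) - \<phi> y) (at y)"
      have "\<bar>- p\<bar> \<le> c (- y)"
      proof (rule test)
        show "continuous_on {\<alpha>..\<beta>} (\<lambda>z. \<phi> (- z))"
          by (rule continuous_on_compose2[OF \<phi>(1)]) (auto intro!: continuous_intros)
        show "((\<lambda>z. \<phi> (- z)) has_real_derivative - p) (at (- y))"
          using \<phi>(2) by (simp add: DERIV_mirror)
        show "eventually (\<lambda>s. w s - \<phi> (- s) \<le> w (- y) - \<phi> (- (- y))) (at (- y))"
          using ev by (simp add: eventually_filtermap flip: filtermap_at_minus)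
      qed (use y in auto)
      then show "p \<le> c (- y)" by simp
    qed (use that in auto)
    then show ?thesis using up by simp
  qed
  show ?thesis
    using *[of s t] *[of t s] st by (cases s t rule: linorder_cases) (auto simp: abs_minus_commute)
qed

section \<open>Geometry of the gasket\<close>

lemma third_index:
  assumes "i \<noteq> j"
  shows "\<exists>k. k \<noteq> i \<and> k \<noteq> j \<and> UNIV = {i, j, k :: 3}"
proof -
  have "card {i, j} \<noteq> card (UNIV :: 3 set)" using assms by simp
  then have "{i, j} \<noteq> UNIV" by metis
  then obtain k where k: "k \<noteq> i" "k \<noteq> j" by auto
  then have "{i, j, k} = UNIV" using assms by (intro card_subset_eq) auto
  then show ?thesis using k by auto
qed

section \<open>The contractions, the vertex sets and the edges\<close>

text \<open>A composition of the maps is a homothety without rotation; injectivity, affinity,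
  continuity and the scaling of distances all come from this identity.\<close>

lemma psi_word_diff: "psi_word a w x - psi_word a w y = (1/2) ^ length w *\<^sub>R (x - y)"
  by (induction w arbitrary: x y) (simp_all add: psi_def flip: scaleR_diff_right)

lemma dist_psi_word: "dist (psi_word a w x) (psi_word a w y) = (1/2) ^ length w * dist x y"
  by (simp add: dist_norm psi_word_diff)

lemma psi_word_inj: "psi_word a w x = psi_word a w y \<longleftrightarrow> x = y"
  using dist_psi_word[of a w x y] by auto

lemma psi_inj: "psi a i x = psi a i y \<longleftrightarrow> x = y"
  using psi_word_inj[of a "[i]" x y] by simp

lemma psi_word_affine:
  "psi_word a w ((1 - u) *\<^sub>R x + u *\<^sub>R y) = (1 - u) *\<^sub>R psi_word a w x + u *\<^sub>R psi_word a w y"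
proof -
  have "(1 - u) *\<^sub>R x + u *\<^sub>R y = x + u *\<^sub>R (y - x)" by (simp add: algebra_simps)
  moreover have "psi_word a w (x + u *\<^sub>R (y - x)) - psi_word a w x = u *\<^sub>R (psi_word a w y - psi_word a w x)"
    by (simp add: psi_word_diff)
  ultimately show ?thesis by (simp add: algebra_simps)
qed

lemma psi_word_segment:
  "psi_word a w ` closed_segment x y = closed_segment (psi_word a w x) (psi_word a w y)"
  by (force simp: closed_segment_def psi_word_affine image_iff)

lemma psi_word_append: "psi_word a (v @ w) x = psi_word a v (psi_word a w x)"
  by (induction v) auto

lemma psi_conv: "psi a i x = (1/2) *\<^sub>R x + (1/2) *\<^sub>R a i"
  by (simp add: psi_def vec_eq_iff field_simps)

lemma psi_vertex: "psi a i (a i) = a i"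
  by (simp add: psi_def)

lemma continuous_psi_word: "continuous_on A (psi_word a w)"
proof -
  have eq: "psi_word a w x = (1/2) ^ length w *\<^sub>R x + psi_word a w 0" for x
    using psi_word_diff[of a w x 0] by (simp only: diff_eq_eq diff_zero)
  have "continuous_on A (\<lambda>x. (1/2) ^ length w *\<^sub>R x + psi_word a w 0)"
    by (intro continuous_intros)
  then show ?thesis by (rule continuous_on_eq) (rule eq[symmetric])
qed

lemma psi_word_vertices: "x \<in> vertices a n \<Longrightarrow> psi_word a w x \<in> vertices a (length w + n)"
proof -
  assume "x \<in> vertices a n"
  then obtain v i where "length v = n" "x = psi_word a v (a i)" by (auto simp: vertices_def)
  then show ?thesis
    unfolding vertices_def by (intro UN_I[of "w @ v"]) (auto simp: psi_word_append)
qed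

lemma vertices_Suc: "vertices a n \<subseteq> vertices a (Suc n)"
proof
  fix x assume "x \<in> vertices a n"
  then obtain w i where w: "length w = n" "x = psi_word a w (a i)" by (auto simp: vertices_def)
  then have "x = psi_word a (w @ [i]) (a i)" by (simp add: psi_word_append psi_vertex)
  moreover have "length (w @ [i]) = Suc n" using w by simp
  ultimately show "x \<in> vertices a (Suc n)" unfolding vertices_def by blast
qed

lemma vertices_mono: "m \<le> n \<Longrightarrow> vertices a m \<subseteq> vertices a n"
  using vertices_Suc by (rule lift_Suc_mono_le)

lemma vertices_0: "vertices a 0 = bdry a"
  by (auto simp: vertices_def)

lemma bdry_subset_vertices: "bdry a \<subseteq> vertices a n"
  using vertices_mono[of 0 n a] by (simp add: vertices_0)

lemma vertices_subset_gasket: "vertices a n \<subseteq> gasket a"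
  unfolding gasket_def by (rule order_trans[OF _ closure_subset]) auto

lemma finite_words: "finite {w :: 3 list. length w = n}"
  using finite_lists_length_eq[of "UNIV :: 3 set" n] by simp

lemma finite_vertices: "finite (vertices a n)"
  unfolding vertices_def using finite_words by auto

lemma finite_edges: "finite (edges a n)"
proof -
  have "edges a n \<subseteq> (\<Union>w\<in>{w. length w = n}. \<Union>i. \<Union>j. {psi_word a w ` closed_segment (a i) (a j)})"
    unfolding edges_def by blast
  then show ?thesis by (rule finite_subset) (simp add: finite_words)
qed

lemma edges_conv: "edges a n = {closed_segment (psi_word a w (a i)) (psi_word a w (a j)) | w i j. length w = n \<and> i \<noteq> j}"
  by (simp add: edges_def psi_word_segment)

lemma psi_word_gasket: "x \<in> gasket a \<Longrightarrow> psi_word a w x \<in> gasket a"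
proof -
  assume "x \<in> gasket a"
  have "psi_word a w ` closure (\<Union>n. vertices a n) \<subseteq> closure (psi_word a w ` (\<Union>n. vertices a n))"
    by (intro image_closure_subset continuous_psi_word closed_closure closure_subset)
  also have "\<dots> \<subseteq> gasket a"
    unfolding gasket_def
  proof (intro closure_mono subsetI)
    fix y assume "y \<in> psi_word a w ` (\<Union>n. vertices a n)"
    then obtain n x where "x \<in> vertices a n" "y = psi_word a w x" by blast
    then show "y \<in> (\<Union>n. vertices a n)" using psi_word_vertices by blast
  qed
  finally show ?thesis using \<open>x \<in> gasket a\<close> by (auto simp: gasket_def)
qed

lemma closed_gasket: "closed (gasket a)"
  by (simp add: gasket_def)

section \<open>Cells and barycentric coordinates\<close>

text \<open>The filled triangle instead of the piece of the gasket in it: it is convex, it is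
  described by barycentric coordinates, and two of the same level still meet only in
  vertices.\<close>

definition cell :: "(3 \<Rightarrow> real^2) \<Rightarrow> 3 list \<Rightarrow> (real^2) set" where
  "cell a w = psi_word a w ` (convex hull (bdry a))"

lemma convex_hull_bdry: "convex hull (bdry a) = {\<Sum>i\<in>UNIV. l i *\<^sub>R a i | l. (\<forall>i. 0 \<le> l i) \<and> (\<Sum>i\<in>UNIV. l i) = 1}"
  (is "?L = ?R")
proof
  show "?R \<subseteq> ?L"
  proof clarify
    fix l :: "3 \<Rightarrow> real" assume "\<forall>i. 0 \<le> l i" "(\<Sum>i\<in>UNIV. l i) = 1"
    then show "(\<Sum>i\<in>UNIV. l i *\<^sub>R a i) \<in> convex hull bdry a"
      by (intro convex_sum) (auto simp: hull_inc)
  qed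
  have "convex ?R"
  proof (rule convexI)
    fix x y and u v :: real assume "x \<in> ?R" "y \<in> ?R" and uv: "0 \<le> u" "0 \<le> v" "u + v = 1"
    then obtain l m where lm: "x = (\<Sum>i\<in>UNIV. l i *\<^sub>R a i)" "y = (\<Sum>i\<in>UNIV. m i *\<^sub>R a i)"
      "\<forall>i. 0 \<le> l i" "(\<Sum>i\<in>UNIV. l i) = 1" "\<forall>i. 0 \<le> m i" "(\<Sum>i\<in>UNIV. m i) = 1" by auto
    have "u *\<^sub>R x + v *\<^sub>R y = (\<Sum>i\<in>UNIV. (u * l i + v * m i) *\<^sub>R a i)"
      by (simp add: lm scaleR_sum_right sum.distrib scaleR_add_left)
    moreover have "(\<Sum>i\<in>UNIV. u * l i + v * m i) = 1"
      using lm uv by (simp add: sum.distrib flip: sum_distrib_left)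
    moreover have "\<forall>i. 0 \<le> u * l i + v * m i" using lm uv by auto
    ultimately show "u *\<^sub>R x + v *\<^sub>R y \<in> ?R" by (auto intro!: exI[of _ "\<lambda>i. u * l i + v * m i"])
  qed
  moreover have "bdry a \<subseteq> ?R"
  proof
    fix x assume "x \<in> bdry a"
    then obtain j where "x = a j" by auto
    then show "x \<in> ?R"
      by (auto intro!: exI[of _ "\<lambda>i. if i = j then 1 else 0"] simp: if_distrib[of "\<lambda>z. z *\<^sub>R _"] cong: if_cong)
  qed
  ultimately show "?L \<subseteq> ?R" by (intro hull_minimal) auto
qed

text \<open>The affine function that is 1 at \<open>a i\<close> and 0 on the opposite side of the
  unit triangle. Its gradient points from the centroid to \<open>a i\<close>; the distance between
  these is 1/sqrt 3 and the height is sqrt 3/2, so the factor 2 makes the gradient's length the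
  reciprocal of the height.\<close>

definition barycoord :: "(3 \<Rightarrow> real^2) \<Rightarrow> 3 \<Rightarrow> real^2 \<Rightarrow> real" where
  "barycoord a i x = 1 + 2 * ((x - a i) \<bullet> (a i - (1/3) *\<^sub>R (\<Sum>k\<in>UNIV. a k)))"

locale equilateral =
  fixes a :: "3 \<Rightarrow> real^2"
  assumes unit_equilateral: "unit_equilateral a"
begin

lemma dist_corners: "dist (a i) (a j) = (if i = j then 0 else 1)"
  using unit_equilateral by (auto simp: unit_equilateral_def)

lemma inner_corners: "(a i - a j) \<bullet> (a i - a k) = (if j = i \<or> k = i then 0 else if j = k then 1 else 1/2)"
proof -
  have "(norm (a j - a k))\<^sup>2 = (norm (a i - a j))\<^sup>2 + (norm (a i - a k))\<^sup>2 - 2 * ((a i - a j) \<bullet> (a i - a k))"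
    by (simp add: power2_norm_eq_inner inner_diff_left inner_diff_right inner_commute)
  then show ?thesis
    using dist_corners[of j k] dist_corners[of i k] dist_corners[of i j]
    by (auto simp: dist_norm split: if_splits)
qed

lemma barycoord_corner: "barycoord a i (a j) = (if i = j then 1 else 0)"
proof -
  have "a i - (1/3) *\<^sub>R (\<Sum>k\<in>UNIV. a k) = (1/3) *\<^sub>R (\<Sum>k\<in>UNIV. a i - a k)"
    by (simp add: sum_subtractf scaleR_diff_right)
  then have "barycoord a i (a j) = 1 + (2/3) * (\<Sum>k\<in>UNIV. (a j - a i) \<bullet> (a i - a k))"
    unfolding barycoord_def by (simp only: inner_sum_right inner_scaleR_right)
  moreover have "(a j - a i) \<bullet> (a i - a k) = - ((a i - a j) \<bullet> (a i - a k))" for k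
    by (metis inner_minus_left minus_diff_eq)
  ultimately have "barycoord a i (a j) = 1 + (2/3) * (\<Sum>k\<in>UNIV. - ((a i - a j) \<bullet> (a i - a k)))"
    by simp
  also have "\<dots> = (if i = j then 1 else 0)"
    unfolding inner_corners sum_3 using exhaust_3[of i] exhaust_3[of j] by auto
  finally show ?thesis .
qed

lemma barycoord_affine:
  "barycoord a i ((1 - u) *\<^sub>R x + u *\<^sub>R y) = (1 - u) * barycoord a i x + u * barycoord a i y"
proof -
  have "(1 - u) *\<^sub>R x + u *\<^sub>R y - a i = (1 - u) *\<^sub>R (x - a i) + u *\<^sub>R (y - a i)"
    by (simp add: algebra_simps)
  then show ?thesis by (simp only: barycoord_def inner_add_left inner_scaleR_left) (simp add: algebra_simps)
qed

lemma barycoord_psi: "barycoord a i (psi a j x) = (barycoord a i x + (if i = j then 1 else 0)) / 2"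
proof -
  have "psi a j x = (1 - 1/2) *\<^sub>R x + (1/2) *\<^sub>R a j"
    by (simp add: psi_conv)
  then show ?thesis by (simp only: barycoord_affine barycoord_corner) simp
qed

lemma barycoord_sum:
  assumes "(\<Sum>i\<in>UNIV. l i) = 1"
  shows "barycoord a j (\<Sum>i\<in>UNIV. l i *\<^sub>R a i) = l j"
proof -
  let ?v = "a j - (1/3) *\<^sub>R (\<Sum>k\<in>UNIV. a k)"
  have "(\<Sum>i\<in>UNIV. l i *\<^sub>R a i) - a j = (\<Sum>i\<in>UNIV. l i *\<^sub>R (a i - a j))"
    using assms by (simp add: scaleR_diff_right sum_subtractf flip: scaleR_sum_left)
  then have "barycoord a j (\<Sum>i\<in>UNIV. l i *\<^sub>R a i) = 1 + (\<Sum>i\<in>UNIV. l i * (2 * ((a i - a j) \<bullet> ?v)))"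
    by (simp add: barycoord_def inner_sum_left sum_distrib_left mult_ac)
  also have "\<dots> = (\<Sum>i\<in>UNIV. l i * (1 + (2 * ((a i - a j) \<bullet> ?v))))"
    using assms by (simp add: distrib_left sum.distrib)
  also have "\<dots> = (\<Sum>i\<in>UNIV. l i * barycoord a j (a i))"
    by (simp only: barycoord_def)
  also have "\<dots> = l j" by (simp add: barycoord_corner if_distrib[of "\<lambda>z. _ * z"] cong: if_cong)
  finally show ?thesis .
qed

lemma triangle_barycoord:
  assumes "x \<in> convex hull (bdry a)"
  shows "x = (\<Sum>i\<in>UNIV. barycoord a i x *\<^sub>R a i)" "barycoord a i x \<ge> 0"
    "(\<Sum>i\<in>UNIV. barycoord a i x) = 1"
  using assms unfolding convex_hull_bdry by (auto simp: barycoord_sum)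

lemma triangle_eqI:
  assumes "x \<in> convex hull (bdry a)" "y \<in> convex hull (bdry a)"
    "\<And>i. barycoord a i x = barycoord a i y"
  shows "x = y"
  using triangle_barycoord(1)[OF assms(1)] triangle_barycoord(1)[OF assms(2)] assms(3) by simp

lemma corner_in_triangle: "a i \<in> convex hull (bdry a)"
  by (simp add: hull_inc)

lemma psi_triangle: "x \<in> convex hull (bdry a) \<Longrightarrow> psi a i x \<in> convex hull (bdry a)"
proof -
  assume x: "x \<in> convex hull (bdry a)"
  show ?thesis
    unfolding psi_conv using convexD[OF convex_convex_hull x corner_in_triangle[of i], of "1/2" "1/2"] by simp
qed

lemma cell_subset_triangle: "cell a w \<subseteq> convex hull (bdry a)"
  unfolding cell_def by (induction w) (auto simp: psi_triangle)

lemma cell_Cons: "cell a (i # w) = psi a i ` cell a w"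
  by (auto simp: cell_def)

text \<open>The \<open>i\<close>-th first-level cell is where the \<open>i\<close>-th barycentric coordinate is at least
  \<open>1/2\<close>, so two such cells meet only at the midpoint of a side.\<close>

lemma first_level_cells_meet:
  assumes "x \<in> convex hull (bdry a)" "y \<in> convex hull (bdry a)" "i \<noteq> j" "psi a i x = psi a j y"
  shows "x = a j"
proof -
  have x: "barycoord a k x \<ge> 0" "barycoord a k y \<ge> 0" for k
    using triangle_barycoord assms(1,2) by auto
  have eq: "barycoord a k x + (if k = i then 1 else 0) = barycoord a k y + (if k = j then 1 else 0)" for k
    using barycoord_psi[of k i x] barycoord_psi[of k j y] assms(4) by simp
  have "barycoord a j x \<ge> 1" using eq[of j] x[of j] assms(3) by auto
  moreover have s: "barycoord a 1 x + barycoord a 2 x + barycoord a 3 x = 1"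
    using triangle_barycoord(3)[OF assms(1)] by (simp add: sum_3)
  ultimately have "barycoord a k x = (if k = j then 1 else 0)" for k
    using x(1)[of 1] x(1)[of 2] x(1)[of 3] exhaust_3[of k] exhaust_3[of j] by auto
  then show ?thesis
    by (intro triangle_eqI[OF assms(1) corner_in_triangle]) (simp add: barycoord_corner)
qed

section \<open>How cells, vertices and edges meet\<close>

text \<open>A letter other than \<open>j\<close> halves the \<open>j\<close>-th coordinate, which is
  at most 1 on the triangle but equal to 1 at the corner. So \<open>w\<close> consists of letters
  \<open>j\<close> only, and these fix the corner.\<close>

lemma corner_in_cell: "a j \<in> cell a w \<Longrightarrow> psi_word a w (a j) = a j"
proof (induction w)
  case (Cons i w)
  obtain y where y: "y \<in> cell a w" "a j = psi a i y"
    using Cons.prems unfolding cell_Cons by blast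
  have t: "y \<in> convex hull (bdry a)" using y cell_subset_triangle by auto
  show ?case
  proof (cases "i = j")
    case True
    then have "psi a j y = psi a j (a j)" using y(2)[symmetric] by (simp add: psi_vertex)
    then have "y = a j" by (simp add: psi_inj)
    then have "psi_word a w (a j) = a j" using Cons.IH y(1) by blast
    then show ?thesis using True by (simp add: psi_vertex)
  next
    case False
    have "barycoord a j (a j) = barycoord a j y / 2" using barycoord_psi[of j i y] False unfolding y(2)[symmetric] by simp
    then have "barycoord a j y = 2" by (simp add: barycoord_corner)
    moreover have "barycoord a j y \<le> (\<Sum>i\<in>UNIV. barycoord a i y)"
      by (rule member_le_sum) (simp_all add: triangle_barycoord(2)[OF t])
    ultimately show ?thesis using triangle_barycoord(3)[OF t] by simp
  qed
qed auto

text \<open>The finite ramification of the gasket. Common first letters are removed by injectivity;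
  at the first difference the point lies in two different first-level cells, hence is a midpoint of
  a side and a vertex of level 1.\<close>

lemma cells_meet:
  assumes "length v = length w" "v \<noteq> w" "x \<in> cell a v" "x \<in> cell a w"
  shows "x \<in> vertices a (length w)"
  using assms
proof (induction v arbitrary: w x)
  case (Cons i v)
  then obtain j w' where w: "w = j # w'" by (cases w) auto
  obtain y z where yz: "y \<in> cell a v" "z \<in> cell a w'" "x = psi a i y" "x = psi a j z"
    using Cons.prems w by (auto simp: cell_Cons)
  show ?case
  proof (cases "i = j")
    case True
    then have "y = z" using yz by (simp add: psi_inj)
    then have "y \<in> vertices a (length w')" using Cons.IH[of w' y] Cons.prems w True yz by auto
    then show ?thesis using psi_word_vertices[of y a _ "[i]"] yz w by simp
  next
    case False
    have "y = a j"
      by (rule first_level_cells_meet[of y z i j]) (use yz cell_subset_triangle False in auto)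
    then have "x \<in> vertices a (Suc 0)"
      using psi_word_vertices[of y a 0 "[i]"] yz by (auto simp: vertices_0)
    then show ?thesis using vertices_mono[of "Suc 0" "length w" a] w by auto
  qed
qed auto

text \<open>The vertex may be given by the word of another cell, and it has to be excluded that it
  lies elsewhere in this one. Where the words first differ, it is a corner of a first-level cell,
  and \<open>corner_in_cell\<close> carries this through the remaining letters.\<close>

lemma vertex_in_cell:
  assumes "x \<in> cell a w" "x \<in> vertices a (length w)"
  shows "\<exists>k. x = psi_word a w (a k)"
proof -
  obtain v k where v: "length v = length w" "x = psi_word a v (a k)"
    using assms(2) by (auto simp: vertices_def)
  show ?thesis using v assms(1)
  proof (induction v arbitrary: w x)
    case (Cons i v)
    then obtain j w' where w: "w = j # w'" by (cases w) auto
    let ?y = "psi_word a v (a k)"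
    obtain z where z: "z \<in> cell a w'" "x = psi a j z" using Cons.prems w by (auto simp: cell_Cons)
    have y: "x = psi a i ?y" using Cons.prems by simp
    show ?case
    proof (cases "i = j")
      case True
      then have "?y = z" using y z by (simp add: psi_inj)
      then obtain k' where "?y = psi_word a w' (a k')"
        using Cons.IH[of w' ?y] Cons.prems w z by auto
      then show ?thesis using y True w by auto
    next
      case False
      have t: "?y \<in> convex hull (bdry a)" "z \<in> convex hull (bdry a)"
        using cell_subset_triangle z corner_in_triangle by (auto simp: cell_def)
      have "z = a i"
        by (rule first_level_cells_meet[OF t(2,1)]) (use False y z in auto)
      then have "x = psi_word a w (a i)" using z w corner_in_cell[of i w'] by auto
      then show ?thesis by blast
    qed
  qed auto
qed

lemma closed_cell: "closed (cell a w)"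
  unfolding cell_def by (intro compact_imp_closed compact_continuous_image continuous_psi_word
      finite_imp_compact_convex_hull) auto

lemma vertices_subset_cells: "vertices a m \<subseteq> (\<Union>w\<in>{w. length w = n}. cell a w)"
proof -
  \<comment> \<open>Raised to level \<open>m + n\<close>, a vertex has a word of at least
    \<open>n\<close> letters, and the first \<open>n\<close> of them name the cell.\<close>
  have "vertices a (m + n) \<subseteq> (\<Union>w\<in>{w. length w = n}. cell a w)"
  proof
    fix x assume "x \<in> vertices a (m + n)"
    then obtain w i where w: "length w = m + n" "x = psi_word a w (a i)" by (auto simp: vertices_def)
    have "x = psi_word a (take n w) (psi_word a (drop n w) (a i))"
      using w by (simp flip: psi_word_append)
    moreover have "psi_word a (drop n w) (a i) \<in> convex hull (bdry a)"
      using cell_subset_triangle corner_in_triangle by (auto simp: cell_def)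
    ultimately have "x \<in> cell a (take n w)" by (simp add: cell_def)
    moreover have "length (take n w) = n" using w by simp
    ultimately show "x \<in> (\<Union>w\<in>{w. length w = n}. cell a w)" by blast
  qed
  then show ?thesis using vertices_mono[of m "m + n" a] by auto
qed

lemma gasket_subset_cells: "gasket a \<subseteq> (\<Union>w\<in>{w. length w = n}. cell a w)"
  unfolding gasket_def using vertices_subset_cells
  by (intro closure_minimal closed_UN finite_words) (auto simp: closed_cell)

lemma compact_gasket: "compact (gasket a)"
proof -
  have "gasket a \<subseteq> convex hull (bdry a)"
    using gasket_subset_cells[of 0] by (auto simp: cell_def)
  moreover have "compact (convex hull (bdry a))" by (intro finite_imp_compact_convex_hull) auto
  ultimately show ?thesis
    using compact_Int_closed[OF _ closed_gasket, of "convex hull (bdry a)" a] by (simp add: inf_absorb2)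
qed

lemma cell_diameter:
  assumes "x \<in> cell a w" "y \<in> cell a w"
  shows "dist x y \<le> (1/2) ^ length w"
proof -
  have d: "dist x' y' \<le> 1" if x': "x' \<in> convex hull (bdry a)" and y': "y' \<in> convex hull (bdry a)" for x' y'
  proof -
    \<comment> \<open>Balls are convex, so it suffices to test corners: first against a ball around
      a corner, then against the ball around \<open>y'\<close>.\<close>
    have "convex hull (bdry a) \<subseteq> cball (a j) 1" for j
      by (intro hull_minimal convex_cball) (auto simp: dist_corners)
    then have "y' \<in> cball (a j) 1" for j using y' by blast
    then have "bdry a \<subseteq> cball y' 1" by (auto simp: dist_commute)
    then have "convex hull (bdry a) \<subseteq> cball y' 1" by (intro hull_minimal convex_cball)
    then show ?thesis using x' by (auto simp: dist_commute)
  qed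
  obtain x' y' where "x = psi_word a w x'" "y = psi_word a w y'"
    "x' \<in> convex hull (bdry a)" "y' \<in> convex hull (bdry a)"
    using assms by (auto simp: cell_def)
  then show ?thesis using d[of x' y'] by (simp add: dist_psi_word)
qed

lemma side_subset_triangle: "closed_segment (a i) (a j) \<subseteq> convex hull (bdry a)"
  by (intro closed_segment_subset corner_in_triangle convex_convex_hull)

text \<open>The gasket is a closure of vertices, so points of a side have to be approximated. The
  two halves of a side are its images under the maps of its end corners; doubling the parameter
  therefore reduces level \<open>n + 1\<close> to level \<open>n\<close>.\<close>

lemma side_subset_gasket: "closed_segment (a i) (a j) \<subseteq> gasket a"
proof
  fix x assume x: "x \<in> closed_segment (a i) (a j)"
  have approx: "\<exists>v\<in>vertices a n. dist ((1 - u) *\<^sub>R a i + u *\<^sub>R a j) v \<le> (1/2) ^ n"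
    if "0 \<le> u" "u \<le> 1" for u n using that
  proof (induction n arbitrary: u)
    case 0
    have "a i \<in> vertices a 0" by (auto simp: vertices_0)
    moreover have "dist ((1 - u) *\<^sub>R a i + u *\<^sub>R a j) (a i) \<le> (1/2) ^ 0"
    proof -
      have "(1 - u) *\<^sub>R a i + u *\<^sub>R a j - a i = u *\<^sub>R (a j - a i)" by (simp add: algebra_simps)
      then show ?thesis using 0 dist_corners[of j i] by (auto simp: dist_norm split: if_splits)
    qed
    ultimately show ?case by blast
  next
    case (Suc n)
    obtain k u' where k: "0 \<le> u'" "u' \<le> 1"
      "(1 - u) *\<^sub>R a i + u *\<^sub>R a j = psi a k ((1 - u') *\<^sub>R a i + u' *\<^sub>R a j)"
    proof (cases "u \<le> 1/2")
      case True
      have "(1 - u) *\<^sub>R a i + u *\<^sub>R a j = psi a i ((1 - 2 * u) *\<^sub>R a i + (2 * u) *\<^sub>R a j)"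
        by (simp add: psi_conv vec_eq_iff algebra_simps)
      then show thesis using that[of "2 * u" i] True Suc.prems by auto
    next
      case False
      have "(1 - u) *\<^sub>R a i + u *\<^sub>R a j = psi a j ((1 - (2 * u - 1)) *\<^sub>R a i + (2 * u - 1) *\<^sub>R a j)"
        by (simp add: psi_conv vec_eq_iff algebra_simps)
      then show thesis using that[of "2 * u - 1" j] False Suc.prems by auto
    qed
    obtain v where v: "v \<in> vertices a n" "dist ((1 - u') *\<^sub>R a i + u' *\<^sub>R a j) v \<le> (1/2) ^ n"
      using Suc.IH k by blast
    have "psi a k v \<in> vertices a (Suc n)" using psi_word_vertices[OF v(1), of "[k]"] by simp
    moreover have "dist ((1 - u) *\<^sub>R a i + u *\<^sub>R a j) (psi a k v) \<le> (1/2) ^ Suc n"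
      using dist_psi_word[of a "[k]" "(1 - u') *\<^sub>R a i + u' *\<^sub>R a j" v] v(2) k(3) by simp
    ultimately show ?case by blast
  qed
  show "x \<in> gasket a"
    unfolding gasket_def closure_approachable
  proof (intro allI impI)
    fix e :: real assume "0 < e"
    then obtain n where n: "(1/2) ^ n < e" using real_arch_pow_inv[of e "1/2"] by auto
    obtain u where "0 \<le> u" "u \<le> 1" "x = (1 - u) *\<^sub>R a i + u *\<^sub>R a j"
      using x by (auto simp: in_segment)
    then obtain v where "v \<in> vertices a n" "dist x v \<le> (1/2) ^ n" using approx by blast
    then show "\<exists>y\<in>\<Union>n. vertices a n. dist y x < e"
      using n by (auto simp: dist_commute intro!: exI[of _ n] bexI[of _ v])
  qed
qed

lemma edge_subset_gasket: "e \<in> edges a n \<Longrightarrow> e \<subseteq> gasket a"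
  using side_subset_gasket psi_word_gasket by (fastforce simp: edges_def)

lemma network_subset_gasket: "network a n \<subseteq> gasket a"
  using edge_subset_gasket by (auto simp: network_def)

lemma vertex_on_edge:
  assumes "length w = n" "i \<noteq> j" "x \<in> closed_segment (psi_word a w (a i)) (psi_word a w (a j))"
    "x \<in> vertices a n"
  shows "x = psi_word a w (a i) \<or> x = psi_word a w (a j)"
proof -
  obtain y where y: "y \<in> closed_segment (a i) (a j)" "x = psi_word a w y"
    using assms(3) by (auto simp flip: psi_word_segment)
  then have "x \<in> cell a w" using side_subset_triangle by (auto simp: cell_def)
  then obtain k where "x = psi_word a w (a k)" using vertex_in_cell assms by blast
  then have yk: "y = a k" using y by (simp add: psi_word_inj)
  obtain u where u: "y = (1 - u) *\<^sub>R a i + u *\<^sub>R a j" using y by (auto simp: in_segment)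
  have "barycoord a k y = (1 - u) * barycoord a k (a i) + u * barycoord a k (a j)"
    unfolding u by (rule barycoord_affine)
  then have "k = i \<or> k = j" by (auto simp: yk barycoord_corner split: if_splits)
  then show ?thesis using yk y by auto
qed

text \<open>Edges of different cells meet in vertices because the cells do. Two sides of one cell
  lie opposite to different corners; at a common point both of these coordinates vanish, which
  leaves the third corner.\<close>

lemma edges_meet:
  assumes "e \<in> edges a n" "e' \<in> edges a n" "e \<noteq> e'" "x \<in> e" "x \<in> e'"
  shows "x \<in> vertices a n"
proof -
  obtain w i j where e: "length w = n" "i \<noteq> j" "e = psi_word a w ` closed_segment (a i) (a j)"
    using assms(1) by (auto simp: edges_def)
  obtain w' i' j' where e': "length w' = n" "i' \<noteq> j'" "e' = psi_word a w' ` closed_segment (a i') (a j')"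
    using assms(2) by (auto simp: edges_def)
  show ?thesis
  proof (cases "w = w'")
    case False
    have "x \<in> cell a w" "x \<in> cell a w'"
      using assms(4,5) e e' side_subset_triangle by (auto simp: cell_def)
    then show ?thesis using cells_meet[of w w' x] False e e' by auto
  next
    case True
    obtain y where y: "x = psi_word a w y" "y \<in> closed_segment (a i) (a j)" using assms(4) e by auto
    have y': "y \<in> closed_segment (a i') (a j')" using assms(5) e' y True by (auto simp: psi_word_inj)
    obtain k where k: "k \<noteq> i" "k \<noteq> j" "UNIV = {i, j, k}" using third_index[OF e(2)] by auto
    obtain k' where k': "k' \<noteq> i'" "k' \<noteq> j'" "UNIV = {i', j', k'}" using third_index[OF e'(2)] by auto
    have "k \<noteq> k'"
    proof
      assume "k = k'"
      have "{i, j} = {i, j, k} - {k}" using k(1,2) by auto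
      also have "\<dots> = {i', j', k'} - {k'}" using k(3) k'(3) \<open>k = k'\<close> by simp
      also have "\<dots> = {i', j'}" using k'(1,2) by auto
      finally have "{i, j} = {i', j'}" .
      then have "closed_segment (a i) (a j) = closed_segment (a i') (a j')"
        unfolding doubleton_eq_iff using closed_segment_commute by metis
      then have "e = e'" by (simp only: e(3) e'(3) True)
      then show False using assms(3) by simp
    qed
    then obtain m where m: "m \<noteq> k" "m \<noteq> k'" "UNIV = {k, k', m}" using third_index by blast
    have side: "barycoord a q y = 0" if "y \<in> closed_segment (a r) (a s)" "q \<noteq> r" "q \<noteq> s" for q r s
      using that by (auto simp: in_segment barycoord_affine barycoord_corner)
    have z: "barycoord a k y = 0" "barycoord a k' y = 0"
      using side[OF y(2) k(1,2)] side[OF y' k'(1,2)] by auto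
    have t: "y \<in> convex hull (bdry a)" using y side_subset_triangle by auto
    have "(\<Sum>l\<in>{k, k', m}. barycoord a l y) = 1"
      using triangle_barycoord(3)[OF t] by (simp only: m(3))
    then have "barycoord a m y = 1" using z m(1,2) \<open>k \<noteq> k'\<close> by auto
    moreover have "l = k \<or> l = k' \<or> l = m" for l
      using UNIV_I[of l] unfolding m(3) by simp
    ultimately have "barycoord a l y = barycoord a l (a m)" for l
      using z m(1,2) by (metis barycoord_corner)
    then have "y = a m" by (intro triangle_eqI t corner_in_triangle) auto
    then show ?thesis using y e by (auto simp: vertices_def)
  qed
qed

end

section \<open>Geodesic distance and admissible curves\<close>

lemma path_len_le_lipschitz:
  assumes "C-lipschitz_on {0..1} \<gamma>"
  shows "path_len \<gamma> \<le> ennreal C"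
  unfolding path_len_def
proof (rule SUP_least)
  fix ts :: "real list" assume ts: "ts \<in> {ts. sorted ts \<and> set ts \<subseteq> {0..1}}"
  have C: "C \<ge> 0" using assms by (rule lipschitz_on_nonneg)
  have mem: "ts ! i \<in> {0..1}" if "i < length ts" for i using ts that nth_mem by blast
  have "(\<Sum>i<length ts - 1. dist (\<gamma> (ts ! i)) (\<gamma> (ts ! Suc i))) \<le> (\<Sum>i<length ts - 1. C * ts ! Suc i - C * ts ! i)"
  proof (rule sum_mono)
    fix i assume i: "i \<in> {..<length ts - 1}"
    then have "ts ! i \<le> ts ! Suc i" using ts by (auto intro: sorted_nth_mono)
    moreover have "dist (\<gamma> (ts ! i)) (\<gamma> (ts ! Suc i)) \<le> C * dist (ts ! i) (ts ! Suc i)"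
      using i by (intro lipschitz_onD[OF assms] mem) auto
    ultimately show "dist (\<gamma> (ts ! i)) (\<gamma> (ts ! Suc i)) \<le> C * ts ! Suc i - C * ts ! i"
      by (simp add: dist_real_def algebra_simps)
  qed
  also have "\<dots> = C * (ts ! (length ts - 1) - ts ! 0)"
    by (subst sum_lessThan_telescope) (simp add: algebra_simps)
  also have "\<dots> \<le> C"
  proof (cases "ts = []")
    case False
    then have "ts ! (length ts - 1) - ts ! 0 \<le> 1" using mem[of 0] mem[of "length ts - 1"] by auto
    then show ?thesis using mult_left_mono[OF _ C] by fastforce
  qed (use C in simp)
  finally show "(\<Sum>i<length ts - 1. ennreal (dist (\<gamma> (ts ! i)) (\<gamma> (ts ! Suc i)))) \<le> ennreal C"
    by (subst sum_ennreal) (auto intro: ennreal_leI)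
qed

lemma dist_le_path_len: "ennreal (dist (pathstart \<gamma>) (pathfinish \<gamma>)) \<le> path_len \<gamma>"
  unfolding path_len_def
  by (rule SUP_upper2[of "[0, 1]"]) (auto simp: pathstart_def pathfinish_def)

text \<open>A fixed Lipschitz constant bounds the length and survives pointwise limits, which is
  used to pass from vertices to all points of the gasket.\<close>

definition lipschitz_path_in :: "'a::metric_space set \<Rightarrow> real \<Rightarrow> 'a \<Rightarrow> 'a \<Rightarrow> (real \<Rightarrow> 'a) \<Rightarrow> bool" where
  "lipschitz_path_in K C x y \<gamma> \<longleftrightarrow>
     C-lipschitz_on {0..1} \<gamma> \<and> \<gamma> ` {0..1} \<subseteq> K \<and> \<gamma> 0 = x \<and> \<gamma> 1 = y"

lemma lipschitz_path_inI:
  "C-lipschitz_on {0..1} \<gamma> \<Longrightarrow> \<gamma> ` {0..1} \<subseteq> K \<Longrightarrow> \<gamma> 0 = x \<Longrightarrow> \<gamma> 1 = y \<Longrightarrow> lipschitz_path_in K C x y \<gamma>"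
  by (simp add: lipschitz_path_in_def)

lemma lipschitz_path_inD:
  assumes "lipschitz_path_in K C x y \<gamma>"
  shows "C-lipschitz_on {0..1} \<gamma>" "\<gamma> ` {0..1} \<subseteq> K" "\<gamma> 0 = x" "\<gamma> 1 = y"
  using assms by (simp_all add: lipschitz_path_in_def)

text \<open>The path also matters for the lower bound: \<open>enn2real\<close> sends an infinite
  infimum to 0, and a path of finite length excludes this.\<close>

lemma geodist_bounds:
  assumes path: "lipschitz_path_in (gasket a) C x y \<gamma>"
  shows "dist x y \<le> geodist a x y" "geodist a x y \<le> C"
proof -
  note assms = lipschitz_path_inD[OF path]
  let ?P = "{\<gamma>. path \<gamma> \<and> path_image \<gamma> \<subseteq> gasket a \<and> pathstart \<gamma> = x \<and> pathfinish \<gamma> = y}"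
  have "path \<gamma>" unfolding path_def using assms(1) by (rule lipschitz_on_continuous_on)
  then have "\<gamma> \<in> ?P" using assms by (auto simp: path_image_def pathstart_def pathfinish_def)
  then have le: "(INF \<gamma>\<in>?P. path_len \<gamma>) \<le> ennreal C"
    using path_len_le_lipschitz[OF assms(1)] by (intro INF_lower2)
  then show "geodist a x y \<le> C"
    unfolding geodist_def by (intro enn2real_leI lipschitz_on_nonneg[OF assms(1)])
  have "ennreal (dist x y) \<le> (INF \<gamma>\<in>?P. path_len \<gamma>)"
    using dist_le_path_len by (intro INF_greatest) auto
  then have "enn2real (ennreal (dist x y)) \<le> enn2real (INF \<gamma>\<in>?P. path_len \<gamma>)"
    using le by (intro enn2real_mono) (auto simp: top.not_eq_extremum intro: le_less_trans)
  then show "dist x y \<le> geodist a x y" by (simp add: geodist_def)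
qed

lemma linepath_lipschitz: "(dist x y)-lipschitz_on A (linepath x (y :: 'a::real_normed_vector))"
proof (rule lipschitz_onI)
  fix s t
  have "linepath x y s - linepath x y t = (s - t) *\<^sub>R (y - x)"
    by (simp add: linepath_def algebra_simps)
  then show "dist (linepath x y s) (linepath x y t) \<le> dist x y * dist s t"
    by (simp add: dist_norm norm_minus_commute)
qed simp

lemma joinpaths_lipschitz:
  assumes "C-lipschitz_on {0..1} g" "C-lipschitz_on {0..1} h" "g 1 = h 0"
  shows "(2 * C)-lipschitz_on {0..1} (g +++ h)"
proof -
  have dist_twice: "dist (2 * s - r) (2 * t - r) = 2 * dist s t" "dist (2 * s) (2 * t) = 2 * dist s t" for r s t :: real
    by (auto simp: dist_real_def abs_if)
  have "(2 * C)-lipschitz_on {0..1} (\<lambda>t. if t \<le> 1/2 then g (2 * t) else h (2 * t - 1))"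
  proof (rule lipschitz_on_concat)
    show "(2 * C)-lipschitz_on {0..1/2} (\<lambda>t. g (2 * t))"
    proof (rule lipschitz_onI)
      fix s t :: real assume "s \<in> {0..1/2}" "t \<in> {0..1/2}"
      then show "dist (g (2 * s)) (g (2 * t)) \<le> 2 * C * dist s t"
        using lipschitz_onD[OF assms(1), of "2 * s" "2 * t"] dist_twice(2)[of s t] by auto
    qed (use lipschitz_on_nonneg[OF assms(1)] in auto)
    show "(2 * C)-lipschitz_on {1/2..1} (\<lambda>t. h (2 * t - 1))"
    proof (rule lipschitz_onI)
      fix s t :: real assume "s \<in> {1/2..1}" "t \<in> {1/2..1}"
      then show "dist (h (2 * s - 1)) (h (2 * t - 1)) \<le> 2 * C * dist s t"
        using lipschitz_onD[OF assms(2), of "2 * s - 1" "2 * t - 1"] dist_twice(1)[of s 1 t] by auto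
    qed (use lipschitz_on_nonneg[OF assms(1)] in auto)
  qed (use assms(3) in auto)
  then show ?thesis by (simp add: joinpaths_def[abs_def])
qed

context equilateral
begin

section \<open>Finiteness of the geodesic distance; admissible curves\<close>

text \<open>The constant does not depend on the level: a segment of length at most 1/2 leads from
  \<open>a 1\<close> to its image in the first-level cell, the contracted path of the previous level
  has constant 1/2, and running both at double speed gives 1 again.\<close>

lemma vertex_lipschitz_path:
  "x \<in> vertices a n \<Longrightarrow> \<exists>\<gamma>. lipschitz_path_in (gasket a) 1 (a 1) x \<gamma>"
proof (induction n arbitrary: x)
  case 0
  then obtain i where x: "x = a i" by (auto simp: vertices_0)
  have "1-lipschitz_on {0..1} (linepath (a 1) (a i))"
    using linepath_lipschitz by (rule lipschitz_on_le) (simp add: dist_corners)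
  moreover have "linepath (a 1) (a i) ` {0..1} \<subseteq> gasket a"
    using side_subset_gasket by (simp add: linepath_image_01)
  moreover have "linepath (a 1) (a i) 0 = a 1" "linepath (a 1) (a i) 1 = x"
    using x by (simp_all add: linepath_def)
  ultimately show ?case by (blast intro: lipschitz_path_inI)
next
  case (Suc n)
  obtain v k where v: "length v = Suc n" "x = psi_word a v (a k)"
    using Suc.prems by (auto simp: vertices_def)
  from v(1) obtain i w where w: "v = i # w" "length w = n"
    unfolding length_Suc_conv by blast
  have "psi_word a w (a k) \<in> vertices a n" using w(2) unfolding vertices_def by blast
  then obtain \<gamma> where "lipschitz_path_in (gasket a) 1 (a 1) (psi_word a w (a k)) \<gamma>"
    using Suc.IH by blast
  note \<gamma> = lipschitz_path_inD[OF this]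
  let ?g = "linepath (a 1) (psi a i (a 1))" and ?h = "psi a i \<circ> \<gamma>"
  have "(1/2)-lipschitz_on {0..1} ?g"
  proof (rule lipschitz_on_le[OF linepath_lipschitz])
    have "a 1 - psi a i (a 1) = (1/2) *\<^sub>R (a 1 - a i)" by (simp add: psi_conv vec_eq_iff)
    then show "dist (a 1) (psi a i (a 1)) \<le> 1/2" using dist_corners[of 1 i] by (simp only: dist_norm norm_scaleR) (simp split: if_splits)
  qed
  moreover have "(1/2)-lipschitz_on {0..1} ?h"
  proof (rule lipschitz_onI)
    fix s t :: real assume "s \<in> {0..1}" "t \<in> {0..1}"
    then show "dist (?h s) (?h t) \<le> 1/2 * dist s t"
      using lipschitz_onD[OF \<gamma>(1), of s t] dist_psi_word[of a "[i]" "\<gamma> s" "\<gamma> t"] by simp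
  qed simp
  ultimately have "(2 * (1/2))-lipschitz_on {0..1} (?g +++ ?h)"
    by (rule joinpaths_lipschitz) (simp add: linepath_def \<gamma>)
  moreover have "path_image (?g +++ ?h) \<subseteq> gasket a"
  proof -
    have "closed_segment (a 1) (psi a i (a 1)) \<subseteq> closed_segment (a 1) (a i)"
    proof -
      have "psi a i (a 1) = (1 - 1/2) *\<^sub>R a 1 + (1/2) *\<^sub>R a i" by (simp add: psi_conv)
      then have "psi a i (a 1) \<in> closed_segment (a 1) (a i)"
        unfolding in_segment by (intro exI[of _ "1/2"]) simp
      then show ?thesis by (simp add: subset_closed_segment)
    qed
    then have "path_image ?g \<subseteq> gasket a" using side_subset_gasket[of 1 i] by auto
    moreover have "path_image ?h \<subseteq> gasket a"
      using \<gamma>(2) psi_word_gasket[of _ a "[i]"] by (auto simp: path_image_def)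
    ultimately show ?thesis using path_image_join_subset[of ?g ?h] by blast
  qed
  then have "(?g +++ ?h) ` {0..1} \<subseteq> gasket a" by (simp only: path_image_def)
  moreover have "(?g +++ ?h) 0 = a 1" "(?g +++ ?h) 1 = x"
    unfolding v(2) w(1) by (simp_all add: joinpaths_def linepath_def \<gamma>(4))
  ultimately have "lipschitz_path_in (gasket a) 1 (a 1) x (?g +++ ?h)"
    by (intro lipschitz_path_inI) simp_all
  then show ?case by blast
qed

text \<open>The paths to approximating vertices share the constant 1, so by Arzela-Ascoli a
  subsequence converges uniformly; the limit stays in the closed gasket.\<close>

lemma gasket_lipschitz_path_corner:
  assumes "x \<in> gasket a"
  shows "\<exists>\<gamma>. lipschitz_path_in (gasket a) 1 (a 1) x \<gamma>"
proof -
  obtain X where X: "\<And>k. X k \<in> (\<Union>n. vertices a n)" "X \<longlonglongrightarrow> x"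
    using assms unfolding gasket_def closure_sequential by auto
  have "\<exists>\<gamma>. lipschitz_path_in (gasket a) 1 (a 1) (X k) \<gamma>" for k
    using X(1)[of k] vertex_lipschitz_path by auto
  then obtain \<gamma> where "\<And>k. lipschitz_path_in (gasket a) 1 (a 1) (X k) (\<gamma> k)" by metis
  note \<gamma> = lipschitz_path_inD[OF this]
  obtain B where B: "\<And>y. y \<in> gasket a \<Longrightarrow> norm y \<le> B"
    using compact_imp_bounded[OF compact_gasket] by (auto simp: bounded_iff)
  obtain g and r :: "nat \<Rightarrow> nat" where "continuous_on {0..1} g" and r: "strict_mono r" and
    conv: "\<And>e. 0 < e \<Longrightarrow> \<exists>N. \<forall>n t. n \<ge> N \<and> t \<in> {0..1} \<longrightarrow> norm (\<gamma> (r n) t - g t) < e"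
  proof (rule Arzela_Ascoli[of "{0..1::real}" \<gamma> B])
    fix s e :: real assume "s \<in> {0..1}" "0 < e"
    then show "\<exists>d>0. \<forall>n t. t \<in> {0..1} \<and> norm (s - t) < d \<longrightarrow> norm (\<gamma> n s - \<gamma> n t) < e"
      using lipschitz_onD[OF \<gamma>(1), of s]
      by (intro exI[of _ e]) (auto simp: dist_norm intro: le_less_trans)
  next
    fix k and t :: real assume "t \<in> {0..1}"
    then show "norm (\<gamma> k t) \<le> B" using \<gamma>(2)[of k] by (intro B) blast
  qed auto
  have lim: "(\<lambda>n. \<gamma> (r n) t) \<longlonglongrightarrow> g t" if "t \<in> {0..1}" for t
    unfolding LIMSEQ_iff using conv that by meson
  have "1-lipschitz_on {0..1} g"
  proof (rule lipschitz_onI)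
    fix s t :: real assume st: "s \<in> {0..1}" "t \<in> {0..1}"
    show "dist (g s) (g t) \<le> 1 * dist s t"
      by (rule tendsto_upperbound[OF tendsto_dist[OF lim[OF st(1)] lim[OF st(2)]]])
         (use st lipschitz_onD[OF \<gamma>(1)] in \<open>auto intro!: always_eventually\<close>)
  qed simp
  moreover have "g ` {0..1} \<subseteq> gasket a"
  proof clarify
    fix t :: real assume t: "t \<in> {0..1}"
    show "g t \<in> gasket a"
      by (rule closed_sequentially[OF closed_gasket _ lim[OF t]]) (use \<gamma>(2) t in blast)
  qed
  moreover have "g 0 = a 1"
    using LIMSEQ_unique[OF lim[of 0]] \<gamma>(3) by auto
  moreover have "g 1 = x"
    using LIMSEQ_unique[OF lim[of 1] LIMSEQ_subseq_LIMSEQ[OF X(2) r, unfolded o_def, folded \<gamma>(4)]] by auto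
  ultimately show ?thesis by (blast intro: lipschitz_path_inI)
qed

text \<open>Two paths joined at the corner \<open>a 1\<close> show that the infimum is finite, so
  that \<open>geodist\<close> is not the default value 0.\<close>

lemma dist_le_geodist:
  assumes "x \<in> gasket a" "y \<in> gasket a"
  shows "dist x y \<le> geodist a x y"
proof -
  obtain g where "lipschitz_path_in (gasket a) 1 (a 1) x g"
    using gasket_lipschitz_path_corner[OF assms(1)] by blast
  note g = lipschitz_path_inD[OF this]
  obtain h where "lipschitz_path_in (gasket a) 1 (a 1) y h"
    using gasket_lipschitz_path_corner[OF assms(2)] by blast
  note h = lipschitz_path_inD[OF this]
  have "1-lipschitz_on {0..1} (reversepath g)"
  proof (rule lipschitz_onI)
    fix s t :: real assume "s \<in> {0..1}" "t \<in> {0..1}"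
    then show "dist (reversepath g s) (reversepath g t) \<le> 1 * dist s t"
      using lipschitz_onD[OF g(1), of "1 - s" "1 - t"] by (simp add: reversepath_def dist_real_def)
  qed simp
  then have "(2 * 1)-lipschitz_on {0..1} (reversepath g +++ h)"
    using h(1) by (rule joinpaths_lipschitz) (simp add: reversepath_def g h)
  then show ?thesis
  proof (intro geodist_bounds(1) lipschitz_path_inI)
    have "path_image (reversepath g +++ h) \<subseteq> gasket a"
      using path_image_join_subset[of "reversepath g" h] g(2) h(2)
      by (simp only: path_image_reversepath) (auto simp: path_image_def)
    then show "(reversepath g +++ h) ` {0..1} \<subseteq> gasket a" by (simp add: path_image_def)
  qed (simp_all add: joinpaths_def reversepath_def g h)
qed

lemma geodist_segment:
  assumes "closed_segment x y \<subseteq> gasket a"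
  shows "geodist a x y = dist x y"
proof (rule antisym)
  show "geodist a x y \<le> dist x y"
    by (rule geodist_bounds(2)[OF lipschitz_path_inI[OF linepath_lipschitz]])
       (use assms in \<open>simp_all only: linepath_image_01 linepath_0' linepath_1'\<close>)
  show "dist x y \<le> geodist a x y" using assms by (intro dist_le_geodist) auto
qed

text \<open>This is the form in which the speed bound is used later. The Euclidean distance is good
  enough there, because the ends of an edge have Euclidean distance exactly
  \<open>edge_length n\<close>.\<close>

lemma admissible_lipschitz:
  assumes "admissible a I \<xi>"
  shows "1-lipschitz_on I \<xi>"
proof (rule lipschitz_on_leI)
  fix s t assume st: "s \<in> I" "t \<in> I" "s \<le> t"
  note ac = assms[unfolded admissible_def, THEN conjunct1, unfolded abs_cont_curve_def]
  note adm = ac[THEN conjunct1] ac[THEN conjunct2, THEN conjunct1]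
    assms[unfolded admissible_def, THEN conjunct2]
  note ac[THEN conjunct2, THEN conjunct2, THEN conjunct2, rule_format, OF st]
  note int = this[THEN conjunct1] this[THEN conjunct2]
  have sub: "{s..t} \<subseteq> I"
    using mem_is_interval_1_I[OF adm(1) st(1,2)] by auto
  have "dist (\<xi> s) (\<xi> t) \<le> geodist a (\<xi> s) (\<xi> t)"
    using adm(2) st by (intro dist_le_geodist) auto
  also note int(2)
  also have "(LINT r:{s..t}|lebesgue. metric_deriv a I \<xi> r) \<le> (LINT r:{s..t}|lebesgue. 1)"
  proof (rule set_integral_mono_AE[OF int(1)])
    show "set_integrable lebesgue {s..t} (\<lambda>r. 1 :: real)"
      by (simp add: set_integrable_def flip: lmeasurable_iff_integrable)
    show "AE r\<in>{s..t} in lebesgue. metric_deriv a I \<xi> r \<le> 1"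
      using adm(3) by (rule eventually_mono) (use sub in blast)
  qed
  also have "\<dots> = dist s t"
    using st by (simp add: set_lebesgue_integral_def dist_real_def)
  finally show "dist (\<xi> s) (\<xi> t) \<le> 1 * dist s t" by simp
qed simp

text \<open>The distinct points \<open>s0\<close> and \<open>t0\<close> exclude a one-point
  interval, on which every number would be a metric derivative and \<open>THE\<close> would not
  determine a value.\<close>

lemma unit_speed_admissible:
  assumes I: "is_interval I" "s0 \<in> I" "t0 \<in> I" "s0 \<noteq> t0"
    and im: "\<xi> ` I \<subseteq> gasket a"
    and speed: "\<And>s t. s \<in> I \<Longrightarrow> t \<in> I \<Longrightarrow> geodist a (\<xi> s) (\<xi> t) = \<bar>s - t\<bar>"
  shows "admissible a I \<xi>"
proof -
  have lim: "at t within I \<noteq> bot" if "t \<in> I" for t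
  proof -
    have "t islimpt I"
      using I that by (intro connected_imp_perfect is_interval_connected) auto
    then show ?thesis using trivial_limit_within by blast
  qed
  have has1: "has_metric_deriv a I \<xi> t 1" if "t \<in> I" for t
  proof -
    have "eventually (\<lambda>s. geodist a (\<xi> s) (\<xi> t) / \<bar>s - t\<bar> = 1) (at t within I)"
      unfolding eventually_at_topological using that speed by (intro exI[of _ UNIV]) auto
    then show ?thesis unfolding has_metric_deriv_def by (rule tendsto_eventually)
  qed
  have md: "metric_deriv a I \<xi> t = 1" if "t \<in> I" for t
    unfolding metric_deriv_def
  proof (rule the_equality)
    fix m assume "has_metric_deriv a I \<xi> t m"
    then show "m = 1"
      using has1[OF that] lim[OF that] unfolding has_metric_deriv_def by (metis tendsto_unique)
  qed (rule has1[OF that])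
  have int: "set_integrable lebesgue {s..t} (metric_deriv a I \<xi>)"
    "(LINT r:{s..t}|lebesgue. metric_deriv a I \<xi> r) = t - s" if "s \<in> I" "t \<in> I" "s \<le> t" for s t
  proof -
    have sub: "r \<in> I" if "r \<in> {s..t}" for r using mem_is_interval_1_I[OF I(1) \<open>s \<in> I\<close> \<open>t \<in> I\<close>] that by auto
    have eq: "(\<lambda>r. indicator {s..t} r *\<^sub>R metric_deriv a I \<xi> r) = indicator {s..t}"
      using md sub by (auto simp: fun_eq_iff indicator_def)
    show "set_integrable lebesgue {s..t} (metric_deriv a I \<xi>)"
      unfolding set_integrable_def eq by (simp flip: lmeasurable_iff_integrable)
    show "(LINT r:{s..t}|lebesgue. metric_deriv a I \<xi> r) = t - s"
      unfolding set_lebesgue_integral_def eq using that by simp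
  qed
  show ?thesis
    unfolding admissible_def abs_cont_curve_def
  proof (intro conjI ballI impI)
    show "AE t in lebesgue. t \<in> I \<longrightarrow> (\<exists>m. has_metric_deriv a I \<xi> t m)"
      using has1 by (intro AE_I2) blast
    show "AE t in lebesgue. t \<in> I \<longrightarrow> metric_deriv a I \<xi> t \<le> 1"
      using md by (intro AE_I2) simp
  qed (use I(1) im int speed in simp_all)
qed

end

section \<open>Network solutions along edges\<close>

lemma edge_length_pos: "edge_length n > 0"
  by (simp add: edge_length_def)

lemma clamp_eq: "s \<in> {a..b} \<Longrightarrow> max a (min b s) = (s :: real)"
  by auto

context equilateral
begin

section \<open>Edges as rays from a vertex\<close>

text \<open>Every edge can be read from either end, independently of the orientation that the
  parametrization gives it; the reading is chosen to suit each argument.\<close>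

definition edge_ray :: "nat \<Rightarrow> real^2 \<Rightarrow> real^2 \<Rightarrow> bool" where
  "edge_ray n P d \<longleftrightarrow> norm d = 1 \<and> closed_segment P (P + edge_length n *\<^sub>R d) \<in> edges a n"

abbreviation ray_edge :: "nat \<Rightarrow> real^2 \<Rightarrow> real^2 \<Rightarrow> (real^2) set" where
  "ray_edge n P d \<equiv> closed_segment P (P + edge_length n *\<^sub>R d)"

lemma edge_rayD: "edge_ray n P d \<Longrightarrow> norm d = 1" "edge_ray n P d \<Longrightarrow> ray_edge n P d \<in> edges a n"
  by (simp_all add: edge_ray_def)

lemma in_ray_edge: "y \<in> ray_edge n P d \<longleftrightarrow> (\<exists>t\<in>{0..edge_length n}. y = P + t *\<^sub>R d)"
proof
  assume "y \<in> ray_edge n P d"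
  then obtain u where u: "0 \<le> u" "u \<le> 1" "y = (1 - u) *\<^sub>R P + u *\<^sub>R (P + edge_length n *\<^sub>R d)"
    by (auto simp: in_segment)
  then have "y = P + (u * edge_length n) *\<^sub>R d" by (simp add: algebra_simps)
  moreover have "u * edge_length n \<in> {0..edge_length n}"
    using u edge_length_pos[of n] by (simp add: mult_left_le_one_le)
  ultimately show "\<exists>t\<in>{0..edge_length n}. y = P + t *\<^sub>R d" by blast
next
  assume "\<exists>t\<in>{0..edge_length n}. y = P + t *\<^sub>R d"
  then obtain t where t: "t \<in> {0..edge_length n}" "y = P + t *\<^sub>R d" by blast
  let ?u = "t / edge_length n"
  have "y = (1 - ?u) *\<^sub>R P + ?u *\<^sub>R (P + edge_length n *\<^sub>R d)"
    using edge_length_pos[of n] t by (simp add: algebra_simps)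
  moreover have "0 \<le> ?u" "?u \<le> 1" using edge_length_pos[of n] t by auto
  ultimately show "y \<in> ray_edge n P d" unfolding in_segment by blast
qed

lemma ray_in_edge: "t \<in> {0..edge_length n} \<Longrightarrow> P + t *\<^sub>R d \<in> ray_edge n P d"
  unfolding in_ray_edge by blast

lemma ray_in_network: "edge_ray n P d \<Longrightarrow> t \<in> {0..edge_length n} \<Longrightarrow> P + t *\<^sub>R d \<in> network a n"
  unfolding network_def using edge_rayD(2) ray_in_edge by blast

lemma ray_in_gasket: "edge_ray n P d \<Longrightarrow> t \<in> {0..edge_length n} \<Longrightarrow> P + t *\<^sub>R d \<in> gasket a"
  using ray_in_network network_subset_gasket by blast

lemma dist_ray: "norm d = 1 \<Longrightarrow> dist (P + s *\<^sub>R d) (P + t *\<^sub>R d) = \<bar>s - t\<bar>"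
  by (simp add: dist_norm flip: scaleR_diff_left)

lemma edge_ends:
  assumes "e \<in> edges a n"
  obtains p q where "e = closed_segment p q" "dist p q = edge_length n" "p \<in> vertices a n" "q \<in> vertices a n"
    "e \<inter> vertices a n = {p, q}"
proof -
  obtain w i j where w: "e = closed_segment (psi_word a w (a i)) (psi_word a w (a j))" "length w = n" "i \<noteq> j"
    using assms unfolding edges_conv by blast
  show thesis
  proof
    show "e = closed_segment (psi_word a w (a i)) (psi_word a w (a j))" by (rule w(1))
    show "dist (psi_word a w (a i)) (psi_word a w (a j)) = edge_length n"
      using w by (simp add: dist_psi_word dist_corners edge_length_def)
    show v: "psi_word a w (a i) \<in> vertices a n" "psi_word a w (a j) \<in> vertices a n"
      using w(2) unfolding vertices_def by blast+
    show "e \<inter> vertices a n = {psi_word a w (a i), psi_word a w (a j)}"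
      using vertex_on_edge[OF w(2,3)] v w(1) by auto
  qed
qed

lemma edge_rayI:
  assumes "closed_segment p q \<in> edges a n" "dist p q = edge_length n"
  shows "edge_ray n p ((1 / edge_length n) *\<^sub>R (q - p))"
    "p + edge_length n *\<^sub>R ((1 / edge_length n) *\<^sub>R (q - p)) = q"
  using assms edge_length_pos[of n] by (auto simp: edge_ray_def dist_norm norm_minus_commute)

lemma edge_ray_at_vertex:
  assumes "e \<in> edges a n" "x \<in> e" "x \<in> vertices a n"
  obtains d where "edge_ray n x d" "e = ray_edge n x d"
proof -
  obtain p q where pq: "e = closed_segment p q" "dist p q = edge_length n" "e \<inter> vertices a n = {p, q}"
    using edge_ends[OF assms(1)] by metis
  then have "x = p \<or> x = q" using assms by auto
  then obtain y where y: "e = closed_segment x y" "dist x y = edge_length n"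
    using pq by (metis closed_segment_commute dist_commute)
  then show thesis
    using that[of "(1 / edge_length n) *\<^sub>R (y - x)"] edge_rayI[of x y n] assms(1) by simp
qed

lemma edge_ray_ends:
  assumes "edge_ray n P d"
  shows "P \<in> vertices a n" "P + edge_length n *\<^sub>R d \<in> vertices a n"
    "ray_edge n P d \<inter> vertices a n = {P, P + edge_length n *\<^sub>R d}"
proof -
  obtain p q where pq: "ray_edge n P d = closed_segment p q" "ray_edge n P d \<inter> vertices a n = {p, q}"
    using edge_ends[OF edge_rayD(2)[OF assms]] by metis
  then have "{P, P + edge_length n *\<^sub>R d} = {p, q}" by (simp add: closed_segment_eq)
  then show "ray_edge n P d \<inter> vertices a n = {P, P + edge_length n *\<^sub>R d}" using pq(2) by simp
  then show "P \<in> vertices a n" "P + edge_length n *\<^sub>R d \<in> vertices a n" by auto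
qed

lemma ray_interior_not_vertex:
  assumes "edge_ray n P d" "0 < t" "t < edge_length n"
  shows "P + t *\<^sub>R d \<notin> vertices a n"
proof
  assume "P + t *\<^sub>R d \<in> vertices a n"
  then have "P + t *\<^sub>R d \<in> ray_edge n P d \<inter> vertices a n"
    using ray_in_edge[of t n P d] assms by auto
  then have "P + t *\<^sub>R d = P \<or> P + t *\<^sub>R d = P + edge_length n *\<^sub>R d"
    unfolding edge_ray_ends(3)[OF assms(1)] by blast
  moreover have "d \<noteq> 0" using edge_rayD(1)[OF assms(1)] by auto
  ultimately show False using assms by auto
qed

lemma ray_interior_rel_interior:
  assumes "edge_ray n P d" "0 < t" "t < edge_length n"
  shows "P + t *\<^sub>R d \<in> rel_interior (ray_edge n P d)"
proof -
  have "P + t *\<^sub>R d \<in> open_segment P (P + edge_length n *\<^sub>R d)"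
    using ray_in_edge[of t n P d] ray_interior_not_vertex[OF assms] edge_ray_ends(1,2)[OF assms(1)] assms
    unfolding open_segment_def by auto
  then show ?thesis by (auto simp: rel_interior_closed_segment)
qed

text \<open>The edge conditions speak of neighbourhoods in the whole network. The other edges form a
  closed set that misses an interior point of this one, so a small ball sees a single edge.\<close>

lemma ray_interior_eventually:
  assumes ray: "edge_ray n P d" and t: "0 < t" "t < edge_length n"
    and ev: "eventually (\<lambda>s. Q (P + s *\<^sub>R d)) (at t)"
  shows "eventually Q (at (P + t *\<^sub>R d) within network a n)"
proof -
  let ?x = "P + t *\<^sub>R d" and ?C = "\<Union>(edges a n - {ray_edge n P d})"
  have "closed ?C"
  proof (rule closed_Union)
    show "\<forall>e\<in>edges a n - {ray_edge n P d}. closed e" unfolding edges_conv by auto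
  qed (simp add: finite_edges)
  moreover have "?x \<notin> ?C"
    using edges_meet[of "ray_edge n P d" n _ ?x] edge_rayD(2)[OF ray] ray_in_edge[of t n P d] t
      ray_interior_not_vertex[OF ray t] by fastforce
  ultimately obtain \<epsilon> where \<epsilon>: "\<epsilon> > 0" "ball ?x \<epsilon> \<subseteq> - ?C"
    using openE[of "- ?C" ?x] unfolding closed_def by blast
  obtain \<delta> where \<delta>: "\<delta> > 0" "\<And>s. s \<noteq> t \<Longrightarrow> dist s t < \<delta> \<Longrightarrow> Q (P + s *\<^sub>R d)"
    using ev unfolding eventually_at by auto
  show ?thesis
    unfolding eventually_at
  proof (intro exI[of _ "min \<epsilon> \<delta>"] conjI ballI impI)
    fix y assume y: "y \<in> network a n" "y \<noteq> ?x \<and> dist y ?x < min \<epsilon> \<delta>"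
    then have "y \<notin> ?C" using \<epsilon>(2) by (auto simp: dist_commute subset_iff)
    then have "y \<in> ray_edge n P d" using y(1) unfolding network_def by blast
    then obtain s where s: "y = P + s *\<^sub>R d" unfolding in_ray_edge by blast
    then have "dist y ?x = dist s t" using dist_ray[OF edge_rayD(1)[OF ray]] by (simp add: dist_real_def)
    then show "Q y" using \<delta>(2)[of s] y(2) s by auto
  qed (use \<epsilon> \<delta> in auto)
qed

end

locale parametrized_gasket = equilateral +
  fixes \<pi> :: "(real^2) set \<Rightarrow> real \<Rightarrow> real^2"
  assumes params: "arclength_params a \<pi>"
begin

section \<open>Derivatives and test functions on edges and at vertices\<close>

text \<open>The images of 0 and \<open>edge_length n\<close> have distance
  \<open>edge_length n\<close>, so they are the two ends of the edge; the distance to the image of 0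
  then determines every other point.\<close>

lemma param_cases:
  assumes ray: "edge_ray n P d"
  shows "(\<forall>s\<in>{0..edge_length n}. \<pi> (ray_edge n P d) s = P + s *\<^sub>R d) \<or>
    (\<forall>s\<in>{0..edge_length n}. \<pi> (ray_edge n P d) s = P + (edge_length n - s) *\<^sub>R d)"
proof -
  let ?e = "ray_edge n P d" and ?h = "edge_length n"
  have im: "\<pi> ?e ` {0..?h} = ?e"
    and iso: "\<And>s t. s \<in> {0..?h} \<Longrightarrow> t \<in> {0..?h} \<Longrightarrow> dist (\<pi> ?e s) (\<pi> ?e t) = \<bar>s - t\<bar>"
    using params edge_rayD(2)[OF ray] unfolding arclength_params_def by blast+
  have "\<forall>s\<in>{0..?h}. \<exists>t\<in>{0..?h}. \<pi> ?e s = P + t *\<^sub>R d"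
    using im in_ray_edge by blast
  then obtain \<tau> where \<tau>: "\<And>s. s \<in> {0..?h} \<Longrightarrow> \<tau> s \<in> {0..?h}"
    "\<And>s. s \<in> {0..?h} \<Longrightarrow> \<pi> ?e s = P + \<tau> s *\<^sub>R d" by metis
  have \<tau>d: "\<bar>\<tau> s - \<tau> t\<bar> = \<bar>s - t\<bar>" if "s \<in> {0..?h}" "t \<in> {0..?h}" for s t
    using iso[OF that] unfolding \<tau>(2)[OF that(1)] \<tau>(2)[OF that(2)] dist_ray[OF edge_rayD(1)[OF ray]] .
  have h: "0 \<in> {0..?h}" "?h \<in> {0..?h}" using edge_length_pos[of n] by auto
  have "(\<tau> 0 = 0 \<and> \<tau> ?h = ?h) \<or> (\<tau> 0 = ?h \<and> \<tau> ?h = 0)"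
    using \<tau>d[OF h] \<tau>(1)[OF h(1)] \<tau>(1)[OF h(2)] by auto
  then consider "\<tau> 0 = 0" | "\<tau> 0 = ?h" by blast
  then show ?thesis
  proof cases
    case 1
    have "\<tau> s = s" if "s \<in> {0..?h}" for s using \<tau>d[OF that h(1)] \<tau>(1)[OF that] that 1 by auto
    then show ?thesis using \<tau>(2) by simp
  next
    case 2
    have "\<tau> s = ?h - s" if "s \<in> {0..?h}" for s using \<tau>d[OF that h(1)] \<tau>(1)[OF that] that 2 by auto
    then show ?thesis using \<tau>(2) by simp
  qed
qed

lemma edge_coord_param:
  assumes "edge_ray n P d" "s \<in> {0..edge_length n}"
  shows "edge_coord \<pi> n (ray_edge n P d) (\<pi> (ray_edge n P d) s) = s"
  unfolding edge_coord_def
proof (rule inv_into_f_f)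
  let ?e = "ray_edge n P d" and ?h = "edge_length n"
  have iso: "\<And>s t. s \<in> {0..?h} \<Longrightarrow> t \<in> {0..?h} \<Longrightarrow> dist (\<pi> ?e s) (\<pi> ?e t) = \<bar>s - t\<bar>"
    using params edge_rayD(2)[OF assms(1)] unfolding arclength_params_def by blast
  show "inj_on (\<pi> ?e) {0..?h}"
  proof (rule inj_onI)
    fix s t assume "s \<in> {0..?h}" "t \<in> {0..?h}" "\<pi> ?e s = \<pi> ?e t"
    then show "s = t" using iso[of s t] by simp
  qed
qed (use assms in simp)

text \<open>Reversing the parametrization changes the sign of the derivative and of
  \<open>orient\<close>. The absolute value and, at the vertex \<open>P\<close>, the product with
  \<open>orient\<close> are therefore intrinsic; the latter is the derivative in the direction away
  from \<open>P\<close>.\<close>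

lemma edge_deriv_along_ray:
  assumes ray: "edge_ray n P d" and t: "t \<in> {0..edge_length n}"
    and D: "((\<lambda>s. \<phi> (P + s *\<^sub>R d)) has_real_derivative p) (at t within {0..edge_length n})"
  shows "edge_differentiable \<pi> n (ray_edge n P d) \<phi> (P + t *\<^sub>R d)"
    "\<bar>edge_deriv \<pi> n (ray_edge n P d) \<phi> (P + t *\<^sub>R d)\<bar> = \<bar>p\<bar>"
    "t = 0 \<Longrightarrow> orient \<pi> n P (ray_edge n P d) * edge_deriv \<pi> n (ray_edge n P d) \<phi> P = p"
proof -
  let ?e = "ray_edge n P d" and ?h = "edge_length n"
  have h: "?h > 0" by (rule edge_length_pos)
  have d0: "d \<noteq> 0" using edge_rayD(1)[OF ray] by auto
  have "edge_differentiable \<pi> n ?e \<phi> (P + t *\<^sub>R d) \<and> \<bar>edge_deriv \<pi> n ?e \<phi> (P + t *\<^sub>R d)\<bar> = \<bar>p\<bar> \<and>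
    (t = 0 \<longrightarrow> orient \<pi> n P ?e * edge_deriv \<pi> n ?e \<phi> P = p)"
    using param_cases[OF ray]
  proof
    assume al: "\<forall>s\<in>{0..?h}. \<pi> ?e s = P + s *\<^sub>R d"
    then have c: "edge_coord \<pi> n ?e (P + t *\<^sub>R d) = t" using edge_coord_param[OF ray t] t by simp
    have "((\<phi> \<circ> \<pi> ?e) has_real_derivative p) (at t within {0..?h})"
      by (rule has_field_derivative_transform_within[OF D zero_less_one t]) (use al in simp)
    then have vd: "((\<phi> \<circ> \<pi> ?e) has_vector_derivative p) (at t within {0..?h})"
      by (simp add: has_real_derivative_iff_has_vector_derivative)
    have "edge_deriv \<pi> n ?e \<phi> (P + t *\<^sub>R d) = p"
      unfolding edge_deriv_def c using vector_derivative_within_closed_interval[OF h t vd] .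
    moreover have "edge_differentiable \<pi> n ?e \<phi> (P + t *\<^sub>R d)"
      unfolding edge_differentiable_def c using differentiableI_vector[OF vd] .
    moreover have "orient \<pi> n P ?e = 1" unfolding orient_def using al h by simp
    ultimately show ?thesis by auto
  next
    assume al: "\<forall>s\<in>{0..?h}. \<pi> ?e s = P + (?h - s) *\<^sub>R d"
    have t': "?h - t \<in> {0..?h}" using t by auto
    then have c: "edge_coord \<pi> n ?e (P + t *\<^sub>R d) = ?h - t" using edge_coord_param[OF ray t'] al by simp
    have im: "(\<lambda>s. ?h - s) ` {0..?h} = {0..?h}" by (simp add: image_diff_atLeastAtMost)
    have "((\<lambda>s. \<phi> (P + s *\<^sub>R d)) has_real_derivative p) (at (?h - (?h - t)) within (\<lambda>s. ?h - s) ` {0..?h})"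
      unfolding im using D by simp
    then have "((\<lambda>s. \<phi> (P + (?h - s) *\<^sub>R d)) has_real_derivative p * (-1)) (at (?h - t) within {0..?h})"
      by (rule DERIV_image_chain[unfolded o_def]) (auto intro!: derivative_eq_intros)
    then have "((\<phi> \<circ> \<pi> ?e) has_real_derivative p * (-1)) (at (?h - t) within {0..?h})"
      by (rule has_field_derivative_transform_within[OF _ zero_less_one t']) (use al in simp)
    then have vd: "((\<phi> \<circ> \<pi> ?e) has_vector_derivative - p) (at (?h - t) within {0..?h})"
      by (simp add: has_real_derivative_iff_has_vector_derivative)
    have "edge_deriv \<pi> n ?e \<phi> (P + t *\<^sub>R d) = - p"
      unfolding edge_deriv_def c using vector_derivative_within_closed_interval[OF h t' vd] .
    moreover have "edge_differentiable \<pi> n ?e \<phi> (P + t *\<^sub>R d)"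
      unfolding edge_differentiable_def c using differentiableI_vector[OF vd] .
    \<comment> \<open>Since \<open>d\<close> is nonzero, the parametrization does not start at
      \<open>P\<close>, and the second case of \<open>orient\<close> applies.\<close>
    moreover have "orient \<pi> n P ?e = - 1" unfolding orient_def using al h d0 by simp
    ultimately show ?thesis by auto
  qed
  then show "edge_differentiable \<pi> n ?e \<phi> (P + t *\<^sub>R d)"
    "\<bar>edge_deriv \<pi> n ?e \<phi> (P + t *\<^sub>R d)\<bar> = \<bar>p\<bar>"
    "t = 0 \<Longrightarrow> orient \<pi> n P ?e * edge_deriv \<pi> n ?e \<phi> P = p" by auto
qed

text \<open>Test functions have to be continuous on the whole network. The given function is
  extended by orthogonal projection to the line of the edge, clamped to its ends.\<close>

lemma interior_test_function:
  assumes ray: "edge_ray n P d" and t: "0 < t" "t < edge_length n"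
    and \<Phi>: "continuous_on {0..edge_length n} \<Phi>" "(\<Phi> has_real_derivative p) (at t)"
  obtains \<phi> where "edge_test a \<pi> n (ray_edge n P d) (P + t *\<^sub>R d) \<phi>"
    "\<bar>edge_deriv \<pi> n (ray_edge n P d) \<phi> (P + t *\<^sub>R d)\<bar> = \<bar>p\<bar>"
    "\<And>s. s \<in> {0..edge_length n} \<Longrightarrow> \<phi> (P + s *\<^sub>R d) = \<Phi> s"
proof -
  let ?h = "edge_length n"
  define \<phi> where "\<phi> y = \<Phi> (max 0 (min ?h ((y - P) \<bullet> d)))" for y
  have "d \<bullet> d = 1" using edge_rayD(1)[OF ray] by (simp add: dot_square_norm)
  then have \<phi>: "\<phi> (P + s *\<^sub>R d) = \<Phi> s" if "s \<in> {0..?h}" for s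
    using that by (simp add: \<phi>_def clamp_eq)
  have "continuous_on (network a n) \<phi>"
    unfolding \<phi>_def
    by (rule continuous_on_compose2[OF \<Phi>(1)])
       (use edge_length_pos[of n] in \<open>auto intro!: continuous_intros\<close>)
  moreover have t': "t \<in> {0..?h}" using t by auto
  have "((\<lambda>s. \<phi> (P + s *\<^sub>R d)) has_real_derivative p) (at t within {0..?h})"
    by (rule has_field_derivative_transform_within[OF DERIV_subset[OF \<Phi>(2)] zero_less_one t'])
       (use \<phi> in auto)
  note edge_deriv_along_ray[OF ray t' this]
  ultimately show thesis using that[of \<phi>] \<phi> unfolding edge_test_def by blast
qed

lemma vertex_test_function:
  assumes rays: "edge_ray n x d1" "edge_ray n x d2" "d1 \<noteq> d2"
    and \<Phi>: "continuous_on {- edge_length n..edge_length n} \<Phi>" "(\<Phi> has_real_derivative p) (at 0)"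
  obtains \<phi> where "vertex_test a \<pi> n (ray_edge n x d1) (ray_edge n x d2) x \<phi>"
    "\<bar>edge_deriv \<pi> n (ray_edge n x d1) \<phi> x\<bar> = \<bar>p\<bar>"
    "\<And>s. s \<in> {0..edge_length n} \<Longrightarrow> \<phi> (x + s *\<^sub>R d1) = \<Phi> (- s)"
    "\<And>s. s \<in> {0..edge_length n} \<Longrightarrow> \<phi> (x + s *\<^sub>R d2) = \<Phi> s"
proof -
  let ?h = "edge_length n"
  have unit: "d1 \<bullet> d1 = 1" "d2 \<bullet> d2 = 1"
    using rays edge_rayD(1) by (simp_all add: dot_square_norm)
  have "(d2 - d1) \<bullet> (d2 - d1) > 0" using rays(3) by simp
  then have pos: "1 - d1 \<bullet> d2 > 0"
    using unit by (simp add: inner_diff_left inner_diff_right inner_commute)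
  \<comment> \<open>The component along \<open>d2 - d1\<close> is
    \<open>s * (1 - d1 \<bullet> d2)\<close> on the second ray and its negative on the first, as
    both directions are unit vectors. So \<open>L\<close> unfolds the two edges onto one line, and
    the outward derivatives become \<open>p\<close> and \<open>- p\<close>, whose sum is 0.\<close>
  define L where "L y = ((y - x) \<bullet> (d2 - d1)) / (1 - d1 \<bullet> d2)" for y
  have L: "L (x + s *\<^sub>R d2) = s" "L (x + s *\<^sub>R d1) = - s" for s
    using pos unit by (simp_all add: L_def inner_diff_right inner_commute field_simps)
  define \<phi> where "\<phi> y = \<Phi> (max (- ?h) (min ?h (L y)))" for y
  have \<phi>2: "\<phi> (x + s *\<^sub>R d2) = \<Phi> s" if "s \<in> {0..?h}" for s
    using that unfolding \<phi>_def L by (subst clamp_eq) auto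
  have \<phi>1: "\<phi> (x + s *\<^sub>R d1) = \<Phi> (- s)" if "s \<in> {0..?h}" for s
    using that unfolding \<phi>_def L by (subst clamp_eq) auto
  have cont: "continuous_on (network a n) \<phi>"
    unfolding \<phi>_def L_def
    by (rule continuous_on_compose2[OF \<Phi>(1)])
       (use edge_length_pos[of n] pos in \<open>auto intro!: continuous_intros\<close>)
  have 0: "0 \<in> {0..?h}" using edge_length_pos[of n] by auto
  have "((\<lambda>s. \<phi> (x + s *\<^sub>R d2)) has_real_derivative p) (at 0 within {0..?h})"
    by (rule has_field_derivative_transform_within[OF DERIV_subset[OF \<Phi>(2)] zero_less_one 0])
       (use \<phi>2 in auto)
  note 2 = edge_deriv_along_ray[OF rays(2) 0 this]
  have "((\<lambda>s. \<Phi> (- s)) has_real_derivative - p) (at 0)"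
    using \<Phi>(2) DERIV_mirror[of \<Phi> p 0] by simp
  then have "((\<lambda>s. \<phi> (x + s *\<^sub>R d1)) has_real_derivative - p) (at 0 within {0..?h})"
    by (intro has_field_derivative_transform_within[OF DERIV_subset[OF _ subset_UNIV] zero_less_one 0])
       (use \<phi>1 in auto)
  note 1 = edge_deriv_along_ray[OF rays(1) 0 this]
  show thesis
  proof
    show "vertex_test a \<pi> n (ray_edge n x d1) (ray_edge n x d2) x \<phi>"
      using cont 1(1) 2(1) 1(3)[OF refl] 2(3)[OF refl] by (simp add: vertex_test_def)
    show "\<bar>edge_deriv \<pi> n (ray_edge n x d1) \<phi> x\<bar> = \<bar>p\<bar>" using 1(2) by simp
  qed (use \<phi>1 \<phi>2 in auto)
qed

section \<open>Inequalities for network solutions on edges and at vertices\<close>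

lemma network_solution_continuous: "network_solution a \<pi> n f u \<Longrightarrow> continuous_on (network a n) u"
  unfolding network_solution_def network_subsolution_def network_supersolution_def
  by (intro usc_lsc_imp_continuous) blast+

lemma continuous_on_ray:
  assumes "continuous_on (network a n) u" "edge_ray n P d"
  shows "continuous_on {0..edge_length n} (\<lambda>s. u (P + s *\<^sub>R d))"
  by (rule continuous_on_compose2[OF assms(1)])
     (use ray_in_network[OF assms(2)] in \<open>auto intro!: continuous_intros\<close>)

lemma network_subsolution_on_ray:
  assumes sol: "network_solution a \<pi> n f u" and ray: "edge_ray n P d"
    and F: "\<And>t. t \<in> {0..edge_length n} \<Longrightarrow>
      (F has_real_derivative f (P + t *\<^sub>R d)) (at t within {0..edge_length n})"
    and st: "s \<in> {0..edge_length n}" "t \<in> {0..edge_length n}"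
  shows "\<bar>u (P + s *\<^sub>R d) - u (P + t *\<^sub>R d)\<bar> \<le> \<bar>F s - F t\<bar>"
proof (rule suboptimality_interval[OF continuous_on_ray[OF network_solution_continuous[OF sol] ray] F _ st])
  fix t \<Phi> p assume t: "0 < t" "t < edge_length n"
    and \<Phi>: "continuous_on {0..edge_length n} \<Phi>" "(\<Phi> has_real_derivative p) (at t)"
    and ev: "eventually (\<lambda>s. u (P + s *\<^sub>R d) - \<Phi> s \<le> u (P + t *\<^sub>R d) - \<Phi> t) (at t)"
  obtain \<phi> where \<phi>: "edge_test a \<pi> n (ray_edge n P d) (P + t *\<^sub>R d) \<phi>"
    "\<bar>edge_deriv \<pi> n (ray_edge n P d) \<phi> (P + t *\<^sub>R d)\<bar> = \<bar>p\<bar>"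
    "\<And>s. s \<in> {0..edge_length n} \<Longrightarrow> \<phi> (P + s *\<^sub>R d) = \<Phi> s"
    using interior_test_function[OF ray t \<Phi>] by metis
  have "eventually (\<lambda>s. s \<in> {0..edge_length n}) (at t)"
    by (rule eventually_at_interior_interval[OF t]) simp
  with ev have "eventually (\<lambda>s. u (P + s *\<^sub>R d) - \<phi> (P + s *\<^sub>R d) \<le> u (P + t *\<^sub>R d) - \<phi> (P + t *\<^sub>R d)) (at t)"
    by eventually_elim (use \<phi>(3) t in simp)
  then have "local_max_on (network a n) (\<lambda>y. u y - \<phi> y) (P + t *\<^sub>R d)"
    unfolding local_max_on_def by (rule ray_interior_eventually[OF ray t])
  then show "\<bar>p\<bar> \<le> f (P + t *\<^sub>R d)"
    using sol \<phi>(1,2) edge_rayD(2)[OF ray] ray_interior_rel_interior[OF ray t]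
    unfolding network_solution_def network_subsolution_def by metis
qed

lemma network_supersolution_interior:
  assumes sol: "network_solution a \<pi> n f u" and ray: "edge_ray n P d"
    and t: "0 < t" "t < edge_length n"
    and \<Phi>: "continuous_on {0..edge_length n} \<Phi>" "(\<Phi> has_real_derivative p) (at t)"
    and ev: "eventually (\<lambda>s. u (P + t *\<^sub>R d) - \<Phi> t \<le> u (P + s *\<^sub>R d) - \<Phi> s) (at t)"
  shows "f (P + t *\<^sub>R d) \<le> \<bar>p\<bar>"
proof -
  obtain \<phi> where \<phi>: "edge_test a \<pi> n (ray_edge n P d) (P + t *\<^sub>R d) \<phi>"
    "\<bar>edge_deriv \<pi> n (ray_edge n P d) \<phi> (P + t *\<^sub>R d)\<bar> = \<bar>p\<bar>"
    "\<And>s. s \<in> {0..edge_length n} \<Longrightarrow> \<phi> (P + s *\<^sub>R d) = \<Phi> s"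
    using interior_test_function[OF ray t \<Phi>] by metis
  have "eventually (\<lambda>s. s \<in> {0..edge_length n}) (at t)"
    by (rule eventually_at_interior_interval[OF t]) simp
  with ev have "eventually (\<lambda>s. u (P + t *\<^sub>R d) - \<phi> (P + t *\<^sub>R d) \<le> u (P + s *\<^sub>R d) - \<phi> (P + s *\<^sub>R d)) (at t)"
    by eventually_elim (use \<phi>(3) t in simp)
  then have "local_min_on (network a n) (\<lambda>y. u y - \<phi> y) (P + t *\<^sub>R d)"
    unfolding local_min_on_def by (rule ray_interior_eventually[OF ray t])
  then show ?thesis
    using sol \<phi>(1,2) edge_rayD(2)[OF ray] ray_interior_rel_interior[OF ray t]
    unfolding network_solution_def network_supersolution_def by metis
qed

lemma network_supersolution_on_ray:
  assumes sol: "network_solution a \<pi> n f u" and ray: "edge_ray n P d"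
    and F: "\<And>t. t \<in> {0..edge_length n} \<Longrightarrow>
      (F has_real_derivative f (P + t *\<^sub>R d)) (at t within {0..edge_length n})"
    and fpos: "\<And>x. x \<in> gasket a \<Longrightarrow> 0 < f x"
    and t: "0 < t" "t < edge_length n"
  shows "u P + \<bar>F t - F 0\<bar> \<le> u (P + t *\<^sub>R d) \<or>
    u (P + edge_length n *\<^sub>R d) + \<bar>F (edge_length n) - F t\<bar> \<le> u (P + t *\<^sub>R d)"
proof -
  have "u (P + 0 *\<^sub>R d) + \<bar>F t - F 0\<bar> \<le> u (P + t *\<^sub>R d) \<or>
    u (P + edge_length n *\<^sub>R d) + \<bar>F (edge_length n) - F t\<bar> \<le> u (P + t *\<^sub>R d)"
  proof (rule superoptimality_interval[where w = "\<lambda>s. u (P + s *\<^sub>R d)", OF t _ F])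
    show "lsc_on {0..edge_length n} (\<lambda>s. u (P + s *\<^sub>R d))"
      by (intro continuous_imp_lsc continuous_on_ray[OF network_solution_continuous[OF sol] ray])
    show "0 < f (P + t *\<^sub>R d)" if "0 < t" "t < edge_length n" for t
      using that by (intro fpos ray_in_gasket[OF ray]) auto
  qed (use network_supersolution_interior[OF sol ray] in blast)+
  then show ?thesis by simp
qed

lemma vertex_eventually:
  assumes "edge_ray n x d1" "edge_ray n x d2" and \<delta>: "\<delta> > 0"
    and Q1: "\<And>s. 0 < s \<Longrightarrow> s < \<delta> \<Longrightarrow> s \<le> edge_length n \<Longrightarrow> Q (x + s *\<^sub>R d1)"
    and Q2: "\<And>s. 0 < s \<Longrightarrow> s < \<delta> \<Longrightarrow> s \<le> edge_length n \<Longrightarrow> Q (x + s *\<^sub>R d2)"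
  shows "eventually Q (at x within ray_edge n x d1 \<union> ray_edge n x d2)"
  unfolding eventually_at
proof (intro exI[of _ \<delta>] conjI ballI impI)
  fix y assume "y \<in> ray_edge n x d1 \<union> ray_edge n x d2" and y: "y \<noteq> x \<and> dist y x < \<delta>"
  then consider s where "s \<in> {0..edge_length n}" "y = x + s *\<^sub>R d1" |
    s where "s \<in> {0..edge_length n}" "y = x + s *\<^sub>R d2"
    unfolding Un_iff in_ray_edge by blast
  then show "Q y"
  proof cases
    case 1
    then have "dist y x = s" using edge_rayD(1)[OF assms(1)] by (simp add: dist_norm)
    then show ?thesis using Q1[of s] 1 y by auto
  next
    case 2
    then have "dist y x = s" using edge_rayD(1)[OF assms(2)] by (simp add: dist_norm)
    then show ?thesis using Q2[of s] 2 y by auto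
  qed
qed (rule \<delta>)

text \<open>Two edges at an inner vertex are concatenated to the curve \<open>\<gamma>\<close>, along which the vertex
  condition is an ordinary viscosity condition at \<open>0\<close>.\<close>

lemma network_supersolution_at_vertex:
  assumes sol: "network_solution a \<pi> n f u" and x: "x \<in> inner_vertices a n"
    and f: "continuous_on (gasket a) f" and fpos: "\<And>x. x \<in> gasket a \<Longrightarrow> 0 < f x"
  obtains d F where "edge_ray n x d"
    "\<And>t. t \<in> {0..edge_length n} \<Longrightarrow>
      (F has_real_derivative f (x + t *\<^sub>R d)) (at t within {0..edge_length n})"
    "u (x + edge_length n *\<^sub>R d) + \<bar>F (edge_length n) - F 0\<bar> \<le> u x"
proof -
  let ?h = "edge_length n"
  have h: "?h > 0" by (rule edge_length_pos)
  have xv: "x \<in> vertices a n" using x by (simp add: inner_vertices_def)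
  obtain e where e: "e \<in> incident a n x"
  proof -
    obtain w i where w: "length w = n" "x = psi_word a w (a i)" using xv by (auto simp: vertices_def)
    obtain j :: 3 where "j \<noteq> i" using third_index[of 1 2] by (metis one_neq_zero)
    then have "psi_word a w ` closed_segment (a i) (a j) \<in> edges a n" "x \<in> psi_word a w ` closed_segment (a i) (a j)"
      using w by (auto simp: edges_def)
    then show thesis using that unfolding incident_def by blast
  qed
  \<comment> \<open>The partner edge is the same for all test functions, so the curve through
    \<open>x\<close> can be fixed before any test function is given.\<close>
  obtain e' where e': "e' \<in> incident a n x - {e}" and
    sup: "\<And>\<phi>. vertex_test a \<pi> n e e' x \<phi> \<Longrightarrow> local_min_on (e \<union> e') (\<lambda>y. u y - \<phi> y) x \<Longrightarrow>
      f x \<le> \<bar>edge_deriv \<pi> n e \<phi> x\<bar>"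
    using sol e x unfolding network_solution_def network_supersolution_def by meson
  obtain d1 where d1: "edge_ray n x d1" "e = ray_edge n x d1"
    using edge_ray_at_vertex[of e n x] e xv unfolding incident_def by blast
  obtain d2 where d2: "edge_ray n x d2" "e' = ray_edge n x d2"
    using edge_ray_at_vertex[of e' n x] e' xv unfolding incident_def by blast
  have ne: "d1 \<noteq> d2" using d1 d2 e' by auto
  define \<gamma> where "\<gamma> s = x + max 0 (- s) *\<^sub>R d1 + max 0 s *\<^sub>R d2" for s
  have \<gamma>2: "\<gamma> s = x + s *\<^sub>R d2" if "s \<ge> 0" for s using that by (simp add: \<gamma>_def)
  have \<gamma>1: "\<gamma> s = x + (- s) *\<^sub>R d1" if "s \<le> 0" for s using that by (simp add: \<gamma>_def max_def)
  have \<gamma>n: "\<gamma> s \<in> network a n" if "s \<in> {-?h..?h}" for s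
  proof (cases "s \<ge> 0")
    case True
    then show ?thesis using ray_in_network[OF d2(1), of s] that by (simp add: \<gamma>2)
  next
    case False
    then show ?thesis using ray_in_network[OF d1(1), of "- s"] that by (simp add: \<gamma>1)
  qed
  then have \<gamma>g: "\<gamma> s \<in> gasket a" if "s \<in> {-?h..?h}" for s
    using that network_subset_gasket by blast
  have cont\<gamma>: "continuous_on {-?h..?h} \<gamma>" unfolding \<gamma>_def by (intro continuous_intros)
  have contf: "continuous_on {-?h..?h} (\<lambda>s. f (\<gamma> s))"
    by (rule continuous_on_compose2[OF f cont\<gamma>]) (use \<gamma>g in auto)
  have contu: "continuous_on {-?h..?h} (\<lambda>s. u (\<gamma> s))"
    by (rule continuous_on_compose2[OF network_solution_continuous[OF sol] cont\<gamma>]) (use \<gamma>n in auto)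
  obtain F where F: "\<And>t. t \<in> {-?h..?h} \<Longrightarrow> (F has_real_derivative f (\<gamma> t)) (at t within {-?h..?h})"
    using antiderivative_continuous[OF contf] by (auto simp: has_real_derivative_iff_has_vector_derivative)
  have "u (\<gamma> (- ?h)) + \<bar>F 0 - F (- ?h)\<bar> \<le> u (\<gamma> 0) \<or> u (\<gamma> ?h) + \<bar>F ?h - F 0\<bar> \<le> u (\<gamma> 0)"
  proof (rule superoptimality_interval[where w = "\<lambda>s. u (\<gamma> s)", OF _ _ continuous_imp_lsc[OF contu] F])
    fix t \<Phi> p assume t: "- ?h < t" "t < ?h"
      and \<Phi>: "continuous_on {-?h..?h} \<Phi>" "(\<Phi> has_real_derivative p) (at t)"
      and ev: "eventually (\<lambda>s. u (\<gamma> t) - \<Phi> t \<le> u (\<gamma> s) - \<Phi> s) (at t)"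
    \<comment> \<open>Away from 0 the curve runs inside one edge, where the interior condition
      applies.\<close>
    consider "t = 0" | "t > 0" | "t < 0" by linarith
    then show "f (\<gamma> t) \<le> \<bar>p\<bar>"
    proof cases
      case 1
      then obtain \<phi> where \<phi>: "vertex_test a \<pi> n (ray_edge n x d1) (ray_edge n x d2) x \<phi>"
        "\<bar>edge_deriv \<pi> n (ray_edge n x d1) \<phi> x\<bar> = \<bar>p\<bar>"
        "\<And>s. s \<in> {0..?h} \<Longrightarrow> \<phi> (x + s *\<^sub>R d1) = \<Phi> (- s)"
        "\<And>s. s \<in> {0..?h} \<Longrightarrow> \<phi> (x + s *\<^sub>R d2) = \<Phi> s"
        using vertex_test_function[OF d1(1) d2(1) ne \<Phi>(1)] \<Phi>(2) by metis
      have \<phi>x: "\<phi> x = \<Phi> 0" using \<phi>(4)[of 0] h by simp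
      obtain \<delta> where \<delta>: "\<delta> > 0" "\<And>s. s \<noteq> 0 \<Longrightarrow> \<bar>s\<bar> < \<delta> \<Longrightarrow> u x - \<Phi> 0 \<le> u (\<gamma> s) - \<Phi> s"
        using ev 1 \<gamma>2[of 0] unfolding eventually_at by (auto simp: dist_real_def)
      have "local_min_on (ray_edge n x d1 \<union> ray_edge n x d2) (\<lambda>y. u y - \<phi> y) x"
        unfolding local_min_on_def
      proof (rule vertex_eventually[OF d1(1) d2(1) \<delta>(1)])
        fix s assume s: "0 < s" "s < \<delta>" "s \<le> ?h"
        show "u x - \<phi> x \<le> u (x + s *\<^sub>R d1) - \<phi> (x + s *\<^sub>R d1)"
          using \<delta>(2)[of "- s"] \<phi>(3)[of s] \<gamma>1[of "- s"] s \<phi>x by simp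
        show "u x - \<phi> x \<le> u (x + s *\<^sub>R d2) - \<phi> (x + s *\<^sub>R d2)"
          using \<delta>(2)[of s] \<phi>(4)[of s] \<gamma>2[of s] s \<phi>x by simp
      qed
      then show ?thesis using sup[of \<phi>] \<phi>(1,2) d1(2) d2(2) 1 \<gamma>2[of 0] by simp
    next
      case 2
      have "f (x + t *\<^sub>R d2) \<le> \<bar>p\<bar>"
      proof (rule network_supersolution_interior[OF sol d2(1) 2 t(2) _ \<Phi>(2)])
        show "continuous_on {0..?h} \<Phi>" by (rule continuous_on_subset[OF \<Phi>(1)]) (use h in auto)
        have "eventually (\<lambda>s. s \<in> {0..?h}) (at t)"
          by (rule eventually_at_interior_interval[OF 2 t(2)]) simp
        with ev show "eventually (\<lambda>s. u (x + t *\<^sub>R d2) - \<Phi> t \<le> u (x + s *\<^sub>R d2) - \<Phi> s) (at t)"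
          by eventually_elim (use 2 \<gamma>2 in simp)
      qed
      then show ?thesis using 2 \<gamma>2[of t] by simp
    next
      case 3
      have "f (x + (- t) *\<^sub>R d1) \<le> \<bar>- p\<bar>"
      proof (rule network_supersolution_interior[OF sol d1(1), where \<Phi> = "\<lambda>s. \<Phi> (- s)"])
        show "continuous_on {0..?h} (\<lambda>s. \<Phi> (- s))"
          by (rule continuous_on_compose2[OF \<Phi>(1)]) (use h in \<open>auto intro!: continuous_intros\<close>)
        show "((\<lambda>s. \<Phi> (- s)) has_real_derivative - p) (at (- t))"
          using \<Phi>(2) by (simp add: DERIV_mirror)
        have "eventually (\<lambda>s. s \<in> {-?h..0}) (at t)"
          by (rule eventually_at_interior_interval[of "- ?h" t 0]) (use t 3 in auto)
        with ev have "eventually (\<lambda>s. u (x + (- t) *\<^sub>R d1) - \<Phi> t \<le> u (x + (- s) *\<^sub>R d1) - \<Phi> s) (at t)"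
          by eventually_elim (use 3 \<gamma>1 in simp)
        then show "eventually (\<lambda>s. u (x + (- t) *\<^sub>R d1) - \<Phi> (- (- t)) \<le> u (x + s *\<^sub>R d1) - \<Phi> (- s)) (at (- t))"
          by (simp add: eventually_filtermap flip: filtermap_at_minus)
      qed (use t 3 in auto)
      then show ?thesis using 3 \<gamma>1[of t] by simp
    qed
  qed (use h \<gamma>g fpos in auto)
  then show thesis
  proof
    assume "u (\<gamma> (- ?h)) + \<bar>F 0 - F (- ?h)\<bar> \<le> u (\<gamma> 0)"
    then have "u (x + ?h *\<^sub>R d1) + \<bar>- F (- ?h) - (- F (- 0))\<bar> \<le> u x"
      using \<gamma>1[of "- ?h"] \<gamma>1[of 0] h by simp
    \<comment> \<open>Read outward from \<open>x\<close>, the first edge is traversed against the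
      curve, which reverses its antiderivative.\<close>
    moreover have "((\<lambda>s. - F (- s)) has_real_derivative f (x + t *\<^sub>R d1)) (at t within {0..?h})"
      if t: "t \<in> {0..?h}" for t
    proof -
      have im: "uminus ` {0..?h} = {-?h..0}" by simp
      have "(F has_real_derivative f (\<gamma> (- t))) (at (- t) within uminus ` {0..?h})"
        unfolding im using t h by (intro DERIV_subset[OF F]) auto
      then have "((\<lambda>s. F (- s)) has_real_derivative f (\<gamma> (- t)) * -1) (at t within {0..?h})"
        by (rule DERIV_image_chain[unfolded o_def]) (auto intro!: derivative_eq_intros)
      from DERIV_minus[OF this] show ?thesis using \<gamma>1[of "- t"] t by simp
    qed
    ultimately show thesis using that[of d1 "\<lambda>s. - F (- s)"] d1(1) by simp
  next
    assume "u (\<gamma> ?h) + \<bar>F ?h - F 0\<bar> \<le> u (\<gamma> 0)"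
    then have "u (x + ?h *\<^sub>R d2) + \<bar>F ?h - F 0\<bar> \<le> u x"
      using \<gamma>2[of ?h] \<gamma>2[of 0] h by simp
    moreover have "(F has_real_derivative f (x + t *\<^sub>R d2)) (at t within {0..?h})"
      if t: "t \<in> {0..?h}" for t
      using DERIV_subset[OF F, of t "{0..?h}"] t h \<gamma>2[of t] by simp
    ultimately show thesis using that[of d2 F] d2(1) by simp
  qed
qed

end

section \<open>Metric solutions along curves\<close>

lemma derivative_remainder_tendsto_0:
  assumes "(\<phi> has_real_derivative p) (at t)"
  shows "((\<lambda>s. (\<phi> s - \<phi> t - p * (s - t)) / \<bar>s - t\<bar>) \<longlongrightarrow> 0) (at t)"
proof -
  have "((\<lambda>s. norm (\<phi> s - \<phi> t - p * (s - t)) / norm (s - t)) \<longlongrightarrow> 0) (at t)"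
    using assms unfolding has_field_derivative_def has_derivative_iff_norm by simp
  then have "((\<lambda>s. \<bar>(\<phi> s - \<phi> t - p * (s - t)) / \<bar>s - t\<bar>\<bar>) \<longlongrightarrow> 0) (at t)"
    by simp
  then show ?thesis by (rule tendsto_rabs_zero_cancel)
qed

lemma local_max_imp_superdiff:
  assumes D: "(\<phi> has_real_derivative p) (at t)"
    and ev: "eventually (\<lambda>s. w s - \<phi> s \<le> w t - \<phi> t) (at t)"
  shows "p \<in> superdiff w t"
proof -
  let ?q = "\<lambda>s. ereal ((w s - w t - p * (s - t)) / \<bar>s - t\<bar>)"
    and ?r = "\<lambda>s. ereal ((\<phi> s - \<phi> t - p * (s - t)) / \<bar>s - t\<bar>)"
  have "eventually (\<lambda>s. ?q s \<le> ?r s) (at t)"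
    using ev by eventually_elim (auto intro!: divide_right_mono)
  then have "Limsup (at t) ?q \<le> Limsup (at t) ?r" by (rule Limsup_mono)
  also have "(?r \<longlongrightarrow> ereal 0) (at t)"
    using derivative_remainder_tendsto_0[OF D] by (intro tendsto_intros)
  then have "Limsup (at t) ?r = ereal 0"
    by (rule lim_imp_Limsup[OF trivial_limit_at])
  finally show ?thesis by (simp add: superdiff_def zero_ereal_def)
qed

lemma local_min_imp_subdiff:
  assumes D: "(\<phi> has_real_derivative p) (at t)"
    and ev: "eventually (\<lambda>s. w t - \<phi> t \<le> w s - \<phi> s) (at t)"
  shows "p \<in> subdiff w t"
proof -
  let ?q = "\<lambda>s. ereal ((w s - w t - p * (s - t)) / \<bar>s - t\<bar>)"
    and ?r = "\<lambda>s. ereal ((\<phi> s - \<phi> t - p * (s - t)) / \<bar>s - t\<bar>)"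
  have "(?r \<longlongrightarrow> ereal 0) (at t)"
    using derivative_remainder_tendsto_0[OF D] by (intro tendsto_intros)
  then have "ereal 0 = Liminf (at t) ?r"
    by (rule lim_imp_Liminf[OF trivial_limit_at, symmetric])
  also have "eventually (\<lambda>s. ?r s \<le> ?q s) (at t)"
    using ev by eventually_elim (auto intro!: divide_right_mono)
  then have "Liminf (at t) ?r \<le> Liminf (at t) ?q" by (rule Liminf_mono)
  finally show ?thesis by (simp add: subdiff_def zero_ereal_def)
qed

text \<open>An infimum over the empty set is infinite, so finiteness says that the boundary is hit;
  the set of hitting times is closed and contains its infimum.\<close>

lemma hit_forward_attained:
  assumes cont: "continuous_on UNIV \<xi>" and fin: "\<bar>hit_forward a \<xi>\<bar> \<noteq> \<infinity>"
  obtains T where "0 \<le> T" "\<xi> T \<in> bdry a" "hit_forward a \<xi> = ereal T"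
proof -
  let ?H = "{t. 0 \<le> t \<and> \<xi> t \<in> bdry a}"
  have "closed (bdry a)" by (intro finite_imp_closed) simp
  then have "closed (\<xi> -` bdry a)" using cont by (rule closed_vimage)
  then have "closed ({0..} \<inter> \<xi> -` bdry a)" by (intro closed_Int closed_atLeast)
  moreover have "?H = {0..} \<inter> \<xi> -` bdry a" by auto
  ultimately have cl: "closed ?H" by (simp only:)
  have ne: "?H \<noteq> {}"
  proof
    assume e: "?H = {}"
    have "hit_forward a \<xi> = \<infinity>" unfolding hit_forward_def e by (simp add: top_ereal_def)
    then show False using fin by simp
  qed
  have bdd: "bdd_below ?H" by (rule bdd_belowI[of _ 0]) simp
  have mem: "Inf ?H \<in> ?H" by (rule closed_contains_Inf[OF ne bdd cl])
  have "hit_forward a \<xi> = ereal (Inf ?H)"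
    unfolding hit_forward_def
  proof (rule antisym)
    show "(INF t\<in>?H. ereal t) \<le> ereal (Inf ?H)" using mem by (rule INF_lower)
    show "ereal (Inf ?H) \<le> (INF t\<in>?H. ereal t)"
      by (rule INF_greatest) (simp add: cInf_lower bdd)
  qed
  then show thesis using mem by (intro that[of "Inf ?H"]) auto
qed

lemma hit_backward_reverse: "hit_backward a \<xi> = - hit_forward a (\<lambda>t. \<xi> (- t))"
proof -
  have "{t. t \<le> 0 \<and> \<xi> t \<in> bdry a} = uminus ` {t. 0 \<le> t \<and> \<xi> (- t) \<in> bdry a}"
  proof (intro set_eqI iffI)
    fix t assume "t \<in> {t. t \<le> 0 \<and> \<xi> t \<in> bdry a}"
    then show "t \<in> uminus ` {t. 0 \<le> t \<and> \<xi> (- t) \<in> bdry a}"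
      by (intro image_eqI[of _ _ "- t"]) simp_all
  qed auto
  then have "hit_backward a \<xi> = (SUP t\<in>{t. 0 \<le> t \<and> \<xi> (- t) \<in> bdry a}. - ereal t)"
    unfolding hit_backward_def by (simp add: image_image)
  then show ?thesis unfolding hit_forward_def by (simp only: ereal_SUP_uminus_eq)
qed

context equilateral
begin

section \<open>Metric solutions on edges and along optimal curves\<close>

text \<open>Semicontinuity is given only along admissible curves, so each estimate of
  \<open>U\<close> has to follow such a curve.\<close>

lemma metric_solution_along_curve:
  assumes "metric_solution a f U" "admissible a I \<xi>"
  shows "continuous_on I (\<lambda>t. U (\<xi> t))"
proof -
  have "usc_on I (U \<circ> \<xi>)" "lsc_on I (U \<circ> \<xi>)"
    using assms unfolding metric_solution_def metric_subsolution_def metric_supersolution_def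
      arcwise_usc_def arcwise_lsc_def by blast+
  then show ?thesis using usc_lsc_imp_continuous by (metis comp_def continuous_on_cong)
qed

text \<open>The shift \<open>t\<close> places the chosen point of the edge at time 0, where the
  subsolution condition is tested. The speed is 1 because the edge is a geodesic.\<close>

lemma ray_admissible:
  assumes ray: "edge_ray n P d" and I: "is_interval I" "s0 \<in> I" "t0 \<in> I" "s0 \<noteq> t0"
    and sub: "\<And>s. s \<in> I \<Longrightarrow> t + s \<in> {0..edge_length n}"
  shows "admissible a I (\<lambda>s. P + (t + s) *\<^sub>R d)"
proof (rule unit_speed_admissible[OF I])
  show "(\<lambda>s. P + (t + s) *\<^sub>R d) ` I \<subseteq> gasket a"
    using ray_in_gasket[OF ray sub] by blast
next
  fix s r assume sr: "s \<in> I" "r \<in> I"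
  have "closed_segment (P + (t + s) *\<^sub>R d) (P + (t + r) *\<^sub>R d) \<subseteq> ray_edge n P d"
    using sr by (intro closed_segment_subset ray_in_edge sub) auto
  also have "\<dots> \<subseteq> gasket a" using edge_rayD(2)[OF ray] by (rule edge_subset_gasket)
  finally have "geodist a (P + (t + s) *\<^sub>R d) (P + (t + r) *\<^sub>R d) = dist (P + (t + s) *\<^sub>R d) (P + (t + r) *\<^sub>R d)"
    by (rule geodist_segment)
  also have "\<dots> = \<bar>(t + s) - (t + r)\<bar>" by (rule dist_ray[OF edge_rayD(1)[OF ray]])
  finally show "geodist a (P + (t + s) *\<^sub>R d) (P + (t + r) *\<^sub>R d) = \<bar>s - r\<bar>" by simp
qed

lemma metric_solution_on_ray:
  assumes sol: "metric_solution a f U" and ray: "edge_ray n P d"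
    and F: "\<And>t. t \<in> {0..edge_length n} \<Longrightarrow>
      (F has_real_derivative f (P + t *\<^sub>R d)) (at t within {0..edge_length n})"
    and st: "s \<in> {0..edge_length n}" "t \<in> {0..edge_length n}"
  shows "\<bar>U (P + s *\<^sub>R d) - U (P + t *\<^sub>R d)\<bar> \<le> \<bar>F s - F t\<bar>"
proof (rule suboptimality_interval[OF _ F _ st])
  let ?h = "edge_length n"
  have "admissible a {0..?h} (\<lambda>s. P + (0 + s) *\<^sub>R d)"
    by (rule ray_admissible[OF ray, of _ 0 ?h]) (use edge_length_pos[of n] in auto)
  from metric_solution_along_curve[OF sol this]
  show "continuous_on {0..?h} (\<lambda>s. U (P + s *\<^sub>R d))" by simp
next
  let ?h = "edge_length n"
  fix t \<Phi> p assume t: "0 < t" "t < ?h"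
    and \<Phi>: "(\<Phi> has_real_derivative p) (at t)"
    and ev: "eventually (\<lambda>s. U (P + s *\<^sub>R d) - \<Phi> s \<le> U (P + t *\<^sub>R d) - \<Phi> t) (at t)"
  \<comment> \<open>The open interval keeps the curve off the ends of the edge, hence off the
    boundary, whose points are vertices of every level.\<close>
  let ?I = "{- t<..<?h - t}" and ?\<xi> = "\<lambda>s. P + (t + s) *\<^sub>R d"
  have adm: "admissible a ?I ?\<xi>"
    by (rule ray_admissible[OF ray, of _ 0 "(?h - t) / 2"]) (use t in \<open>auto simp: field_simps\<close>)
  have int: "?\<xi> s \<in> gasket a - bdry a" if "s \<in> ?I" for s
    using that ray_in_gasket[OF ray, of "t + s"] ray_interior_not_vertex[OF ray, of "t + s"]
      bdry_subset_vertices[of a n] by auto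
  have "p \<in> superdiff (U \<circ> ?\<xi>) 0"
  proof (rule local_max_imp_superdiff[where \<phi> = "\<lambda>s. \<Phi> (t + s)"])
    show "((\<lambda>s. \<Phi> (t + s)) has_real_derivative p) (at 0)"
      using \<Phi> DERIV_shift[of \<Phi> p 0 t] by (simp add: add.commute)
    show "eventually (\<lambda>s. (U \<circ> ?\<xi>) s - \<Phi> (t + s) \<le> (U \<circ> ?\<xi>) 0 - \<Phi> (t + 0)) (at 0)"
      using ev by (simp add: at_to_0[of t] eventually_filtermap add.commute)
  qed
  moreover have "0 \<in> ?I" "open ?I" using t by auto
  moreover have "?\<xi> ` ?I \<subseteq> gasket a - bdry a" by (rule image_subsetI) (rule int)
  moreover have "?\<xi> 0 \<in> gasket a - bdry a" using int[of 0] t by simp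
  ultimately have "\<bar>p\<bar> \<le> f (?\<xi> 0)"
    using sol adm unfolding metric_solution_def metric_subsolution_def by blast
  then show "\<bar>p\<bar> \<le> f (P + t *\<^sub>R d)" by simp
qed

text \<open>The supersolution inequalities are available only strictly before the boundary is hit;
  continuity of \<open>U\<close> along the curve carries the estimate to the hitting time.\<close>

lemma curve_limit:
  assumes cont: "continuous_on UNIV (\<lambda>t. U (\<eta> t))"
    and T: "0 < T" and G: "\<And>t. t \<in> {0..T} \<Longrightarrow> (G has_real_derivative f (\<eta> t)) (at t within {0..T})"
    and le: "\<And>s. 0 < s \<Longrightarrow> s < T \<Longrightarrow> U (\<eta> s) - \<epsilon> + (G s - G 0 - \<epsilon> * s) \<le> b"
  shows "U (\<eta> T) + (G T - G 0) - \<epsilon> * T - \<epsilon> \<le> b"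
proof -
  have "continuous_on {0..T} (\<lambda>s. U (\<eta> s) - \<epsilon> + (G s - G 0 - \<epsilon> * s))"
    by (intro continuous_intros continuous_on_subset[OF cont] DERIV_continuous_on[OF G]) auto
  then have "continuous_on (closure {0<..<T}) (\<lambda>s. U (\<eta> s) - \<epsilon> + (G s - G 0 - \<epsilon> * s))"
    using T by simp
  then have "U (\<eta> T) - \<epsilon> + (G T - G 0 - \<epsilon> * T) \<le> b"
    by (rule continuous_le_on_closure) (use le T in auto)
  then show ?thesis by simp
qed

text \<open>The curve is one of the two halves of the curve provided by the definition of a metric
  supersolution, the backward half being reversed.\<close>

lemma metric_supersolution_curve:
  assumes sol: "metric_solution a f U" and f: "continuous_on (gasket a) f"
    and \<epsilon>: "0 < \<epsilon>" "\<And>x. x \<in> gasket a \<Longrightarrow> \<epsilon> < f x"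
    and x: "x \<in> gasket a - bdry a"
  obtains \<eta> T G where "0 < T" "1-lipschitz_on {0..T} \<eta>" "\<eta> ` {0..T} \<subseteq> gasket a" "\<eta> 0 = x" "\<eta> T \<in> bdry a"
    "\<And>t. t \<in> {0..T} \<Longrightarrow> (G has_real_derivative f (\<eta> t)) (at t within {0..T})"
    "U (\<eta> T) + (G T - G 0) - \<epsilon> * T - \<epsilon> \<le> U x"
proof -
  obtain \<xi> w where \<xi>: "admissible a UNIV \<xi>" "\<xi> 0 = x" and w: "lsc_on UNIV w" "w 0 = U x"
    and fin: "\<bar>hit_forward a \<xi>\<bar> \<noteq> \<infinity>" "\<bar>hit_backward a \<xi>\<bar> \<noteq> \<infinity>"
    and in_time: "\<And>t. hit_backward a \<xi> < ereal t \<and> ereal t < hit_forward a \<xi> \<Longrightarrow>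
      w t \<ge> U (\<xi> t) - \<epsilon> \<and> (\<forall>p\<in>subdiff w t. \<bar>p\<bar> \<ge> f (\<xi> t) - \<epsilon>)"
    using sol x \<epsilon>(1) unfolding metric_solution_def metric_supersolution_def by metis
  have lip: "1-lipschitz_on UNIV \<xi>" using \<xi>(1) by (rule admissible_lipschitz)
  have cont: "continuous_on UNIV \<xi>" using lip by (rule lipschitz_on_continuous_on)
  have gas: "\<xi> t \<in> gasket a" for t
    using \<xi>(1) unfolding admissible_def abs_cont_curve_def by blast
  have contU: "continuous_on UNIV (\<lambda>t. U (\<xi> t))" using metric_solution_along_curve[OF sol \<xi>(1)] .
  have contr: "continuous_on UNIV (\<lambda>t. \<xi> (- t))"
    by (rule continuous_on_compose2[OF cont]) (auto intro!: continuous_intros)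
  have contUr: "continuous_on UNIV (\<lambda>t. U (\<xi> (- t)))"
    by (rule continuous_on_compose2[OF contU]) (auto intro!: continuous_intros)
  obtain T where T: "0 \<le> T" "\<xi> T \<in> bdry a" "hit_forward a \<xi> = ereal T"
    using hit_forward_attained[OF cont fin(1)] .
  have "\<bar>hit_forward a (\<lambda>t. \<xi> (- t))\<bar> \<noteq> \<infinity>" using fin(2) by (simp add: hit_backward_reverse)
  then obtain R where R: "0 \<le> R" "\<xi> (- R) \<in> bdry a" "hit_backward a \<xi> = ereal (- R)"
    using hit_forward_attained[OF contr] by (metis hit_backward_reverse uminus_ereal.simps(1))
  have TR: "0 < T" "0 < R" using T R x \<xi>(2) by (auto simp: less_le)
  have "continuous_on {-R..T} (\<lambda>t. f (\<xi> t))"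
    by (rule continuous_on_compose2[OF f continuous_on_subset[OF cont]]) (use gas in auto)
  from antiderivative_continuous[OF this] obtain G
    where G: "\<And>t. t \<in> {-R..T} \<Longrightarrow> (G has_real_derivative f (\<xi> t)) (at t within {-R..T})"
    by (auto simp: has_real_derivative_iff_has_vector_derivative)
  \<comment> \<open>An antiderivative of \<open>f - \<epsilon>\<close>, the lower bound that the
    supersolution condition puts on slopes.\<close>
  define F where "F t = G t - \<epsilon> * t" for t
  have F: "(F has_real_derivative f (\<xi> t) - \<epsilon>) (at t within {-R..T})" if "t \<in> {-R..T}" for t
    unfolding F_def using G[OF that] by (auto intro!: derivative_eq_intros)
  have alt: "U (\<xi> r) - \<epsilon> + \<bar>F 0 - F r\<bar> \<le> U x \<or> U (\<xi> s) - \<epsilon> + \<bar>F s - F 0\<bar> \<le> U x"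
    if rs: "- R < r" "r < 0" "0 < s" "s < T" for r s
  proof -
    have "w r + \<bar>F 0 - F r\<bar> \<le> w 0 \<or> w s + \<bar>F s - F 0\<bar> \<le> w 0"
    proof (rule superoptimality_interval[OF rs(2,3), where c = "\<lambda>t. f (\<xi> t) - \<epsilon>"])
      show "lsc_on {r..s} w"
        using w(1) by (rule lsc_on_subset) simp
      show "(F has_real_derivative f (\<xi> t) - \<epsilon>) (at t within {r..s})" if "t \<in> {r..s}" for t
        using that rs by (intro DERIV_subset[OF F]) auto
      show "0 < f (\<xi> t) - \<epsilon>" for t using \<epsilon>(2)[OF gas] by simp
      fix t \<Phi> p assume t: "r < t" "t < s" and "(\<Phi> has_real_derivative p) (at t)"
        "eventually (\<lambda>s. w t - \<Phi> t \<le> w s - \<Phi> s) (at t)"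
      then have "p \<in> subdiff w t" by (intro local_min_imp_subdiff)
      then show "f (\<xi> t) - \<epsilon> \<le> \<bar>p\<bar>" using in_time[of t] t rs by (auto simp: T(3) R(3))
    qed
    moreover have "w r \<ge> U (\<xi> r) - \<epsilon>" "w s \<ge> U (\<xi> s) - \<epsilon>"
      using in_time[of r] in_time[of s] rs by (auto simp: T(3) R(3))
    ultimately show ?thesis using w(2) by linarith
  qed
  \<comment> \<open>Since \<open>alt\<close> holds for every pair \<open>r\<close>,
    \<open>s\<close>, one failing \<open>s\<close> forces the backward estimate for all
    \<open>r\<close>: one of the two halves is good up to its end.\<close>
  show thesis
  proof (cases "\<forall>s. 0 < s \<longrightarrow> s < T \<longrightarrow> U (\<xi> s) - \<epsilon> + \<bar>F s - F 0\<bar> \<le> U x")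
    case True
    have G': "(G has_real_derivative f (\<xi> t)) (at t within {0..T})" if "t \<in> {0..T}" for t
      using that TR by (intro DERIV_subset[OF G]) auto
    have "U (\<xi> T) + (G T - G 0) - \<epsilon> * T - \<epsilon> \<le> U x"
      by (rule curve_limit[where U = U and \<eta> = \<xi>, OF contU TR(1) G']) (use True in \<open>fastforce simp: F_def\<close>)+
    then show thesis
      using that[of T \<xi> G] TR(1) lipschitz_on_subset[OF lip] gas \<xi>(2) T(2) G' by blast
  next
    case False
    then have all: "U (\<xi> r) - \<epsilon> + \<bar>F 0 - F r\<bar> \<le> U x" if "- R < r" "r < 0" for r
      using alt that by blast
    have G': "((\<lambda>s. - G (- s)) has_real_derivative f (\<xi> (- t))) (at t within {0..R})" if t: "t \<in> {0..R}" for t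
    proof -
      have im: "uminus ` {0..R} = {-R..0}" by simp
      have "(G has_real_derivative f (\<xi> (- t))) (at (- t) within uminus ` {0..R})"
        unfolding im using t TR by (intro DERIV_subset[OF G]) auto
      then have "((\<lambda>s. G (- s)) has_real_derivative f (\<xi> (- t)) * -1) (at t within {0..R})"
        by (rule DERIV_image_chain[unfolded o_def]) (auto intro!: derivative_eq_intros)
      from DERIV_minus[OF this] show ?thesis by simp
    qed
    have "U (\<xi> (- R)) + (- G (- R) - (- G (- 0))) - \<epsilon> * R - \<epsilon> \<le> U x"
    proof (rule curve_limit[where U = U and \<eta> = "\<lambda>t. \<xi> (- t)", OF contUr TR(2) G'])
      fix s assume "0 < s" "s < R"
      then show "U (\<xi> (- s)) - \<epsilon> + (- G (- s) - - G (- 0) - \<epsilon> * s) \<le> U x"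
        using all[of "- s"] abs_ge_self[of "F 0 - F (- s)"] by (simp add: F_def)
    qed
    moreover have "1-lipschitz_on {0..R} (\<lambda>t. \<xi> (- t))"
    proof (rule lipschitz_onI)
      fix s t show "dist (\<xi> (- s)) (\<xi> (- t)) \<le> 1 * dist s t"
        using lipschitz_onD[OF lip, of "- s" "- t"] by (simp add: dist_real_def)
    qed simp
    ultimately show thesis
      using that[of R "\<lambda>t. \<xi> (- t)" "\<lambda>s. - G (- s)"] TR(2) gas \<xi>(2) R(2) G' by auto
  qed
qed

end

section \<open>Comparison of the two solutions\<close>

text \<open>It expresses a cost as one value of \<open>f\<close> times a duration, so that bounds
  and oscillation estimates for \<open>f\<close> apply to it.\<close>

lemma antiderivative_difference:
  fixes F c :: "real \<Rightarrow> real"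
  assumes F: "\<And>t. t \<in> {\<alpha>..\<beta>} \<Longrightarrow> (F has_real_derivative c t) (at t within {\<alpha>..\<beta>})"
    and st: "\<alpha> \<le> s" "s < t" "t \<le> \<beta>"
  obtains z where "s < z" "z < t" "F t - F s = c z * (t - s)"
proof (rule mvt[OF st(2), of F "\<lambda>z y. c z * y"])
  show "continuous_on {s..t} F"
    by (rule continuous_on_subset[OF DERIV_continuous_on[OF F]]) (use st in auto)
next
  fix z assume "s < z" "z < t"
  then show "(F has_derivative (\<lambda>y. c z * y)) (at z)"
    using F[of z] st by (simp add: at_within_Icc_at has_field_derivative_def)
qed (rule that)

context equilateral
begin

lemma corner_in_gasket: "a i \<in> gasket a"
  using vertices_subset_gasket[of a 0] by (auto simp: vertices_0)

section \<open>Costs of edges and the bound for the metric solution at vertices\<close>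

lemma ray_antiderivative:
  assumes f: "continuous_on (gasket a) f" and ray: "edge_ray n P d"
  obtains F where "\<And>t. t \<in> {0..edge_length n} \<Longrightarrow>
    (F has_real_derivative f (P + t *\<^sub>R d)) (at t within {0..edge_length n})"
proof -
  have "continuous_on {0..edge_length n} (\<lambda>t. f (P + t *\<^sub>R d))"
    by (rule continuous_on_compose2[OF f])
       (use ray_in_gasket[OF ray] in \<open>auto intro!: continuous_intros\<close>)
  from antiderivative_continuous[OF this] show thesis
    using that by (auto simp: has_real_derivative_iff_has_vector_derivative)
qed

lemma ray_cost_bound:
  assumes F: "\<And>t. t \<in> {0..edge_length n} \<Longrightarrow>
      (F has_real_derivative f (P + t *\<^sub>R d)) (at t within {0..edge_length n})"
    and ray: "edge_ray n P d"
    and fM: "\<And>x. x \<in> gasket a \<Longrightarrow> \<bar>f x\<bar> \<le> M"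
    and st: "s \<in> {0..edge_length n}" "t \<in> {0..edge_length n}"
  shows "\<bar>F s - F t\<bar> \<le> M * edge_length n"
proof -
  have M: "M \<ge> 0" using fM[OF ray_in_gasket[OF ray st(1)]] by linarith
  have *: "\<bar>F s - F t\<bar> \<le> M * edge_length n" if st: "0 \<le> s" "s < t" "t \<le> edge_length n" for s t
  proof -
    obtain z where z: "s < z" "z < t" "F t - F s = f (P + z *\<^sub>R d) * (t - s)"
      using antiderivative_difference[OF F st] .
    have "\<bar>f (P + z *\<^sub>R d)\<bar> \<le> M" using z that by (intro fM ray_in_gasket[OF ray]) auto
    then have "\<bar>f (P + z *\<^sub>R d)\<bar> * (t - s) \<le> M * edge_length n"
      using that M by (intro mult_mono) auto
    moreover have "\<bar>F s - F t\<bar> = \<bar>f (P + z *\<^sub>R d)\<bar> * (t - s)"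
      using z(3) that by (simp add: abs_minus_commute[of "F s"] abs_mult)
    ultimately show ?thesis by simp
  qed
  show ?thesis
    using *[of s t] *[of t s] st M edge_length_pos[of n]
    by (cases s t rule: linorder_cases) (auto simp: abs_minus_commute)
qed

lemma metric_solution_edge_variation:
  assumes sol: "metric_solution a f U" and f: "continuous_on (gasket a) f"
    and fM: "\<And>x. x \<in> gasket a \<Longrightarrow> \<bar>f x\<bar> \<le> M"
    and ray: "edge_ray n P d"
    and st: "s \<in> {0..edge_length n}" "t \<in> {0..edge_length n}"
  shows "\<bar>U (P + s *\<^sub>R d) - U (P + t *\<^sub>R d)\<bar> \<le> M * edge_length n"
proof -
  obtain F where F: "\<And>t. t \<in> {0..edge_length n} \<Longrightarrow>
    (F has_real_derivative f (P + t *\<^sub>R d)) (at t within {0..edge_length n})"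
    using ray_antiderivative[OF f ray] by blast
  show ?thesis
    using metric_solution_on_ray[OF sol ray F st] ray_cost_bound[OF F ray fM st] by linarith
qed

text \<open>If \<open>i\<close> is the last letter of its word, a vertex of level
  \<open>n + 1\<close> equals or is adjacent to the corner that the word gives for
  \<open>a i\<close>. As \<open>a i\<close> is fixed by its own map, that corner has level
  \<open>n\<close>. The edge lengths used add up to \<open>1 - (1/2) ^ n\<close>.\<close>

lemma metric_solution_vertices_bound:
  assumes sol: "metric_solution a f U" and f: "continuous_on (gasket a) f"
    and fM: "\<And>x. x \<in> gasket a \<Longrightarrow> \<bar>f x\<bar> \<le> M"
    and B: "\<And>x. x \<in> bdry a \<Longrightarrow> U x \<le> B"
  shows "x \<in> vertices a n \<Longrightarrow> U x \<le> B + M * (1 - (1/2) ^ n)"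
proof (induction n arbitrary: x)
  case 0
  then show ?case using B by (simp add: vertices_0)
next
  case (Suc n)
  obtain v k where v: "length v = Suc n" "x = psi_word a v (a k)"
    using Suc.prems by (auto simp: vertices_def)
  define w and i where "w = butlast v" and "i = last v"
  have wi: "v = w @ [i]" "length w = n"
    using v(1) by (auto simp: w_def i_def intro: append_butlast_last_id[symmetric])
  let ?y = "psi_word a v (a i)"
  have "?y = psi_word a w (a i)" by (simp add: wi(1) psi_word_append psi_vertex)
  then have "?y \<in> vertices a n" using wi(2) unfolding vertices_def by blast
  then have y: "U ?y \<le> B + M * (1 - (1/2) ^ n)" by (rule Suc.IH)
  have M: "M \<ge> 0"
    using fM[OF corner_in_gasket[of 1]] by linarith
  have h: "M * (1 - (1/2) ^ n) + M * edge_length (Suc n) = M * (1 - (1/2) ^ Suc n)"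
    by (simp add: edge_length_def algebra_simps)
  show ?case
  proof (cases "i = k")
    case True
    moreover have "M * edge_length (Suc n) \<ge> 0" using M edge_length_pos[of "Suc n"] by simp
    ultimately show ?thesis using y h v(2) by simp
  next
    case False
    have "closed_segment ?y x \<in> edges a (Suc n)"
      unfolding edges_conv using v False by blast
    moreover have "dist ?y x = edge_length (Suc n)"
      using v False by (simp add: dist_psi_word dist_corners edge_length_def)
    ultimately obtain d where d: "edge_ray (Suc n) ?y d" "?y + edge_length (Suc n) *\<^sub>R d = x"
      using edge_rayI by blast
    have "\<bar>U (?y + edge_length (Suc n) *\<^sub>R d) - U (?y + 0 *\<^sub>R d)\<bar> \<le> M * edge_length (Suc n)"
      using edge_length_pos[of "Suc n"]
      by (intro metric_solution_edge_variation[OF sol f fM d(1)]) auto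
    then have "\<bar>U x - U ?y\<bar> \<le> M * edge_length (Suc n)" by (simp only: d(2)) simp
    then show ?thesis using y h by linarith
  qed
qed

text \<open>Strictly between the last visit to the current vertex and the next visit to another one
  the curve avoids all vertices of level \<open>n\<close>. The cells are finitely many closed sets
  that meet only in such vertices, so the connected piece lies in a single cell, and by closedness
  so do its ends.\<close>

lemma curve_to_next_vertex:
  fixes \<eta> :: "real \<Rightarrow> real^2"
  assumes lip: "1-lipschitz_on {0..T} \<eta>" and gas: "\<eta> ` {0..T} \<subseteq> gasket a"
    and t: "t \<in> {0..T}" and v: "\<eta> t \<in> vertices a n" "\<eta> T \<in> vertices a n" "\<eta> t \<noteq> \<eta> T"
  obtains t' t1 w where "t \<le> t'" "t' < t1" "t1 \<le> T" "\<eta> t' = \<eta> t" "\<eta> t1 \<in> vertices a n" "\<eta> t1 \<noteq> \<eta> t"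
    "length w = n" "\<eta> ` {t'..t1} \<subseteq> cell a w"
proof -
  have cont: "continuous_on {0..T} \<eta>" using lip by (rule lipschitz_on_continuous_on)
  have closed_hits: "closed ({s..T} \<inter> \<eta> -` A)" if "finite A" "0 \<le> s" for A s
  proof (rule continuous_closed_preimage)
    show "continuous_on {s..T} \<eta>" by (rule continuous_on_subset[OF cont]) (use that in simp)
    show "closed A" using that(1) by (rule finite_imp_closed)
  qed (rule closed_atLeastAtMost)
  let ?L = "{t..T} \<inter> \<eta> -` {\<eta> t}"
  define t' where "t' = Sup ?L"
  have "t' \<in> ?L"
    unfolding t'_def using closed_hits[of "{\<eta> t}" t] t
    by (intro closed_contains_Sup) (auto intro!: bdd_aboveI[of _ T])
  then have t': "t \<le> t'" "t' \<le> T" "\<eta> t' = \<eta> t" by auto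
  have last: "\<eta> s \<noteq> \<eta> t" if "t' < s" "s \<le> T" for s
  proof
    assume "\<eta> s = \<eta> t"
    then have "s \<le> t'" unfolding t'_def using that t'(1)
      by (intro cSup_upper) (auto intro!: bdd_aboveI[of _ T])
    then show False using that by simp
  qed
  let ?N = "{t'..T} \<inter> \<eta> -` (vertices a n - {\<eta> t})"
  define t1 where "t1 = Inf ?N"
  have "t1 \<in> ?N"
    unfolding t1_def using closed_hits[of "vertices a n - {\<eta> t}" t'] t t' v finite_vertices
    by (intro closed_contains_Inf) (auto intro!: bdd_belowI[of _ t'])
  then have t1: "t' \<le> t1" "t1 \<le> T" "\<eta> t1 \<in> vertices a n" "\<eta> t1 \<noteq> \<eta> t" by auto
  then have lt: "t' < t1" using t'(3) by (auto simp: less_le)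
  have free: "\<eta> s \<notin> vertices a n" if "t' < s" "s < t1" for s
  proof
    assume "\<eta> s \<in> vertices a n"
    then have "s \<in> ?N" using last[of s] that t1 by auto
    then have "t1 \<le> s" unfolding t1_def by (intro cInf_lower) (auto intro!: bdd_belowI[of _ t'])
    then show False using that by simp
  qed
  let ?J = "{t'<..<t1}"
  have sub: "{t'..t1} \<subseteq> {0..T}" using t t' t1 by auto
  have conn: "connected (\<eta> ` ?J)"
    by (rule connected_continuous_image[OF continuous_on_subset[OF cont]]) (use sub in auto)
  have mid: "(t' + t1) / 2 \<in> ?J" using lt by auto
  then have "\<eta> ((t' + t1) / 2) \<in> gasket a" using gas sub by auto
  then obtain w where w: "length w = n" "\<eta> ((t' + t1) / 2) \<in> cell a w"
    using gasket_subset_cells[of n] by blast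
  let ?C = "\<Union>v\<in>{v. length v = n} - {w}. cell a v"
  have closedC: "closed ?C" using finite_words by (intro closed_UN) (auto simp: closed_cell)
  have cover: "\<eta> ` ?J \<subseteq> cell a w \<union> ?C"
  proof
    fix y assume "y \<in> \<eta> ` ?J"
    then have "y \<in> gasket a" using gas sub by auto
    then obtain v where "length v = n" "y \<in> cell a v" using gasket_subset_cells[of n] by blast
    then show "y \<in> cell a w \<union> ?C" by (cases "v = w") auto
  qed
  have disjoint: "cell a w \<inter> ?C \<inter> \<eta> ` ?J = {}"
  proof (rule equals0I)
    fix y assume "y \<in> cell a w \<inter> ?C \<inter> \<eta> ` ?J"
    then obtain v s where v: "length v = n" "v \<noteq> w" "y \<in> cell a v" "y \<in> cell a w"
      and s: "s \<in> ?J" "y = \<eta> s" by blast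
    have "y \<in> vertices a n" using cells_meet[of v w y] v w(1) by simp
    then show False using free[of s] s by simp
  qed
  have "cell a w \<inter> \<eta> ` ?J \<noteq> {}" using w(2) mid by blast
  then have "?C \<inter> \<eta> ` ?J = {}"
    using connected_closedD[OF conn disjoint cover closed_cell closedC] by simp
  then have "\<eta> ` ?J \<subseteq> cell a w" using cover by blast
  then have "\<eta> ` closure ?J \<subseteq> cell a w"
    by (intro image_closure_subset closed_cell) (use lt sub in \<open>auto intro: continuous_on_subset[OF cont]\<close>)
  then have "\<eta> ` {t'..t1} \<subseteq> cell a w" using lt by simp
  then show thesis using that[of t' t1 w] t' t1 lt w(1) by blast
qed

end

context parametrized_gasket
begin

section \<open>Comparison of both solutions, first at vertices\<close>

lemma network_solution_edge_variation:
  assumes sol: "network_solution a \<pi> n f u" and f: "continuous_on (gasket a) f"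
    and fM: "\<And>x. x \<in> gasket a \<Longrightarrow> \<bar>f x\<bar> \<le> M"
    and ray: "edge_ray n P d"
    and st: "s \<in> {0..edge_length n}" "t \<in> {0..edge_length n}"
  shows "\<bar>u (P + s *\<^sub>R d) - u (P + t *\<^sub>R d)\<bar> \<le> M * edge_length n"
proof -
  obtain F where F: "\<And>t. t \<in> {0..edge_length n} \<Longrightarrow>
    (F has_real_derivative f (P + t *\<^sub>R d)) (at t within {0..edge_length n})"
    using ray_antiderivative[OF f ray] by blast
  show ?thesis
    using network_subsolution_on_ray[OF sol ray F st] ray_cost_bound[OF F ray fM st] by linarith
qed

lemma network_on_ray:
  assumes "x \<in> network a n"
  obtains P d t where "edge_ray n P d" "t \<in> {0..edge_length n}" "x = P + t *\<^sub>R d"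
proof -
  obtain e where e: "e \<in> edges a n" "x \<in> e" using assms by (auto simp: network_def)
  obtain p q where pq: "e = closed_segment p q" "p \<in> vertices a n"
    using edge_ends[OF e(1)] by metis
  obtain d where d: "edge_ray n p d" "e = ray_edge n p d"
    using edge_ray_at_vertex[of e n p] e(1) pq by auto
  then show thesis using that[OF d(1)] e(2) in_ray_edge by metis
qed

text \<open>A minimiser of \<open>u - U\<close> over the vertices that moreover has the least value of \<open>u\<close> must be a
  boundary vertex, since an inner vertex would pass its minimality on to a lower neighbour.\<close>

lemma metric_le_network_at_vertices:
  assumes net: "network_solution a \<pi> n f u" and met: "metric_solution a f U"
    and f: "continuous_on (gasket a) f" and fpos: "\<And>x. x \<in> gasket a \<Longrightarrow> 0 < f x"
    and bd: "\<And>x. x \<in> bdry a \<Longrightarrow> u x = U x"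
    and x: "x \<in> vertices a n"
  shows "U x \<le> u x"
proof -
  let ?V = "vertices a n"
  define m where "m = Min ((\<lambda>y. u y - U y) ` ?V)"
  have le: "m \<le> u y - U y" if "y \<in> ?V" for y
    unfolding m_def using that finite_vertices by (intro Min_le) auto
  have "m \<in> (\<lambda>y. u y - U y) ` ?V"
    unfolding m_def using x finite_vertices by (intro Min_in) auto
  then have ne: "{y \<in> ?V. u y - U y = m} \<noteq> {}" by blast
  have fin: "finite {y \<in> ?V. u y - U y = m}" using finite_vertices by simp
  obtain p where p: "p \<in> ?V" "u p - U p = m" and pmin: "\<And>y. y \<in> ?V \<Longrightarrow> u y - U y = m \<Longrightarrow> u p \<le> u y"
    using ex_min_if_finite[of "u ` {y \<in> ?V. u y - U y = m}"] fin ne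
    by (auto simp: not_less)
  have "p \<in> bdry a"
  proof (rule ccontr)
    assume "p \<notin> bdry a"
    then have "p \<in> inner_vertices a n" using p by (simp add: inner_vertices_def)
    then obtain d F where ray: "edge_ray n p d" and
      F: "\<And>t. t \<in> {0..edge_length n} \<Longrightarrow>
        (F has_real_derivative f (p + t *\<^sub>R d)) (at t within {0..edge_length n})" and
      step: "u (p + edge_length n *\<^sub>R d) + \<bar>F (edge_length n) - F 0\<bar> \<le> u p"
      using network_supersolution_at_vertex[OF net _ f fpos] by metis
    let ?q = "p + edge_length n *\<^sub>R d"
    have h: "edge_length n > 0" by (rule edge_length_pos)
    obtain z where z: "0 < z" "z < edge_length n" "F (edge_length n) - F 0 = f (p + z *\<^sub>R d) * (edge_length n - 0)"
      using antiderivative_difference[OF F, of 0 "edge_length n"] h by auto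
    have "f (p + z *\<^sub>R d) > 0" using z by (intro fpos ray_in_gasket[OF ray]) auto
    then have pos: "\<bar>F (edge_length n) - F 0\<bar> > 0" using z(3) h by simp
    have "\<bar>U (p + 0 *\<^sub>R d) - U ?q\<bar> \<le> \<bar>F 0 - F (edge_length n)\<bar>"
      by (rule metric_solution_on_ray[OF met ray F]) (use h in auto)
    then have "U p - U ?q \<le> \<bar>F (edge_length n) - F 0\<bar>" by simp
    moreover have q: "?q \<in> ?V" by (rule edge_ray_ends(2)[OF ray])
    ultimately have "u ?q - U ?q = m" using le[OF q] step p(2) by linarith
    then show False using pmin[OF q] step pos by linarith
  qed
  then show ?thesis using bd[of p] p(2) le[OF x] by simp
qed

text \<open>Inside an edge \<open>u\<close> exceeds its value at one of the ends by at least the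
  cost of the way there, and \<open>U\<close> by at most this cost.\<close>

lemma metric_le_network:
  assumes net: "network_solution a \<pi> n f u" and met: "metric_solution a f U"
    and f: "continuous_on (gasket a) f" and fpos: "\<And>x. x \<in> gasket a \<Longrightarrow> 0 < f x"
    and bd: "\<And>x. x \<in> bdry a \<Longrightarrow> u x = U x"
    and x: "x \<in> network a n"
  shows "U x \<le> u x"
proof -
  note vert = metric_le_network_at_vertices[OF net met f fpos bd]
  let ?h = "edge_length n"
  obtain P d t where ray: "edge_ray n P d" and t: "t \<in> {0..?h}" "x = P + t *\<^sub>R d"
    using network_on_ray[OF x] by blast
  have ends: "U P \<le> u P" "U (P + ?h *\<^sub>R d) \<le> u (P + ?h *\<^sub>R d)"
    using edge_ray_ends[OF ray] vert by blast+
  consider "t = 0" | "t = ?h" | "0 < t" "t < ?h" using t(1) by fastforce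
  then show ?thesis
  proof cases
    case 3
    obtain F where F: "\<And>t. t \<in> {0..?h} \<Longrightarrow> (F has_real_derivative f (P + t *\<^sub>R d)) (at t within {0..?h})"
      using ray_antiderivative[OF f ray] by blast
    have h: "0 \<in> {0..?h}" "?h \<in> {0..?h}" using edge_length_pos[of n] by auto
    show ?thesis
      using network_supersolution_on_ray[OF net ray F fpos 3]
        metric_solution_on_ray[OF met ray F t(1) h(1)] metric_solution_on_ray[OF met ray F h(2) t(1)] ends
      unfolding t(2) by auto
  qed (use ends t(2) in auto)
qed

text \<open>The curve is cut at the last visit of the current vertex and at the next vertex it reaches;
  in between it takes at least the time \<open>edge_length n\<close>, which is what crossing the edge costs.\<close>

lemma network_solution_along_curve:
  assumes net: "network_solution a \<pi> n f u" and f: "continuous_on (gasket a) f"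
    and fpos: "\<And>x. x \<in> gasket a \<Longrightarrow> 0 < f x"
    and osc: "\<And>y z. y \<in> gasket a \<Longrightarrow> z \<in> gasket a \<Longrightarrow> dist y z \<le> edge_length n \<Longrightarrow> f y \<le> f z + \<epsilon>"
    and \<epsilon>: "\<epsilon> \<ge> 0"
    and lip: "1-lipschitz_on {0..T} \<eta>" and gas: "\<eta> ` {0..T} \<subseteq> gasket a" and T: "\<eta> T \<in> vertices a n"
    and G: "\<And>t. t \<in> {0..T} \<Longrightarrow> (G has_real_derivative f (\<eta> t)) (at t within {0..T})"
  shows "t \<in> {0..T} \<Longrightarrow> \<eta> t \<in> vertices a n \<Longrightarrow> T - t < real k * edge_length n \<Longrightarrow>
    u (\<eta> t) \<le> u (\<eta> T) + (G T - G t) + \<epsilon> * (T - t)"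
proof (induction k arbitrary: t)
  \<comment> \<open>The hypothesis would say \<open>T - t < 0\<close>. In general \<open>k\<close>
    bounds the number of remaining passages, each of which takes at least the time
    \<open>edge_length n\<close>.\<close>
  case 0
  then show ?case by simp
next
  case (Suc k)
  have mono: "G s \<le> G r" if "0 \<le> s" "s \<le> r" "r \<le> T" for s r
  proof (cases "s = r")
    case False
    then obtain z where z: "s < z" "z < r" "G r - G s = f (\<eta> z) * (r - s)"
      using antiderivative_difference[OF G, of s r] \<open>0 \<le> s\<close> \<open>s \<le> r\<close> \<open>r \<le> T\<close> by auto
    have "\<eta> z \<in> gasket a" using gas z that by auto
    then have "f (\<eta> z) * (r - s) \<ge> 0" using fpos[of "\<eta> z"] that by simp
    then show ?thesis using z(3) by linarith
  qed simp
  show ?case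
  proof (cases "\<eta> t = \<eta> T")
    case True
    have "\<epsilon> * (T - t) \<ge> 0" using \<epsilon> Suc.prems(1) by simp
    then show ?thesis using True mono[of t T] Suc.prems(1) by simp
  next
    case False
    obtain t' t1 w where tt: "t \<le> t'" "t' < t1" "t1 \<le> T" "\<eta> t' = \<eta> t" "\<eta> t1 \<in> vertices a n" "\<eta> t1 \<noteq> \<eta> t"
      and w: "length w = n" "\<eta> ` {t'..t1} \<subseteq> cell a w"
      using curve_to_next_vertex[OF lip gas Suc.prems(1,2) T False] by metis
    let ?h = "edge_length n"
    have t0: "0 \<le> t" using Suc.prems(1) by simp
    have "\<eta> t' \<in> cell a w" "\<eta> t1 \<in> cell a w" using w(2) tt(2) by auto
    then obtain i j where ij: "\<eta> t = psi_word a w (a i)" "\<eta> t1 = psi_word a w (a j)"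
      using vertex_in_cell[of _ w] w(1) tt(4,5) Suc.prems(2) by metis
    then have "i \<noteq> j" using tt(6) by auto
    have e: "closed_segment (\<eta> t) (\<eta> t1) \<in> edges a n"
      unfolding edges_conv ij using \<open>i \<noteq> j\<close> w(1) by blast
    have dist: "dist (\<eta> t) (\<eta> t1) = ?h"
      unfolding ij using \<open>i \<noteq> j\<close> w(1) by (simp add: dist_psi_word dist_corners edge_length_def)
    have "dist (\<eta> t') (\<eta> t1) \<le> 1 * dist t' t1"
      by (rule lipschitz_onD[OF lip]) (use tt t0 in auto)
    then have h_le: "?h \<le> t1 - t'" using dist tt(2,4) by (simp add: dist_real_def)
    obtain d where d: "edge_ray n (\<eta> t) d" "\<eta> t + ?h *\<^sub>R d = \<eta> t1"
      using edge_rayI[OF e dist] by blast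
    obtain F where F: "\<And>s. s \<in> {0..?h} \<Longrightarrow> (F has_real_derivative f (\<eta> t + s *\<^sub>R d)) (at s within {0..?h})"
      using ray_antiderivative[OF f d(1)] by blast
    have h: "?h > 0" by (rule edge_length_pos)
    obtain z where z: "0 < z" "z < ?h" "F ?h - F 0 = f (\<eta> t + z *\<^sub>R d) * (?h - 0)"
      using antiderivative_difference[OF F, of 0 ?h] h by auto
    let ?z = "\<eta> t + z *\<^sub>R d"
    have zg: "?z \<in> gasket a" using z by (intro ray_in_gasket[OF d(1)]) auto
    have "?z \<in> closed_segment (\<eta> t) (\<eta> t1)"
      using ray_in_edge[of z n "\<eta> t" d] z d(2) by simp
    then have zc: "?z \<in> cell a w"
      unfolding ij psi_word_segment[symmetric] cell_def using side_subset_triangle by blast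
    have "\<bar>u (\<eta> t + 0 *\<^sub>R d) - u (\<eta> t + ?h *\<^sub>R d)\<bar> \<le> \<bar>F 0 - F ?h\<bar>"
      by (rule network_subsolution_on_ray[OF net d(1) F]) (use h in auto)
    moreover have "\<bar>F 0 - F ?h\<bar> = f ?z * ?h" using z(3) mult_pos_pos[OF fpos[OF zg] h] by simp
    ultimately have step: "u (\<eta> t) \<le> u (\<eta> t1) + f ?z * ?h" by (simp add: d(2))
    obtain s where s: "t' < s" "s < t1" "G t1 - G t' = f (\<eta> s) * (t1 - t')"
      using antiderivative_difference[OF G, of t' t1] t0 tt by auto
    have sg: "\<eta> s \<in> gasket a" using gas s t0 tt by auto
    have "\<eta> s \<in> cell a w" using w(2) s by auto
    then have "dist ?z (\<eta> s) \<le> ?h" using cell_diameter[OF zc] w(1) by (simp add: edge_length_def)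
    then have "f ?z \<le> f (\<eta> s) + \<epsilon>" by (rule osc[OF zg sg])
    \<comment> \<open>A passage slower than necessary only enlarges the right-hand side, since
      \<open>f + \<epsilon>\<close> is positive.\<close>
    then have "f ?z * ?h \<le> (f (\<eta> s) + \<epsilon>) * (t1 - t')"
      using h h_le fpos[OF sg] \<epsilon> by (intro mult_mono) auto
    then have cost: "f ?z * ?h \<le> G t1 - G t' + \<epsilon> * (t1 - t')"
      using s(3) by (simp add: algebra_simps)
    have "T - t1 < real k * ?h" using Suc.prems(3) h_le tt(1) by (simp add: algebra_simps)
    then have IH: "u (\<eta> t1) \<le> u (\<eta> T) + (G T - G t1) + \<epsilon> * (T - t1)"
      using tt t0 by (intro Suc.IH) auto
    \<comment> \<open>The loops of the curve between \<open>t\<close> and \<open>t'\<close> are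
      dropped; their cost is nonnegative.\<close>
    have "G t \<le> G t'" using mono[of t t'] t0 tt by auto
    moreover have "\<epsilon> * t \<le> \<epsilon> * t'" using \<epsilon> tt(1) by (intro mult_left_mono)
    ultimately show ?thesis using step cost IH by (simp add: algebra_simps)
  qed
qed

text \<open>Along an almost optimal curve of duration \<open>T\<close> the slack and the oscillation
  of \<open>f\<close> cost \<open>\<epsilon> * T\<close> each, and a further \<epsilon> comes from
  \<open>w\<close>. The duration satisfies
  \<open>m * T \<le> U x - L + \<epsilon> + \<epsilon> * T\<close>, and
  \<open>2 * \<epsilon> \<le> m\<close> absorbs the last term; inserting the resulting bound on
  \<open>T\<close> into \<open>2 * \<epsilon> * T\<close> gives the factor 4.\<close>

lemma network_le_metric_at_vertices:
  assumes net: "network_solution a \<pi> n f u" and met: "metric_solution a f U"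
    and f: "continuous_on (gasket a) f" and m: "0 < m" "\<And>x. x \<in> gasket a \<Longrightarrow> m \<le> f x"
    and bd: "\<And>x. x \<in> bdry a \<Longrightarrow> u x = U x"
    and osc: "\<And>y z. y \<in> gasket a \<Longrightarrow> z \<in> gasket a \<Longrightarrow> dist y z \<le> edge_length n \<Longrightarrow> f y \<le> f z + \<epsilon>"
    and \<epsilon>: "0 < \<epsilon>" "2 * \<epsilon> \<le> m"
    and L: "\<And>x. x \<in> bdry a \<Longrightarrow> L \<le> U x"
    and x: "x \<in> vertices a n"
  shows "u x \<le> U x + \<epsilon> + 4 * \<epsilon> * (U x - L + \<epsilon>) / m"
proof (cases "x \<in> bdry a")
  case True
  then show ?thesis using bd[OF True] L[OF True] \<epsilon> m(1) by simp
next
  case False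
  have fpos: "0 < f y" "\<epsilon> < f y" if "y \<in> gasket a" for y
    using m(2)[OF that] m(1) \<epsilon> by linarith+
  have "x \<in> gasket a - bdry a" using x False vertices_subset_gasket by blast
  then obtain \<eta> T G where T: "0 < T" and \<eta>: "1-lipschitz_on {0..T} \<eta>" "\<eta> ` {0..T} \<subseteq> gasket a" "\<eta> 0 = x" "\<eta> T \<in> bdry a"
    and G: "\<And>t. t \<in> {0..T} \<Longrightarrow> (G has_real_derivative f (\<eta> t)) (at t within {0..T})"
    and U: "U (\<eta> T) + (G T - G 0) - \<epsilon> * T - \<epsilon> \<le> U x"
    using metric_supersolution_curve[OF met f \<epsilon>(1) fpos(2)] by metis
  have v: "\<eta> T \<in> vertices a n" using \<eta>(4) bdry_subset_vertices by blast
  obtain k :: nat where "T / edge_length n < real k" using reals_Archimedean2 by blast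
  then have "T - 0 < real k * edge_length n"
    using edge_length_pos[of n] by (simp add: pos_divide_less_eq)
  then have "u (\<eta> 0) \<le> u (\<eta> T) + (G T - G 0) + \<epsilon> * (T - 0)"
    using network_solution_along_curve[OF net f fpos(1) osc _ \<eta>(1,2) v G, of 0 k] \<epsilon> T x \<eta>(3) by simp
  then have up: "u x \<le> U x + 2 * (\<epsilon> * T) + \<epsilon>" using U bd[OF \<eta>(4)] \<eta>(3) by simp
  obtain z where z: "0 < z" "z < T" "G T - G 0 = f (\<eta> z) * (T - 0)"
    using antiderivative_difference[OF G, of 0 T] T by auto
  have "m \<le> f (\<eta> z)" using \<eta>(2) z by (intro m(2)) auto
  then have "m * T \<le> G T - G 0" using z(3) T by simp
  moreover have "2 * \<epsilon> * T \<le> m * T" using \<epsilon> T by (intro mult_right_mono) auto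
  ultimately have "m * T \<le> 2 * (U x - L + \<epsilon>)" using U L[OF \<eta>(4)] by (simp add: algebra_simps)
  then have "T \<le> 2 * (U x - L + \<epsilon>) / m" using m(1) by (simp add: pos_le_divide_eq mult.commute)
  then have "2 * \<epsilon> * T \<le> 2 * \<epsilon> * (2 * (U x - L + \<epsilon>) / m)"
    using \<epsilon>(1) by (intro mult_left_mono) auto
  then show ?thesis using up by (simp add: algebra_simps)
qed

end

section \<open>Choice of the constants and uniform convergence\<close>

theorem theorem5p1:
  fixes a :: "3 \<Rightarrow> real^2"
    and \<pi> :: "(real^2) set \<Rightarrow> real \<Rightarrow> real^2"
    and f g U :: "real^2 \<Rightarrow> real"
    and u :: "nat \<Rightarrow> real^2 \<Rightarrow> real"
  assumes "unit_equilateral a"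
    and "arclength_params a \<pi>"
    and "continuous_on (gasket a) f"
    and "(INF x\<in>gasket a. f x) > 0"
    and "compatible a f g"
    and "\<And>n. network_solution a \<pi> n f (u n)"
    and "\<And>n x. x \<in> bdry a \<Longrightarrow> u n x = g x"
    and "metric_solution a f U"
    and "\<And>x. x \<in> bdry a \<Longrightarrow> U x = g x"
  shows "(\<lambda>n. SUP x\<in>network a n. ereal \<bar>u n x - U x\<bar>) \<longlonglongrightarrow> 0"
proof -
  interpret parametrized_gasket a \<pi>
    by unfold_locales (use assms(1,2) in auto)
  note f = assms(3) and net = assms(6) and met = assms(8)
  have bd: "u n x = U x" if "x \<in> bdry a" for n x using assms(7,9) that by simp
  have comp: "compact (f ` gasket a)" by (rule compact_continuous_image[OF f compact_gasket])
  define m where "m = (INF x\<in>gasket a. f x)"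
  have m0: "m > 0" using assms(4) by (simp add: m_def)
  have m: "m \<le> f x" if "x \<in> gasket a" for x
  proof -
    have "bdd_below (f ` gasket a)" using compact_imp_bounded[OF comp] by (rule bounded_imp_bdd_below)
    then show ?thesis unfolding m_def using that by (rule cINF_lower)
  qed
  have fpos: "0 < f x" if "x \<in> gasket a" for x using m[OF that] m0 by linarith
  obtain M where M: "\<And>x. x \<in> gasket a \<Longrightarrow> \<bar>f x\<bar> \<le> M"
    using compact_imp_bounded[OF comp] unfolding bounded_iff by auto
  have M0: "M \<ge> 0"
    using M[OF corner_in_gasket[of 1]] by linarith
  define B L where "B = Max (U ` bdry a)" and "L = Min (U ` bdry a)"
  have BL: "U x \<le> B" "L \<le> U x" if "x \<in> bdry a" for x
    using that unfolding B_def L_def by (auto intro!: Max_ge Min_le)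
  have UB: "U x \<le> B + M" if "x \<in> vertices a n" for x n
  proof -
    have "U x \<le> B + M * (1 - (1/2) ^ n)"
      using metric_solution_vertices_bound[OF met f M BL(1)] that by blast
    also have "\<dots> \<le> B + M" using M0 by (simp add: mult_left_le)
    finally show ?thesis .
  qed
  \<comment> \<open>The vertex error divided by \<epsilon>, with \<open>U\<close> replaced by its
    bound \<open>B + M\<close> at vertices and the inner \<epsilon> by \<open>m\<close>.\<close>
  define K where "K = 1 + 4 * (B + M - L + m) / m"
  have LB: "L \<le> B" using BL[of "a 1"] by simp
  have K: "K > 0" unfolding K_def using LB M0 m0 by (intro add_pos_nonneg divide_nonneg_pos) auto
  have key: "\<exists>N. \<forall>n\<ge>N. \<forall>x\<in>network a n. \<bar>u n x - U x\<bar> \<le> \<delta>" if \<delta>: "\<delta> > 0" for \<delta>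
  proof -
    \<comment> \<open>The cap \<open>m / 2\<close> is what the vertex estimate demands; the other
      one spends half of \<delta> on the vertex error.\<close>
    define \<epsilon> where "\<epsilon> = min (m / 2) (\<delta> / (2 * K))"
    have \<epsilon>: "0 < \<epsilon>" "2 * \<epsilon> \<le> m" "\<epsilon> * K \<le> \<delta> / 2"
      using m0 K \<delta> by (auto simp: \<epsilon>_def min_def field_simps)
    obtain \<rho> where \<rho>: "\<rho> > 0" "\<And>y z. y \<in> gasket a \<Longrightarrow> z \<in> gasket a \<Longrightarrow> dist y z < \<rho> \<Longrightarrow> dist (f y) (f z) < \<epsilon>"
      using compact_uniformly_continuous[OF f compact_gasket] \<epsilon>(1) unfolding uniformly_continuous_on_def
      by metis
    have "(\<lambda>n. edge_length n) \<longlonglongrightarrow> 0" unfolding edge_length_def by (intro LIMSEQ_power_zero) simp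
    \<comment> \<open>Below \<rho> the function \<open>f\<close> varies by less than \<epsilon> in a
      cell. The second bound leaves the other half of \<delta> for moving from a vertex into the
      edge, once for each function; the summand 1 avoids a zero denominator.\<close>
    moreover have "min \<rho> (\<delta> / (4 * (M + 1))) > 0" using \<rho>(1) \<delta> M0 by simp
    ultimately have "eventually (\<lambda>n. edge_length n < min \<rho> (\<delta> / (4 * (M + 1)))) sequentially"
      by (rule order_tendstoD(2))
    then obtain N where N: "\<And>n. n \<ge> N \<Longrightarrow> edge_length n < min \<rho> (\<delta> / (4 * (M + 1)))"
      by (auto simp: eventually_sequentially)
    have "\<bar>u n x - U x\<bar> \<le> \<delta>" if n: "n \<ge> N" and x: "x \<in> network a n" for n x
    proof -
      let ?h = "edge_length n"
      have h: "?h > 0" "?h < \<rho>" "?h < \<delta> / (4 * (M + 1))" using N[OF n] edge_length_pos by auto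
      have "4 * (M + 1) * ?h < \<delta>" using h(3) M0 by (simp add: pos_less_divide_eq mult.commute)
      moreover have "4 * (M * ?h) \<le> 4 * (M + 1) * ?h" using h(1) by (simp add: algebra_simps)
      ultimately have Mh: "2 * (M * ?h) \<le> \<delta> / 2" by simp
      have osc: "f y \<le> f z + \<epsilon>" if "y \<in> gasket a" "z \<in> gasket a" "dist y z \<le> ?h" for y z
        using \<rho>(2)[OF that(1,2)] that(3) h(2) by (simp add: dist_real_def)
      obtain P d t where ray: "edge_ray n P d" and t: "t \<in> {0..?h}" "x = P + t *\<^sub>R d"
        using network_on_ray[OF x] by blast
      have P: "P \<in> vertices a n" by (rule edge_ray_ends(1)[OF ray])
      have 0: "0 \<in> {0..?h}" using h(1) by simp
      have "\<epsilon> + 4 * \<epsilon> * (U P - L + \<epsilon>) / m \<le> \<epsilon> + 4 * \<epsilon> * (B + M - L + m) / m"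
        using UB[OF P] \<epsilon> m0 by (intro add_left_mono divide_right_mono mult_left_mono) auto
      also have "\<dots> = \<epsilon> * K" by (simp add: K_def algebra_simps)
      finally have "u n P \<le> U P + \<delta> / 2"
        using network_le_metric_at_vertices[OF net met f m0 m bd osc \<epsilon>(1,2) BL(2) P] \<epsilon>(3) by linarith
      moreover have "\<bar>u n (P + t *\<^sub>R d) - u n (P + 0 *\<^sub>R d)\<bar> \<le> M * ?h"
        by (rule network_solution_edge_variation[OF net f M ray t(1) 0])
      moreover have "\<bar>U (P + t *\<^sub>R d) - U (P + 0 *\<^sub>R d)\<bar> \<le> M * ?h"
        by (rule metric_solution_edge_variation[OF met f M ray t(1) 0])
      ultimately have "u n x \<le> U x + \<delta>" using Mh t(2) by simp
      moreover have "U x \<le> u n x" by (rule metric_le_network[OF net met f fpos bd x])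
      ultimately show ?thesis by simp
    qed
    then show ?thesis by blast
  qed
  \<comment> \<open>In the extended reals an empty supremum would be minus infinity, so a point of
    the network is exhibited.\<close>
  have nonneg: "0 \<le> (SUP x\<in>network a n. ereal \<bar>u n x - U x\<bar>)" for n
  proof -
    have "a 1 \<in> closed_segment (a 1) (a 2)" by simp
    then have "psi_word a (replicate n 1) (a 1) \<in> psi_word a (replicate n 1) ` closed_segment (a 1) (a 2)" by blast
    moreover have "psi_word a (replicate n 1) ` closed_segment (a 1) (a 2) \<in> edges a n"
      unfolding edges_def by force
    ultimately have "psi_word a (replicate n 1) (a 1) \<in> network a n" unfolding network_def by blast
    then show ?thesis by (rule SUP_upper2) simp
  qed
  show ?thesis
  proof (rule order_tendstoI)
    fix y :: ereal assume "y < 0"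
    then show "eventually (\<lambda>n. y < (SUP x\<in>network a n. ereal \<bar>u n x - U x\<bar>)) sequentially"
      using nonneg by (intro always_eventually) (auto intro: less_le_trans)
  next
    fix y :: ereal assume "0 < y"
    then obtain \<delta> where \<delta>: "0 < ereal \<delta>" "ereal \<delta> < y" using ereal_dense2 by blast
    then obtain N where N: "\<And>n x. n \<ge> N \<Longrightarrow> x \<in> network a n \<Longrightarrow> \<bar>u n x - U x\<bar> \<le> \<delta>"
      using key[of \<delta>] by auto
    have "(SUP x\<in>network a n. ereal \<bar>u n x - U x\<bar>) < y" if "n \<ge> N" for n
      using N[OF that] by (intro le_less_trans[OF SUP_least \<delta>(2)]) simp
    then show "eventually (\<lambda>n. (SUP x\<in>network a n. ereal \<bar>u n x - U x\<bar>) < y) sequentially"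
      unfolding eventually_sequentially by blast
  qed
qed

end
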